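(* Among the quasi-homogeneous linear systems $\mathcal{L}(d, m_0, n, 4)$, with $d, m_0, n$ non-negative integers, the $(-1)$ special ones are exactly the following systems: $$\begin{array}{ll} \mathcal{L}(d, d, e, 4) & \text{with } d \geq 4e \geq 4,\\ \mathcal{L}(d, d-1, e, 4) & \text{with } d \geq \frac{7}{2}e \geq 1,\\ \mathcal{L}(d, d-2, e, 4) & \text{with } d \geq \frac{9e+1}{3} \geq \frac{10}{3},\\ \mathcal{L}(6e, 6e-2, 2e, 4) & \text{with } e\geq 1,\\ \mathcal{L}(5e, 5e-3, 2e, 4) & \text{with } e\geq 1,\\ \mathcal{L}(5e+1, 5e-2, 2e, 4) & \text{with } e\geq 1,\\ \mathcal{L}(4e, 4e-4, 2e, 4) & \text{with } e\geq 1,\\ \mathcal{L}(4e+1, 4e-3, 2e, 4) & \text{with } e\geq 1,\\ \mathcal{L}(4e+2, 4e-2, 2e, 4) & \text{with } e\geq 1, \end{array}$$ (where $d$ and $e$ denote integers), together with $$\begin{array}{l} \mathcal{L}(5, 0, 2, 4),\ \mathcal{L}(6, 1, 2, 4),\ \mathcal{L}(8, 3, 4, 4),\ \mathcal{L}(9, 4, 4, 4),\ \mathcal{L}(12, 7, 6, 4),\ \mathcal{L}(15, 10, 8, 4),\\ \mathcal{L}(6, 0, 2, 4),\ \mathcal{L}(6, 0, 3, 4),\ \mathcal{L}(8, 2, 4, 4),\ \mathcal{L}(12, 6, 7, 4),\\ \mathcal{L}(9, 2, 5, 4),\ \mathcal{L}(8, 0, 5, 4),\ \mathcal{L}(9,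 1, 5, 4),\ \mathcal{L}(9, 0, 5, 4). \end{array}$$
   Context: Work in the projective plane over $\mathbb{C}$ and let $p_0, p_1, \dots, p_n$ be points in general position. Linear systems. $\mathcal{L}(d, m_0, n, m)$ denotes the linear system of plane curves of degree $d$ with multiplicity at least $m_0$ at $p_0$ and at least $m$ at each of $p_1, \dots, p_n$ (a quasi-homogeneous system). More generally, the system of curves of degree $d$ with multiplicities $m_i$ at $p_i$ ($0 \le i \le n$) has virtual dimension $$v = \frac{d(d+3)}{2} - \sum_{i=0}^n \frac{m_i(m_i+1)}{2}.$$ The intersection number of the systems (or curves) with data $(d; m_0,\dots,m_n)$ and $(d'; m_0',\dots,m_n')$ is $dd' - \sum_i m_i m_i'$. $(-1)$ curves. A $(-1)$ curve is an irreducible plane curve of degree $\delta$ with multiplicities $\mu_i$ at $p_i$ ($0\le i\le n$) such that $\delta^2 - \sum_i \mu_i^2 = -1$ (self-intersection $-1$) and $\frac{(\delta-1)(\delta-2)}{2} - \sum_i \frac{\mu_i(\mu_i-1)}{2} = 0$ (genus zero). Two $(-1)$ curves, of degrees $\delta$ and $\delta'$ and with multiplicities $\mu_i$ and $\mu_i'$ at $p_i$ ($0\le i\le n$), are disjoint if their intersection number $\delta\delta' - \sum_i \mu_i\mu_i'$ is $0$. $(-1)$ special systems. A linear system $\mathcal{L}$ is $(-1)$ special if there are pairwise disjoint $(-1)$ curves $A_1, \dots, A_r$ such that $\mathcal{L}\cdot A_j = -N_j$ with $N_j \geq 1$ for every $j$ and $N_j \geq 2$ for some $j$, and such that the residual system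 $\mathcal{M} = \mathcal{L} - \sum_j N_j A_j$ (the linear system whose degree and multiplicities, which must be non-negative, are obtained by subtracting from those of $\mathcal{L}$ the degrees and multiplicities of $\sum_j N_jA_j$) has non-negative virtual dimension and non-negative intersection number with every $A_j$. *)

theory Defs
  imports
    "HOL-Analysis.Analysis"
    "HOL-Computational_Algebra.Polynomial"
    "HOL-Library.Poly_Mapping"
begin

section \<open>Configurations of points and general position\<close>

text \<open>
  A point of the complex projective plane is given by homogeneous coordinates, i.e. by a nonzero
  vector of \<open>complex ^ 3\<close>. Everything below depends only on the projective points and not on the
  chosen coordinates. Of a configuration \<open>p :: nat \<Rightarrow> complex ^ 3\<close> only \<open>p 0, \<dots>, p n\<close> matter.
\<close>

definition point_tuples :: "nat \<Rightarrow> (nat \<Rightarrow> complex ^ 3) set" where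
  "point_tuples n = {p. \<forall>i\<le>n. p i \<noteq> 0}"

text \<open>
  Polynomials in the coordinates of all the points: the variable \<open>(i, j)\<close> stands for the
  \<open>j\<close>-th homogeneous coordinate of the \<open>i\<close>-th point.
\<close>

type_synonym coord_poly = "(nat \<times> 3 \<Rightarrow>\<^sub>0 nat) \<Rightarrow>\<^sub>0 complex"

definition eval_coord_poly :: "coord_poly \<Rightarrow> (nat \<Rightarrow> complex ^ 3) \<Rightarrow> complex" where
  "eval_coord_poly G p =
     (\<Sum>\<alpha>\<in>Poly_Mapping.keys G. Poly_Mapping.lookup G \<alpha> *
        (\<Prod>v\<in>Poly_Mapping.keys \<alpha>. (p (fst v) $ snd v) ^ Poly_Mapping.lookup \<alpha> v))"

text \<open>
  Homogeneous in the coordinates of each of the points \<open>0, \<dots>, n\<close> separately, and not involving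
  the coordinates of any other point.
\<close>

definition multihomogeneous :: "nat \<Rightarrow> coord_poly \<Rightarrow> bool" where
  "multihomogeneous n G \<longleftrightarrow>
     (\<exists>e :: nat \<Rightarrow> nat. (\<forall>i>n. e i = 0) \<and>
        (\<forall>\<alpha>\<in>Poly_Mapping.keys G. \<forall>i. (\<Sum>j\<in>UNIV. Poly_Mapping.lookup \<alpha> (i, j)) = e i))"

definition zariski_closed :: "nat \<Rightarrow> (nat \<Rightarrow> complex ^ 3) set \<Rightarrow> bool" where
  "zariski_closed n Z \<longleftrightarrow>
     (\<exists>S. (\<forall>G\<in>S. multihomogeneous n G) \<and>
        Z = {p \<in> point_tuples n. \<forall>G\<in>S. eval_coord_poly G p = 0})"

text \<open>
  \<open>P\<close> holds for points \<open>p 0, \<dots>, p n\<close> in general position: it holds outside a proper Zariski closed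
  subset of the (irreducible) variety of all \<open>(n + 1)\<close>-tuples of points of the plane.
\<close>

definition for_general_points :: "nat \<Rightarrow> ((nat \<Rightarrow> complex ^ 3) \<Rightarrow> bool) \<Rightarrow> bool" where
  "for_general_points n P \<longleftrightarrow>
     (\<exists>Z. zariski_closed n Z \<and> Z \<noteq> point_tuples n \<and> (\<forall>p\<in>point_tuples n - Z. P p))"


section \<open>Plane curves\<close>

text \<open>
  Polynomials in three variables \<open>X, Y, Z\<close>, as iterated univariate polynomials: the coefficient of
  \<open>X ^ i * Y ^ j * Z ^ k\<close> in \<open>F\<close> is \<open>coeff (coeff (coeff F i) j) k\<close>.
\<close>

type_synonym poly3 = "complex poly poly poly"

definition monomials :: "poly3 \<Rightarrow> (nat \<times> nat \<times> nat) set" where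
  "monomials F = {(i, j, k). coeff (coeff (coeff F i) j) k \<noteq> 0}"

text \<open>Only meaningful for \<open>F \<noteq> 0\<close>.\<close>

definition total_degree :: "poly3 \<Rightarrow> nat" where
  "total_degree F = Max ((\<lambda>(i, j, k). i + j + k) ` monomials F)"

definition homogeneous :: "poly3 \<Rightarrow> bool" where
  "homogeneous F \<longleftrightarrow> (\<forall>(i, j, k)\<in>monomials F. i + j + k = total_degree F)"

definition eval3 :: "poly3 \<Rightarrow> complex ^ 3 \<Rightarrow> complex" where
  "eval3 F x = poly (poly (poly F [:[:x $ 1:]:]) [:x $ 2:]) (x $ 3)"

definition dX :: "poly3 \<Rightarrow> poly3" where "dX = pderiv"
definition dY :: "poly3 \<Rightarrow> poly3" where "dY = map_poly pderiv"
definition dZ :: "poly3 \<Rightarrow> poly3" where "dZ = map_poly (map_poly pderiv)"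

text \<open>
  The multiplicity of the curve \<open>F = 0\<close> (with \<open>F\<close> homogeneous and nonzero) at the point \<open>x\<close>: the least
  order of a partial derivative of \<open>F\<close> that does not vanish at \<open>x\<close>.
\<close>

definition multiplicity_at :: "poly3 \<Rightarrow> complex ^ 3 \<Rightarrow> nat" where
  "multiplicity_at F x =
     (LEAST k. \<exists>a b c. a + b + c = k \<and> eval3 ((dX ^^ a) ((dY ^^ b) ((dZ ^^ c) F))) x \<noteq> 0)"


section \<open>Linear systems\<close>

text \<open>
  The data \<open>(d, m)\<close> of a linear system: the degree \<open>d\<close> and the multiplicities \<open>m i\<close> imposed at the
  points \<open>p i\<close> for \<open>i \<le> n\<close>. The data are integers because those of a residual system are
  differences; \<open>m i\<close> is irrelevant for \<open>i > n\<close>.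
\<close>

type_synonym system = "int \<times> (nat \<Rightarrow> int)"

text \<open>Both divisions in the definition of the virtual dimension are exact.\<close>

definition virtual_dim :: "nat \<Rightarrow> system \<Rightarrow> int" where
  "virtual_dim n = (\<lambda>(d, m). d * (d + 3) div 2 - (\<Sum>i\<le>n. m i * (m i + 1) div 2))"

definition intersection_number :: "nat \<Rightarrow> system \<Rightarrow> system \<Rightarrow> int" where
  "intersection_number n = (\<lambda>(d, m) (d', m'). d * d' - (\<Sum>i\<le>n. m i * m' i))"

definition quasi_homogeneous :: "nat \<Rightarrow> nat \<Rightarrow> nat \<Rightarrow> system" where
  "quasi_homogeneous d m0 m = (int d, \<lambda>i. if i = 0 then int m0 else int m)"

definition curve_data :: "(nat \<Rightarrow> complex ^ 3) \<Rightarrow> poly3 \<Rightarrow> system" where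
  "curve_data p F = (int (total_degree F), \<lambda>i. int (multiplicity_at F (p i)))"


section \<open>\<open>(-1)\<close> curves and \<open>(-1)\<close> special systems\<close>

text \<open>Both divisions in the definition of the genus are exact.\<close>

definition genus :: "nat \<Rightarrow> system \<Rightarrow> int" where
  "genus n = (\<lambda>(d, m). (d - 1) * (d - 2) div 2 - (\<Sum>i\<le>n. m i * (m i - 1) div 2))"

definition minus_one_curve :: "nat \<Rightarrow> (nat \<Rightarrow> complex ^ 3) \<Rightarrow> poly3 \<Rightarrow> bool" where
  "minus_one_curve n p F \<longleftrightarrow>
     homogeneous F \<and> irreducible F \<and>
     intersection_number n (curve_data p F) (curve_data p F) = -1 \<and>
     genus n (curve_data p F) = 0"

definition disjoint_curves :: "nat \<Rightarrow> (nat \<Rightarrow> complex ^ 3) \<Rightarrow> poly3 \<Rightarrow> poly3 \<Rightarrow> bool" where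
  "disjoint_curves n p F F' \<longleftrightarrow> intersection_number n (curve_data p F) (curve_data p F') = 0"

text \<open>The data of the residual system \<open>L - (\<Sum>j<r. N j * A j)\<close>.\<close>

definition residual ::
  "(nat \<Rightarrow> complex ^ 3) \<Rightarrow> system \<Rightarrow> nat \<Rightarrow> (nat \<Rightarrow> int) \<Rightarrow> (nat \<Rightarrow> poly3) \<Rightarrow> system" where
  "residual p L r N A =
     (fst L - (\<Sum>j<r. N j * fst (curve_data p (A j))),
      \<lambda>i. snd L i - (\<Sum>j<r. N j * snd (curve_data p (A j)) i))"

definition minus_one_special :: "nat \<Rightarrow> (nat \<Rightarrow> complex ^ 3) \<Rightarrow> system \<Rightarrow> bool" where
  "minus_one_special n p L \<longleftrightarrow>
     (\<exists>(r :: nat) (A :: nat \<Rightarrow> poly3) (N :: nat \<Rightarrow> int).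
        (\<forall>j<r. minus_one_curve n p (A j)) \<and>
        (\<forall>i<r. \<forall>j<r. i \<noteq> j \<longrightarrow> disjoint_curves n p (A i) (A j)) \<and>
        (\<forall>j<r. intersection_number n L (curve_data p (A j)) = - N j \<and> N j \<ge> 1) \<and>
        (\<exists>j<r. N j \<ge> 2) \<and>
        (let M = residual p L r N A in
           fst M \<ge> 0 \<and> (\<forall>i\<le>n. snd M i \<ge> 0) \<and>
           virtual_dim n M \<ge> 0 \<and>
           (\<forall>j<r. intersection_number n M (curve_data p (A j)) \<ge> 0)))"

end

theory Submission
  imports Defs "HOL-Computational_Algebra.Polynomial_Factorial" "HOL-Computational_Algebra.Field_as_Ring"
begin

text \<open>
  The statement is reduced to one property \<open>good\<close> of a configuration \<open>p\<close>: the affine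
  first coordinates of the points are defined and distinct, and every class (degree \<open>D\<close>,
  multiplicities \<open>m\<close>) of bounded degree that contains a curve at \<open>p\<close> contains a curve at \<^emph>\<open>every\<close>
  configuration. Containing a curve means that a homogeneous linear system, whose coefficients are
  multihomogeneous in the points, has a nontrivial solution; Gaussian elimination without division
  shows that this fails on a nonempty Zariski open set as soon as it fails anywhere, and there are finitely many
  classes of bounded degree, so general points are good (\<open>good_general\<close>). Goodness replaces monodromy: since configurations may be
  reordered, the set of classes that contain a curve at a good \<open>p\<close> is invariant under permutations
  of the points, and a class contains no curve at \<open>p\<close> as soon as it contains none at one
  cleverly chosen special configuration.

  The geometry rests on two counts of unknowns and equations. A class with nonnegative
  multiplicities and nonnegative virtual dimension contains a curve (\<open>exists_form\<close>), and an
  irreducible curve that is not a component of another curve satisfies Bezout's inequality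
  \<open>(\<Sum>i\<le>n. \<mu> i * m i) \<le> \<delta> * d\<close> (\<open>bezout\<close>). Hence a class that contains a curve still does after an
  irreducible curve that it meets negatively is subtracted, and by symmetry also after a permuted copy
  of that curve is subtracted (\<open>subtractable_permute\<close>).

  \<^emph>\<open>Special systems are listed.\<close> Let \<open>A\<close> be one of the \<open>(-1)\<close> curves with \<open>L \<cdot> A = -N\<close>, \<open>N \<ge> 2\<close>.
  The residual system contains a curve, hence so does \<open>L\<close>, and \<open>L\<close> meets every permuted copy of \<open>A\<close> in
  the same number \<open>-N\<close>. Two copies that met positively could be subtracted from \<open>L\<close> forever, so the
  copies are disjoint; this forces the multiplicities of \<open>A\<close> at \<open>p 1, \<dots>, p n\<close> to be equal, or equal up to
  one exception that differs by \<open>1\<close>. As the residual multiplicities are nonnegative, they are at most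
  \<open>4 / N \<le> 2\<close>, and solving the two equations of a \<open>(-1)\<close> curve leaves a line through \<open>p 0\<close>, the rational
  curves \<open>(e; e - 1, 1, \<dots>, 1)\<close> with \<open>n = 2 * e\<close>, the conic through five points, the sextic
  \<open>(6; 3, 2, \<dots>, 2)\<close> with \<open>n = 7\<close>, and the three sides of a triangle (\<open>very_negative_curve_classes\<close>). In
  each case \<open>L \<cdot> A = -N\<close>, the existence of \<open>L - N A\<close> and the virtual dimension
  \<open>v L + (\<Sum>j. N j * (N j - 1)) / 2\<close> of the residual system leave exactly the list.

  \<^emph>\<open>Listed systems are special.\<close> All that is needed is that these curves exist, are irreducible and have
  exactly the expected multiplicities. Each of their classes contains a curve by the dimension count
  and has self-intersection \<open>-1\<close>, so some irreducible component meets the class negatively; Bezout's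
  inequality against lines and cubics, and special configurations without rational curves
  (\<open>no_rational_section\<close>), show that this component has the full degree and the right multiplicities.
\<close>

section \<open>Ternary forms\<close>

abbreviation coeff3 :: "'a::zero poly poly poly \<Rightarrow> nat \<Rightarrow> nat \<Rightarrow> nat \<Rightarrow> 'a" where
  "coeff3 F i j k \<equiv> coeff (coeff (coeff F i) j) k"

definition monom3 :: "nat \<Rightarrow> nat \<Rightarrow> nat \<Rightarrow> 'a::zero \<Rightarrow> 'a poly poly poly" where
  "monom3 i j k c = monom (monom (monom c k) j) i"

definition scale3 :: "complex \<Rightarrow> poly3 \<Rightarrow> poly3" where
  "scale3 c F = smult [:[:c:]:] F"

text \<open>
  Unlike \<open>homogeneous\<close>, this holds for \<open>0\<close> in every degree, so the forms of a given degree are a vector space.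
\<close>

definition form :: "nat \<Rightarrow> poly3 \<Rightarrow> bool" where
  "form D F \<longleftrightarrow> (\<forall>i j k. coeff3 F i j k \<noteq> 0 \<longrightarrow> i + j + k = D)"

text \<open>
  The exponents \<open>(i, j)\<close> of \<open>X\<close> and \<open>Y\<close> in the monomials of degree \<open>D\<close>; the exponent of \<open>Z\<close> is \<open>D - i - j\<close>.
\<close>

definition triangle :: "nat \<Rightarrow> (nat \<times> nat) set" where
  "triangle D = {(i, j). i + j \<le> D}"

lemma poly3_eqI: "(\<And>i j k. coeff3 F i j k = coeff3 G i j k) \<Longrightarrow> F = G"
  by (intro poly_eqI) auto

lemma coeff3_monom3: "coeff3 (monom3 i j k c) a b e = (if a = i \<and> b = j \<and> e = k then c else 0)"
  by (auto simp: monom3_def)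

lemma coeff3_scale3 [simp]: "coeff3 (scale3 c F) i j k = c * coeff3 F i j k"
  by (simp add: scale3_def)

lemma poly_monom_induct:
  assumes "\<And>a i. P (monom a i)" "\<And>f g. P f \<Longrightarrow> P g \<Longrightarrow> P (f + g)"
  shows "P (f :: 'a::comm_monoid_add poly)"
proof -
  have P0: "P 0" using assms(1)[of 0 0] by simp
  have "P (\<Sum>i\<in>A. monom (coeff f i) i)" if "finite A" for A
    using that by induction (auto intro: assms P0)
  from this[of "{..degree f}"] show ?thesis by (simp add: poly_as_sum_of_monoms)
qed

lemma poly3_induct [case_names monom3 add]:
  assumes m: "\<And>i j k c. P (monom3 i j k c)" and a: "\<And>F G. P F \<Longrightarrow> P G \<Longrightarrow> P (F + G)"
  shows "P (F :: 'a::comm_monoid_add poly poly poly)"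
proof (rule poly_monom_induct)
  fix f :: "'a poly poly" and i
  show "P (monom f i)"
  proof (rule poly_monom_induct[of "\<lambda>f. P (monom f i)"])
    fix g :: "'a poly" and j
    show "P (monom (monom g j) i)"
    proof (rule poly_monom_induct[of "\<lambda>g. P (monom (monom g j) i)"])
      show "P (monom (monom (monom c k) j) i)" for c k using m by (simp add: monom3_def)
    qed (metis a add_monom)
  qed (metis a add_monom)
qed (rule a)

lemma finite_triangle [simp]: "finite (triangle D)"
proof -
  have "triangle D \<subseteq> {..D} \<times> {..D}" by (auto simp: triangle_def)
  then show ?thesis by (rule finite_subset) simp
qed

lemma card_triangle: "2 * card (triangle D) = (D + 1) * (D + 2)"
proof -
  have "triangle D = (SIGMA i:{..D}. {..D - i})" by (auto simp: triangle_def)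
  then have "card (triangle D) = (\<Sum>i\<le>D. D - i + 1)" by simp
  also have "\<dots> = (\<Sum>i\<le>D. i + 1)"
    by (rule sum.reindex_bij_witness[of _ "\<lambda>i. D - i" "\<lambda>i. D - i"]) auto
  finally have c: "card (triangle D) = (\<Sum>i\<le>D. i + 1)" .
  have "2 * (\<Sum>i\<le>D. i + 1) = (D + 1) * (D + 2)" by (induction D) auto
  then show ?thesis by (simp add: c)
qed

lemma form_sum_monom3:
  assumes "form D F"
  shows "F = (\<Sum>(i, j)\<in>triangle D. monom3 i j (D - i - j) (coeff3 F i j (D - i - j)))"
proof (rule poly3_eqI)
  fix a b e
  have "coeff3 (\<Sum>(i, j)\<in>triangle D. monom3 i j (D - i - j) (coeff3 F i j (D - i - j))) a b e
      = (\<Sum>p\<in>triangle D. coeff3 (monom3 (fst p) (snd p) (D - fst p - snd p) (coeff3 F (fst p) (snd p) (D - fst p - snd p))) a b e)"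
    by (simp add: coeff_sum case_prod_unfold)
  also have "\<dots> = (\<Sum>p\<in>triangle D. if p = (a, b) then (if e = D - a - b then coeff3 F a b e else 0) else 0)"
    by (rule sum.cong) (auto simp: coeff3_monom3)
  also have "\<dots> = (if (a, b) \<in> triangle D \<and> e = D - a - b then coeff3 F a b e else 0)"
    by simp
  also have "\<dots> = coeff3 F a b e"
  proof (cases "coeff3 F a b e = 0")
    case False
    then have "a + b + e = D" using assms by (simp add: form_def)
    then show ?thesis by (auto simp: triangle_def)
  next
    case True
    show ?thesis by (simp only: True if_cancel)
  qed
  finally show "coeff3 F a b e = coeff3 (\<Sum>(i, j)\<in>triangle D. monom3 i j (D - i - j) (coeff3 F i j (D - i - j))) a b e"
    by simp
qed

lemma form_0 [simp]: "form D 0" by (simp add: form_def)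
lemma form_monom3: "i + j + k = D \<Longrightarrow> form D (monom3 i j k c)"
  by (auto simp: form_def coeff3_monom3 split: if_splits)
lemma form_add: "form D F \<Longrightarrow> form D G \<Longrightarrow> form D (F + G)"
  by (force simp: form_def)
lemma form_sum: "(\<And>x. x \<in> A \<Longrightarrow> form D (f x)) \<Longrightarrow> form D (sum f A)"
  by (induction A rule: infinite_finite_induct) (auto intro: form_add)
lemma form_scale3: "form D F \<Longrightarrow> form D (scale3 c F)"
  by (auto simp: form_def)
lemma monom3_mult: "monom3 i j k c * monom3 a b e d = monom3 (i + a) (j + b) (k + e) (c * d)"
  by (simp add: monom3_def mult_monom)

lemma form_mult:
  assumes "form D F" "form E G" shows "form (D + E) (F * G)"
proof -
  define f where "f p = monom3 (fst p) (snd p) (D - fst p - snd p) (coeff3 F (fst p) (snd p) (D - fst p - snd p))" for p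
  define g where "g p = monom3 (fst p) (snd p) (E - fst p - snd p) (coeff3 G (fst p) (snd p) (E - fst p - snd p))" for p
  have F: "F = sum f (triangle D)" and G: "G = sum g (triangle E)"
    using form_sum_monom3[OF assms(1)] form_sum_monom3[OF assms(2)]
    unfolding f_def g_def case_prod_unfold by auto
  have "form (D + E) (f p * g q)" if "p \<in> triangle D" "q \<in> triangle E" for p q
    unfolding f_def g_def monom3_mult using that by (intro form_monom3) (auto simp: triangle_def)
  then have "form (D + E) (\<Sum>p\<in>triangle D. \<Sum>q\<in>triangle E. f p * g q)"
    by (intro form_sum)
  then show ?thesis unfolding F G sum_product .
qed

lemma monom3_0001: "monom3 0 0 0 1 = (1 :: poly3)"
  by (simp add: monom3_def monom_0 one_pCons)

lemma form_1: "form 0 1"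
  using form_monom3[of 0 0 0 0 1] by (simp only: monom3_0001 add_0_left)

lemma form_power: "form D F \<Longrightarrow> form (D * n) (F ^ n)"
  by (induction n) (simp_all add: form_mult form_1)

lemma form_prod: "finite A \<Longrightarrow> (\<And>x. x \<in> A \<Longrightarrow> form (d x) (f x)) \<Longrightarrow> form (\<Sum>x\<in>A. d x) (\<Prod>x\<in>A. f x)"
  by (induction A rule: finite_induct) (simp_all add: form_mult form_1)

lemma form_nonzero:
  assumes "F \<noteq> 0" "form D F" shows "\<exists>i j k. coeff3 F i j k \<noteq> 0 \<and> i + j + k = D"
proof -
  obtain i j k where "coeff3 F i j k \<noteq> 0" using assms(1) poly3_eqI[of F 0] by auto
  with assms(2) show ?thesis unfolding form_def by blast
qed

lemma form_unique_degree: "F \<noteq> 0 \<Longrightarrow> form D F \<Longrightarrow> form E F \<Longrightarrow> D = E"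
  using form_nonzero[of F D] unfolding form_def by blast

lemma form_homogeneous:
  assumes "F \<noteq> 0" "form D F" shows "homogeneous F" "total_degree F = D"
proof -
  have "(\<lambda>(i, j, k). i + j + k) ` monomials F = {D}"
  proof
    show "{D} \<subseteq> (\<lambda>(i, j, k). i + j + k) ` monomials F"
      using form_nonzero[OF assms] unfolding monomials_def image_def by (auto split: prod.splits)
  qed (use assms(2) in \<open>auto simp: monomials_def form_def\<close>)
  then show "total_degree F = D" by (simp add: total_degree_def)
  with assms(2) show "homogeneous F" by (auto simp: homogeneous_def form_def monomials_def)
qed

lemma homogeneous_form: "homogeneous F \<Longrightarrow> form (total_degree F) F"
  by (auto simp: homogeneous_def form_def monomials_def)

section \<open>Evaluation and derivatives\<close>

lemma eval3_add [simp]: "eval3 (F + G) x = eval3 F x + eval3 G x"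
  by (simp add: eval3_def)
lemma eval3_mult [simp]: "eval3 (F * G) x = eval3 F x * eval3 G x"
  by (simp add: eval3_def)
lemma eval3_0 [simp]: "eval3 0 x = 0" by (simp add: eval3_def)
lemma eval3_1 [simp]: "eval3 1 x = 1" by (simp add: eval3_def)
lemma eval3_monom3: "eval3 (monom3 i j k c) x = c * (x $ 1) ^ i * (x $ 2) ^ j * (x $ 3) ^ k"
  by (simp add: eval3_def monom3_def poly_monom)
lemma eval3_scale3 [simp]: "eval3 (scale3 c F) x = c * eval3 F x"
  by (simp add: eval3_def scale3_def)
lemma eval3_sum: "eval3 (sum f A) x = (\<Sum>a\<in>A. eval3 (f a) x)"
  by (induction A rule: infinite_finite_induct) auto

lemma coeff3_dX: "coeff3 (dX F) i j k = of_nat (Suc i) * coeff3 F (Suc i) j k"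
  by (simp add: dX_def coeff_pderiv of_nat_poly)
lemma coeff3_dY: "coeff3 (dY F) i j k = of_nat (Suc j) * coeff3 F i (Suc j) k"
  by (simp add: dY_def coeff_map_poly coeff_pderiv of_nat_poly)
lemma coeff3_dZ: "coeff3 (dZ F) i j k = of_nat (Suc k) * coeff3 F i j (Suc k)"
  by (simp add: dZ_def coeff_map_poly coeff_pderiv)

lemmas coeff3_d = coeff3_dX coeff3_dY coeff3_dZ

lemma d_add: "dX (F + G) = dX F + dX G" "dY (F + G) = dY F + dY G" "dZ (F + G) = dZ F + dZ G"
  by (rule poly3_eqI; simp add: coeff3_d algebra_simps)+
lemma d_commute: "dY (dX F) = dX (dY F)" "dZ (dX F) = dX (dZ F)" "dZ (dY F) = dY (dZ F)"
  by (rule poly3_eqI; simp add: coeff3_d algebra_simps)+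
lemma d_scale3: "dX (scale3 c F) = scale3 c (dX F)" "dY (scale3 c F) = scale3 c (dY F)"
    "dZ (scale3 c F) = scale3 c (dZ F)"
  by (rule poly3_eqI; simp add: coeff3_d algebra_simps)+
lemma d_0 [simp]: "dX 0 = 0" "dY 0 = 0" "dZ 0 = 0"
  by (rule poly3_eqI; simp add: coeff3_d)+

lemma dX_monom3: "dX (monom3 i j k c) = monom3 (i - 1) j k (of_nat i * c)"
  by (rule poly3_eqI, cases i) (auto simp only: coeff3_d coeff3_monom3 split: if_splits, simp_all)
lemma dY_monom3: "dY (monom3 i j k c) = monom3 i (j - 1) k (of_nat j * c)"
  by (rule poly3_eqI, cases j) (auto simp only: coeff3_d coeff3_monom3 split: if_splits, simp_all)
lemma dZ_monom3: "dZ (monom3 i j k c) = monom3 i j (k - 1) (of_nat k * c)"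
  by (rule poly3_eqI, cases k) (auto simp only: coeff3_d coeff3_monom3 split: if_splits, simp_all)

lemmas d_monom3 = dX_monom3 dY_monom3 dZ_monom3

lemma form_d:
  assumes "form D F"
  shows "form (D - 1) (dX F)" "form (D - 1) (dY F)" "form (D - 1) (dZ F)"
proof -
  have *: "a + b + c = D" if "of_nat n * coeff3 F a b c \<noteq> 0" for n a b c
    using that assms unfolding form_def by auto
  show "form (D - 1) (dX F)" "form (D - 1) (dY F)" "form (D - 1) (dZ F)"
    unfolding form_def coeff3_d using * by fastforce+
qed

definition deriv3 :: "nat \<Rightarrow> nat \<Rightarrow> nat \<Rightarrow> poly3 \<Rightarrow> poly3" where
  "deriv3 a b c F = (dX ^^ a) ((dY ^^ b) ((dZ ^^ c) F))"

lemma funpow_commute: "(\<And>x. f (g x) = g (f x)) \<Longrightarrow> f ((g ^^ n) x) = (g ^^ n) (f x)"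
  by (induction n) auto

lemma d_pow_commute: "dX ((dY ^^ b) F) = (dY ^^ b) (dX F)" "dX ((dZ ^^ b) F) = (dZ ^^ b) (dX F)"
    "dY ((dZ ^^ b) F) = (dZ ^^ b) (dY F)" "dZ ((dX ^^ b) F) = (dX ^^ b) (dZ F)"
    "dZ ((dY ^^ b) F) = (dY ^^ b) (dZ F)" "dY ((dX ^^ b) F) = (dX ^^ b) (dY F)"
  by (rule funpow_commute; simp only: d_commute)+

lemma deriv3_Suc: "deriv3 (Suc a) b c F = deriv3 a b c (dX F)"
    "deriv3 a (Suc b) c F = deriv3 a b c (dY F)" "deriv3 a b (Suc c) F = deriv3 a b c (dZ F)"
  unfolding deriv3_def by (simp_all add: funpow_swap1 d_pow_commute)

lemma deriv3_Suc': "deriv3 (Suc a) b c F = dX (deriv3 a b c F)"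
    "deriv3 a (Suc b) c F = dY (deriv3 a b c F)" "deriv3 a b (Suc c) F = dZ (deriv3 a b c F)"
  unfolding deriv3_def by (simp_all add: d_pow_commute)

lemma deriv3_000 [simp]: "deriv3 0 0 0 F = F" by (simp add: deriv3_def)

lemma deriv3_add: "deriv3 a b c (F + G) = deriv3 a b c F + deriv3 a b c G"
proof -
  have "(dX ^^ a) (F + G) = (dX ^^ a) F + (dX ^^ a) G" for a F G by (induction a) (auto simp: d_add)
  moreover have "(dY ^^ a) (F + G) = (dY ^^ a) F + (dY ^^ a) G" for a F G by (induction a) (auto simp: d_add)
  moreover have "(dZ ^^ a) (F + G) = (dZ ^^ a) F + (dZ ^^ a) G" for a F G by (induction a) (auto simp: d_add)
  ultimately show ?thesis by (simp add: deriv3_def)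
qed

lemma deriv3_0 [simp]: "deriv3 a b c 0 = 0"
  using deriv3_add[of a b c 0 0] by simp

lemma deriv3_sum: "deriv3 a b c (sum f A) = (\<Sum>x\<in>A. deriv3 a b c (f x))"
  by (induction A rule: infinite_finite_induct) (auto simp: deriv3_add)

lemma deriv3_scale3: "deriv3 a b c (scale3 r F) = scale3 r (deriv3 a b c F)"
proof -
  have "(dX ^^ a) (scale3 r F) = scale3 r ((dX ^^ a) F)" for a F by (induction a) (auto simp: d_scale3)
  moreover have "(dY ^^ a) (scale3 r F) = scale3 r ((dY ^^ a) F)" for a F by (induction a) (auto simp: d_scale3)
  moreover have "(dZ ^^ a) (scale3 r F) = scale3 r ((dZ ^^ a) F)" for a F by (induction a) (auto simp: d_scale3)
  ultimately show ?thesis by (simp add: deriv3_def)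
qed

lemma form_deriv3: "form D F \<Longrightarrow> form (D - (a + b + c)) (deriv3 a b c F)"
proof (induction a)
  case 0
  show ?case
  proof (induction b)
    case 0
    show ?case
    proof (induction c)
      case 0 then show ?case using \<open>form D F\<close> by simp
    next
      case (Suc c) then show ?case using form_d(3)[of _ "deriv3 0 0 c F"] by (metis deriv3_Suc'(3) diff_diff_left add_Suc add_Suc_right Suc_eq_plus1)
    qed
  next
    case (Suc b) then show ?case using form_d(2)[of _ "deriv3 0 b c F"] by (metis deriv3_Suc'(2) diff_diff_left add_Suc add_Suc_right Suc_eq_plus1)
  qed
next
  case (Suc a) then show ?case using form_d(1)[of _ "deriv3 a b c F"] by (metis deriv3_Suc'(1) diff_diff_left add_Suc add_Suc_right Suc_eq_plus1)
qed

lemma coeff3_deriv3: "coeff3 (deriv3 a b c F) i j k =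
  pochhammer (of_nat (Suc i)) a * pochhammer (of_nat (Suc j)) b * pochhammer (of_nat (Suc k)) c
    * coeff3 F (i + a) (j + b) (k + c)"
proof -
  have X: "coeff3 ((dX ^^ a) F) i j k = pochhammer (of_nat (Suc i)) a * coeff3 F (i + a) j k" for F i j k
    by (induction a arbitrary: i) (simp_all add: coeff3_dX pochhammer_rec algebra_simps)
  have Y: "coeff3 ((dY ^^ b) F) i j k = pochhammer (of_nat (Suc j)) b * coeff3 F i (j + b) k" for F i j k
    by (induction b arbitrary: j) (simp_all add: coeff3_dY pochhammer_rec algebra_simps)
  have Z: "coeff3 ((dZ ^^ c) F) i j k = pochhammer (of_nat (Suc k)) c * coeff3 F i j (k + c)" for F i j k
    by (induction c arbitrary: k) (simp_all add: coeff3_dZ pochhammer_rec algebra_simps)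
  show ?thesis by (simp add: deriv3_def X Y Z)
qed

lemma pochhammer_Suc_neq_0: "pochhammer (of_nat (Suc i)) a \<noteq> (0 :: complex)"
proof (induction a)
  case (Suc a)
  have "of_nat (Suc i) + of_nat a = (of_nat (Suc (i + a)) :: complex)" by simp
  then have "of_nat (Suc i) + of_nat a \<noteq> (0 :: complex)" by (simp only: of_nat_eq_0_iff nat.distinct not_False_eq_True)
  with Suc show ?case by (simp only: pochhammer_Suc mult_eq_0_iff not_False_eq_True de_Morgan_disj)
qed simp

lemma form0: assumes "form 0 F" shows "eval3 F x = coeff3 F 0 0 0"
proof -
  have "triangle 0 = {(0, 0)}" by (auto simp: triangle_def)
  then have "F = monom3 0 0 0 (coeff3 F 0 0 0)" using form_sum_monom3[OF assms] by simp
  then show ?thesis using eval3_monom3[of 0 0 0 "coeff3 F 0 0 0" x] by simp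
qed

lemma form_deriv3_const:
  assumes "form D F" "i + j + k = D"
  shows "eval3 (deriv3 i j k F) x = fact i * fact j * fact k * coeff3 F i j k"
  using form0[of "deriv3 i j k F" x] form_deriv3[OF assms(1), of i j k] assms(2)
  by (simp add: coeff3_deriv3 pochhammer_fact[symmetric])

section \<open>Multiplicities of forms\<close>

text \<open>
  The linear form of the condition that the multiplicity is at least \<open>m\<close>: it is preserved by sums and
  holds for \<open>0\<close>.
\<close>

definition mult_ge :: "poly3 \<Rightarrow> complex ^ 3 \<Rightarrow> nat \<Rightarrow> bool" where
  "mult_ge F x m \<longleftrightarrow> (\<forall>a b c. a + b + c < m \<longrightarrow> eval3 (deriv3 a b c F) x = 0)"

lemma mult_ge_iff:
  assumes "F \<noteq> 0" "form D F"
  shows "mult_ge F x m \<longleftrightarrow> m \<le> multiplicity_at F x"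
proof -
  let ?P = "\<lambda>k. \<exists>a b c. a + b + c = k \<and> eval3 (deriv3 a b c F) x \<noteq> 0"
  have mu: "multiplicity_at F x = (LEAST k. ?P k)" by (simp add: multiplicity_at_def deriv3_def)
  obtain i j k where ijk: "coeff3 F i j k \<noteq> 0" "i + j + k = D" using form_nonzero assms by blast
  then have ex: "?P D" using form_deriv3_const[OF assms(2) ijk(2)] by force
  have "?P (multiplicity_at F x)" unfolding mu by (rule LeastI[of ?P, OF ex])
  moreover have "\<not> ?P k" if "k < multiplicity_at F x" for k
    using that not_less_Least[of k ?P] unfolding mu by blast
  ultimately show ?thesis unfolding mult_ge_def by (metis linorder_not_le order_less_le_trans)
qed

text \<open>
  For a monomial \<open>X ^ i * Y ^ j * Z ^ k\<close> that occurs in \<open>F\<close>, the derivative of type \<open>(i, j, k)\<close> is a nonzero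
  constant.
\<close>

lemma multiplicity_le_degree:
  assumes "F \<noteq> 0" "form D F"
  shows "multiplicity_at F x \<le> D"
proof (rule ccontr)
  assume "\<not> ?thesis"
  then have "mult_ge F x (Suc D)" using mult_ge_iff[OF assms] by auto
  moreover obtain i j k where ijk: "coeff3 F i j k \<noteq> 0" "i + j + k = D" using form_nonzero assms by blast
  ultimately show False using form_deriv3_const[OF assms(2) ijk(2)] by (force simp: mult_ge_def)
qed

lemma mult_ge_scale3: "mult_ge F x m \<Longrightarrow> mult_ge (scale3 c F) x m"
  by (simp add: mult_ge_def deriv3_scale3)
lemma mult_ge_add: "mult_ge F x m \<Longrightarrow> mult_ge G x m \<Longrightarrow> mult_ge (F + G) x m"
  by (simp add: mult_ge_def deriv3_add)
lemma mult_ge_0 [simp]: "mult_ge 0 x m" by (simp add: mult_ge_def)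
lemma euler:
  assumes "form D F"
  shows "of_nat D * eval3 F x = x $ 1 * eval3 (dX F) x + x $ 2 * eval3 (dY F) x + x $ 3 * eval3 (dZ F) x"
proof -
  define t where "t = (\<lambda>(i, j). monom3 i j (D - i - j) (coeff3 F i j (D - i - j)))"
  have F: "F = sum t (triangle D)" using form_sum_monom3[OF assms] by (simp add: t_def)
  have lin: "dX (sum t A) = (\<Sum>a\<in>A. dX (t a))" "dY (sum t A) = (\<Sum>a\<in>A. dY (t a))"
     "dZ (sum t A) = (\<Sum>a\<in>A. dZ (t a))" for A
    by (induction A rule: infinite_finite_induct; simp add: d_add)+
  have m: "y * (of_nat i * c * y ^ (i - 1) * r) = of_nat i * (c * y ^ i * r)" for y c r :: complex and i
    by (cases i) auto
  have "of_nat D * eval3 (t p) x = x $ 1 * eval3 (dX (t p)) x + x $ 2 * eval3 (dY (t p)) x + x $ 3 * eval3 (dZ (t p)) x"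
    if p: "p \<in> triangle D" for p
  proof -
    obtain i j where ij: "p = (i, j)" by force
    define k where "k = D - i - j"
    have D: "D = i + j + k" using p by (auto simp: ij triangle_def k_def)
    define c where "c = coeff3 F i j k"
    have t: "t p = monom3 i j k c" by (simp add: t_def ij k_def c_def)
    have e1: "x $ 1 * (of_nat i * c * (x $ 1) ^ (i - 1) * (x $ 2) ^ j * (x $ 3) ^ k) = of_nat i * eval3 (t p) x"
      using m[of "x $ 1" i c "(x $ 2) ^ j * (x $ 3) ^ k"] by (simp add: t eval3_monom3 mult_ac)
    have e2: "x $ 2 * (of_nat j * c * (x $ 1) ^ i * (x $ 2) ^ (j - 1) * (x $ 3) ^ k) = of_nat j * eval3 (t p) x"
      using m[of "x $ 2" j c "(x $ 1) ^ i * (x $ 3) ^ k"] by (simp add: t eval3_monom3 mult_ac)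
    have e3: "x $ 3 * (of_nat k * c * (x $ 1) ^ i * (x $ 2) ^ j * (x $ 3) ^ (k - 1)) = of_nat k * eval3 (t p) x"
      using m[of "x $ 3" k c "(x $ 1) ^ i * (x $ 2) ^ j"] by (simp add: t eval3_monom3 mult_ac)
    have "x $ 1 * eval3 (dX (t p)) x + x $ 2 * eval3 (dY (t p)) x + x $ 3 * eval3 (dZ (t p)) x
       = of_nat i * eval3 (t p) x + of_nat j * eval3 (t p) x + of_nat k * eval3 (t p) x"
      unfolding e1[symmetric] e2[symmetric] e3[symmetric] by (simp add: t d_monom3 eval3_monom3)
    then show ?thesis by (simp add: D algebra_simps)
  qed
  then have "(\<Sum>p\<in>triangle D. of_nat D * eval3 (t p) x) = (\<Sum>p\<in>triangle D. x $ 1 * eval3 (dX (t p)) x + x $ 2 * eval3 (dY (t p)) x + x $ 3 * eval3 (dZ (t p)) x)"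
    by (intro sum.cong) auto
  then show ?thesis
    by (subst (1 2 3 4) F) (simp add: lin eval3_sum sum_distrib_left sum.distrib)
qed

text \<open>
  Off the line \<open>Z = 0\<close> Euler's identity expresses a derivative in \<open>Z\<close> through derivatives with fewer \<open>Z\<close>.
  So multiplicity \<open>m\<close> costs \<open>m * (m + 1) / 2\<close> linear conditions, as for a polynomial in two variables.
\<close>

lemma mult_ge_planar:
  assumes "form D F" "x $ 3 \<noteq> 0"
  shows "mult_ge F x m \<longleftrightarrow> (\<forall>a b. a + b < m \<longrightarrow> eval3 (deriv3 a b 0 F) x = 0)"
proof
  assume R: "\<forall>a b. a + b < m \<longrightarrow> eval3 (deriv3 a b 0 F) x = 0"
  have "eval3 (deriv3 a b c F) x = 0" if "a + b + c < m" for a b c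
    using that
  proof (induction c arbitrary: a b)
    case 0 then show ?case using R by simp
  next
    case (Suc c)
    have f: "form (D - (a + b + c)) (deriv3 a b c F)" by (rule form_deriv3[OF assms(1)])
    have "eval3 (deriv3 a b c F) x = 0" "eval3 (deriv3 (Suc a) b c F) x = 0" "eval3 (deriv3 a (Suc b) c F) x = 0"
      using Suc by auto
    with euler[OF f, of x] have "x $ 3 * eval3 (deriv3 a b (Suc c) F) x = 0"
      by (simp add: deriv3_Suc')
    with assms(2) show ?case by simp
  qed
  then show "mult_ge F x m" by (simp add: mult_ge_def)
qed (auto simp: mult_ge_def)

section \<open>Substitution homomorphisms\<close>

definition rhom :: "('a::comm_ring_1 \<Rightarrow> 'b::comm_ring_1) \<Rightarrow> bool" where
  "rhom h \<longleftrightarrow> h 0 = 0 \<and> h 1 = 1 \<and> (\<forall>a b. h (a + b) = h a + h b) \<and> (\<forall>a b. h (a * b) = h a * h b)"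

text \<open>
  Substitution of \<open>a\<close> for the variable along a map \<open>h\<close> of the coefficients, which will be a ring homomorphism.
\<close>

definition ev :: "('a::comm_ring_1 \<Rightarrow> 'b::comm_ring_1) \<Rightarrow> 'b \<Rightarrow> 'a poly \<Rightarrow> 'b" where
  "ev h a f = (\<Sum>i\<le>degree f. h (coeff f i) * a ^ i)"

lemma ev_extend:
  assumes "h 0 = 0" "degree f \<le> N"
  shows "ev h a f = (\<Sum>i\<le>N. h (coeff f i) * a ^ i)"
  unfolding ev_def using assms by (intro sum.mono_neutral_left) (auto simp: coeff_eq_0)

lemma ev_add:
  assumes "rhom h" shows "ev h a (f + g) = ev h a f + ev h a g"
proof -
  have h0: "h 0 = 0" using assms by (auto simp: rhom_def)
  have h: "h (a + b) = h a + h b" for a b using assms by (auto simp: rhom_def)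
  let ?N = "max (degree f) (degree g)"
  have "degree (f + g) \<le> ?N" by (rule degree_add_le_max)
  then show ?thesis
    using ev_extend[of h f ?N a, OF h0] ev_extend[of h g ?N a, OF h0] ev_extend[of h "f + g" ?N a, OF h0]
    by (simp add: h algebra_simps sum.distrib)
qed

lemma ev_monom:
  assumes "rhom h" shows "ev h a (monom c i) = h c * a ^ i"
proof -
  have h: "h 0 = 0" using assms by (auto simp: rhom_def)
  have "ev h a (monom c i) = (\<Sum>k\<le>i. h (coeff (monom c i) k) * a ^ k)"
    by (rule ev_extend[of h, OF h degree_monom_le])
  also have "\<dots> = (\<Sum>k\<le>i. if k = i then h c * a ^ i else 0)"
    by (rule sum.cong) (auto simp: h)
  also have "\<dots> = h c * a ^ i" by simp
  finally show ?thesis .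
qed

lemma ev_mult:
  assumes "rhom h" shows "ev h a (f * g) = ev h a f * ev h a g"
proof (induction f rule: poly_monom_induct)
  case (1 c i)
  show ?case
  proof (induction g rule: poly_monom_induct)
    case (1 d j)
    have "h (c * d) = h c * h d" using assms by (simp add: rhom_def)
    then show ?case by (simp add: mult_monom ev_monom[OF assms] power_add mult_ac)
  next
    case (2 f g) then show ?case by (simp add: ring_distribs ev_add[OF assms])
  qed
next
  case (2 f g) then show ?case by (simp add: ring_distribs ev_add[OF assms])
qed

lemma rhom_ev: assumes "rhom h" shows "rhom (ev h a)"
proof -
  have "ev h a 1 = 1" using ev_monom[OF assms, of a 1 0] assms by (simp add: rhom_def monom_0 one_pCons)
  moreover have "ev h a 0 = 0" using assms by (simp add: ev_def rhom_def)
  ultimately show ?thesis by (simp add: rhom_def ev_add[OF assms] ev_mult[OF assms])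
qed

definition subst3 where "subst3 h x y z = ev (ev (ev h z) y) x"

lemma rhom_subst3: "rhom h \<Longrightarrow> rhom (subst3 h x y z)"
  unfolding subst3_def by (intro rhom_ev)

lemma subst3_monom3:
  assumes "rhom h" shows "subst3 h x y z (monom3 i j k c) = h c * z ^ k * y ^ j * x ^ i"
  unfolding subst3_def monom3_def using assms by (simp add: ev_monom rhom_ev)

lemma rhomD:
  assumes "rhom h"
  shows "h 0 = 0" "h 1 = 1" "h (a + b) = h a + h b" "h (a * b) = h a * h b"
  using assms by (auto simp: rhom_def)

lemma rhom_power: "rhom h \<Longrightarrow> h (a ^ n) = h a ^ n"
  by (induction n) (auto simp: rhom_def)
lemma rhom_sum: "rhom h \<Longrightarrow> h (sum f A) = (\<Sum>a\<in>A. h (f a))"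
  by (induction A rule: infinite_finite_induct) (auto simp: rhom_def)
section \<open>Factors of forms\<close>

text \<open>
  The polynomial \<open>F (T X, T Y, T Z)\<close> in \<open>T\<close>; the coefficient of \<open>T ^ k\<close> is the homogeneous part of degree \<open>k\<close>.
\<close>

definition stretch :: "poly3 \<Rightarrow> poly3 poly" where
  "stretch = subst3 (\<lambda>c. [:[:[:[:c:]:]:]:]) (monom (monom3 1 0 0 1) 1) (monom (monom3 0 1 0 1) 1) (monom (monom3 0 0 1 1) 1)"

lemma rhom_const4: "rhom (\<lambda>c::complex. [:[:[:[:c:]:]:]:])"
  by (simp add: rhom_def one_pCons)

lemma rhom_stretch: "rhom stretch"
  unfolding stretch_def by (rule rhom_subst3[OF rhom_const4])

lemma monom3_power: "(monom3 i j k c :: poly3) ^ n = monom3 (i * n) (j * n) (k * n) (c ^ n)"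
proof (induction n)
  case 0 show ?case by (simp add: monom3_0001)
qed (simp add: monom3_mult)

lemma stretch_monom3: "stretch (monom3 i j k c) = monom (monom3 i j k c) (i + j + k)"
proof -
  have c: "[:[:[:[:c:]:]:]:] = monom (monom3 0 0 0 c) 0" by (simp add: monom3_def monom_0)
  show ?thesis
    unfolding stretch_def subst3_monom3[OF rhom_const4] c
    by (simp add: monom_power mult_monom monom3_mult monom3_power add_ac)
qed

lemma coeff3_stretch: "coeff3 (coeff (stretch F) D) i j k = (if i + j + k = D then coeff3 F i j k else 0)"
proof (induction F rule: poly3_induct)
  case (monom3 a b e c)
  show ?case by (auto simp: stretch_monom3 coeff3_monom3)
next
  case (add F G)
  then show ?case by (simp add: rhomD[OF rhom_stretch])
qed

lemma form_iff_stretch: "form D F \<longleftrightarrow> stretch F = monom F D"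
proof
  assume "form D F"
  then show "stretch F = monom F D"
    by (intro poly_eqI[of "stretch F"] poly3_eqI) (auto simp: coeff3_stretch form_def)
next
  assume *: "stretch F = monom F D"
  show "form D F" unfolding form_def
  proof (intro allI impI)
    fix i j k assume n: "coeff3 F i j k \<noteq> 0"
    have "coeff3 (coeff (stretch F) (i + j + k)) i j k \<noteq> 0" using n by (simp add: coeff3_stretch)
    then show "i + j + k = D" unfolding * by (cases "D = i + j + k") auto
  qed
qed

text \<open>
  Under the ring homomorphism \<open>stretch\<close> a form becomes a monomial in \<open>T\<close>. Over a domain, the lowest and
  the highest exponent of a product are the sums of those of the factors, so factors of monomials
  are monomials.
\<close>

lemma form_factor:
  assumes "form D (F * G)" "F * G \<noteq> 0"
  shows "\<exists>e. form e F"
proof -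
  let ?S = stretch
  have S: "?S F * ?S G = monom (F * G) D"
    using assms(1) by (simp add: form_iff_stretch rhomD[OF rhom_stretch])
  have nz: "?S F * ?S G \<noteq> 0" unfolding S using assms(2) by simp
  then have nz': "?S F \<noteq> 0" "?S G \<noteq> 0" by auto
  have "degree (?S F) + degree (?S G) = D"
    using degree_mult_eq[OF nz'] assms(2) unfolding S by (simp add: degree_monom_eq)
  moreover have "D \<le> order 0 (?S F) + order 0 (?S G)"
    using nz monom_1_dvd_iff[OF nz, of D] unfolding order_mult[OF nz, symmetric]
    by (simp add: S monom_1_dvd_iff')
  moreover have "order 0 (?S F) \<le> degree (?S F)" "order 0 (?S G) \<le> degree (?S G)"
    using nz' by (simp_all add: order_degree)
  ultimately have "degree (?S F) \<le> order 0 (?S F)" by linarith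
  then have low: "coeff (?S F) k = 0" if "k < degree (?S F)" for k
    using that monom_1_dvd_iff[OF nz'(1)] monom_1_dvd_iff'[of _ "?S F"] by blast
  have "form (degree (?S F)) F" unfolding form_def
  proof (intro allI impI)
    fix i j k assume n: "coeff3 F i j k \<noteq> 0"
    have "coeff3 (coeff (?S F) (i + j + k)) i j k \<noteq> 0" using n by (simp add: coeff3_stretch)
    then have "coeff (?S F) (i + j + k) \<noteq> 0" by auto
    then show "i + j + k = degree (?S F)"
      using low by (metis le_degree linorder_cases not_le)
  qed
  then show ?thesis by blast
qed

section \<open>Jets\<close>

definition const3 :: "complex \<Rightarrow> poly3" where "const3 c = [:[:[:c:]:]:]"

text \<open>
  In the target ring of \<open>jet\<close> the outermost variable is \<open>T\<close> and the inner ones are the directions \<open>X\<close>, \<open>Y\<close>.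
\<close>

definition jetX :: "complex ^ 3 \<Rightarrow> poly3" where "jetX x = const3 (x $ 1) + monom3 1 1 0 1"
definition jetY :: "complex ^ 3 \<Rightarrow> poly3" where "jetY x = const3 (x $ 2) + monom3 1 0 1 1"

text \<open>
  The expansion \<open>F (x1 + T X, x2 + T Y, x3)\<close> of \<open>F\<close> at \<open>x\<close> in a general direction of the chart \<open>Z \<noteq> 0\<close>. For a
  form, the multiplicity at \<open>x\<close> is the order of vanishing at \<open>T = 0\<close>. As \<open>jet x\<close> is a ring homomorphism
  into polynomials over a domain, multiplicities become additive.
\<close>

definition jet :: "complex ^ 3 \<Rightarrow> poly3 \<Rightarrow> poly3" where
  "jet x = subst3 const3 (jetX x) (jetY x) (const3 (x $ 3))"

lemma rhom_const3: "rhom const3"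
  by (simp add: rhom_def const3_def one_pCons)

lemma rhom_jet: "rhom (jet x)"
  unfolding jet_def by (rule rhom_subst3[OF rhom_const3])

lemma const3_monom3: "const3 c = monom3 0 0 0 c"
  by (simp add: const3_def monom3_def monom_0)

lemma jet_monom3: "jet x (monom3 i j k c) = const3 c * const3 (x $ 3) ^ k * jetY x ^ j * jetX x ^ i"
  unfolding jet_def by (rule subst3_monom3[OF rhom_const3])

lemma coeff_jet_0: "coeff (jet x F) 0 = [:[:eval3 F x:]:]"
proof (induction F rule: poly3_induct)
  case (monom3 i j k c)
  have X: "poly (jetX x) 0 = [:[:x $ 1:]:]" and Y: "poly (jetY x) 0 = [:[:x $ 2:]:]"
    by (simp_all add: jetX_def jetY_def const3_def monom3_def poly_monom)
  have pw: "[:[:a:]:] ^ n = [:[:a ^ n:]:]" for a :: complex and n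
    by (induction n) (simp_all add: one_pCons)
  show ?case
    by (simp add: poly_0_coeff_0[symmetric] jet_monom3 X Y eval3_monom3) (simp add: const3_def pw)
qed (simp add: rhomD[OF rhom_jet])

lemma monom3_0 [simp]: "monom3 i j k 0 = 0" by (simp add: monom3_def)

definition derivation :: "('a::comm_ring_1 \<Rightarrow> 'a) \<Rightarrow> bool" where
  "derivation d \<longleftrightarrow> (\<forall>a b. d (a + b) = d a + d b) \<and> (\<forall>a b. d (a * b) = d a * b + a * d b)"

lemma derivation_power:
  assumes "derivation d" shows "d (a ^ n) = of_nat n * a ^ (n - 1) * d a"
proof (induction n)
  case 0
  have "d (1 * 1) = d 1 * 1 + 1 * d 1" using assms unfolding derivation_def by blast
  then show ?case by simp
next
  case (Suc n)
  have "d (a * a ^ n) = d a * a ^ n + a * d (a ^ n)" using assms unfolding derivation_def by blast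
  then show ?case using Suc by (cases n) (simp_all add: algebra_simps)
qed

lemma const3_of_nat: "const3 (of_nat n * c) = of_nat n * const3 c"
  by (simp add: const3_def of_nat_poly)

text \<open>
  To be used for the three partial derivatives of the target ring. That in \<open>T\<close> gives
  \<open>X * jet (dX F) + Y * jet (dY F)\<close>, while those in \<open>X\<close> and in \<open>Y\<close> give \<open>T * jet (dX F)\<close> and
  \<open>T * jet (dY F)\<close>: together they relate divisibility of \<open>jet F\<close> by powers of \<open>T\<close> to derivatives of \<open>F\<close>.
\<close>

lemma chain_rule:
  assumes d: "derivation d" and c: "\<And>c. d (const3 c) = 0"
  shows "d (jet x F) = d (jetX x) * jet x (dX F) + d (jetY x) * jet x (dY F)"
proof (induction F rule: poly3_induct)
  case (monom3 i j k c)
  have dm: "d (a * b) = d a * b + a * d b" for a b using d unfolding derivation_def by blast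
  show ?case
    by (simp add: jet_monom3 dX_monom3 dY_monom3 dm derivation_power[OF d] assms(2) const3_of_nat)
next
  case (add F G)
  have da: "d (a + b) = d a + d b" for a b using d unfolding derivation_def by blast
  from add show ?case by (simp add: d_add rhomD[OF rhom_jet] da algebra_simps)
qed

lemma derivation_dX: "derivation dX"
  unfolding derivation_def by (simp add: d_add) (simp add: dX_def pderiv_mult algebra_simps)

lemma derivation_by_monom3:
  assumes add: "\<And>F G. d (F + G) = d F + d G"
    and m: "\<And>i j k c a b e r. d (monom3 i j k c * monom3 a b e r)
      = d (monom3 i j k c) * monom3 a b e r + monom3 i j k c * d (monom3 a b e r)"
  shows "derivation (d :: poly3 \<Rightarrow> poly3)"
proof -
  have "d (F * G) = d F * G + F * d G" for F G
  proof (induction F rule: poly3_induct)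
    case (monom3 i j k c)
    show ?case by (induction G rule: poly3_induct) (simp_all add: m ring_distribs add)
  qed (simp add: ring_distribs add)
  with add show ?thesis by (simp add: derivation_def)
qed

lemma monom3_add: "monom3 i j k (c + d) = monom3 i j k c + monom3 i j k d"
  by (simp add: monom3_def add_monom)

lemma derivation_dY: "derivation dY"
proof (rule derivation_by_monom3)
  fix i j k c a b e r
  have "of_nat (j + b) * (c * r) = of_nat j * (c * r) + of_nat b * (c * r)" for c r :: complex
    by (simp add: algebra_simps)
  then show "dY (monom3 i j k c * monom3 a b e r)
      = dY (monom3 i j k c) * monom3 a b e r + monom3 i j k c * dY (monom3 a b e r)"
    by (cases j; cases b) (simp_all add: monom3_mult dY_monom3 monom3_add[symmetric] algebra_simps)
qed (simp add: d_add)

lemma derivation_dZ: "derivation dZ"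
proof (rule derivation_by_monom3)
  fix i j k c a b e r
  show "dZ (monom3 i j k c * monom3 a b e r)
      = dZ (monom3 i j k c) * monom3 a b e r + monom3 i j k c * dZ (monom3 a b e r)"
    by (cases k; cases e) (simp_all add: monom3_mult dZ_monom3 monom3_add[symmetric] algebra_simps)
qed (simp add: d_add)

lemma pderiv_jet: "dX (jet x F) = monom3 0 1 0 1 * jet x (dX F) + monom3 0 0 1 1 * jet x (dY F)"
  using chain_rule[OF derivation_dX, of x F]
  by (simp add: const3_monom3 jetX_def jetY_def d_add d_monom3)
lemma dY_jet: "dY (jet x F) = monom3 1 0 0 1 * jet x (dX F)"
  using chain_rule[OF derivation_dY, of x F]
  by (simp add: const3_monom3 jetX_def jetY_def d_add d_monom3)
lemma dZ_jet: "dZ (jet x F) = monom3 1 0 0 1 * jet x (dY F)"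
  using chain_rule[OF derivation_dZ, of x F]
  by (simp add: const3_monom3 jetX_def jetY_def d_add d_monom3)

text \<open>
  Both directions are inductions on \<open>m\<close>. If the derivatives vanish, the derivative of the jet in \<open>T\<close> is
  divisible by \<open>T ^ m\<close> by induction, and the constant term is \<open>F x = 0\<close>. Conversely, if \<open>T ^ (m + 1)\<close> divides the
  jet of \<open>F\<close>, it divides the derivatives \<open>T * jet (dX F)\<close> and \<open>T * jet (dY F)\<close> in the directions.
\<close>

lemma jet_vanish_iff:
  "(\<forall>k<m. coeff (jet x F) k = 0) \<longleftrightarrow> (\<forall>a b. a + b < m \<longrightarrow> eval3 (deriv3 a b 0 F) x = 0)"
proof
  have c1: "coeff (monom3 0 i j c * G) k = monom (monom c j) i * coeff G k" for i j c k and G :: poly3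
    by (simp add: monom3_def monom_0)
  show "\<forall>k<m. coeff (jet x F) k = 0" if "\<forall>a b. a + b < m \<longrightarrow> eval3 (deriv3 a b 0 F) x = 0"
    using that
  proof (induction m arbitrary: F)
    case (Suc m)
    show ?case
    proof (intro allI impI)
      fix k assume k: "k < Suc m"
      show "coeff (jet x F) k = 0"
      proof (cases k)
        case 0
        have "eval3 (deriv3 0 0 0 F) x = 0" using Suc.prems[rule_format, of 0 0] by simp
        then show ?thesis by (simp add: 0 coeff_jet_0)
      next
        case (Suc l)
        have "\<forall>a b. a + b < m \<longrightarrow> eval3 (deriv3 a b 0 (dX F)) x = 0"
             "\<forall>a b. a + b < m \<longrightarrow> eval3 (deriv3 a b 0 (dY F)) x = 0"
          using Suc.prems by (simp_all flip: deriv3_Suc)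
        then have "coeff (jet x (dX F)) l = 0" "coeff (jet x (dY F)) l = 0"
          using Suc.IH k Suc by auto
        then have "coeff (dX (jet x F)) l = 0" by (simp add: pderiv_jet c1)
        then show ?thesis
          by (simp add: dX_def coeff_pderiv Suc del: of_nat_Suc)
      qed
    qed
  qed simp
  show "\<forall>a b. a + b < m \<longrightarrow> eval3 (deriv3 a b 0 F) x = 0" if "\<forall>k<m. coeff (jet x F) k = 0"
    using that
  proof (induction m arbitrary: F)
    case (Suc m)
    have T: "coeff (monom3 1 0 0 1 * G) (Suc k) = coeff G k" for G :: poly3 and k
      by (simp add: monom3_def monom_0 coeff_monom_mult flip: one_pCons)
    have d: "coeff (dY G) k = 0" "coeff (dZ G) k = 0" if "coeff G k = 0" for G :: poly3 and k
      using that by (simp_all add: dY_def dZ_def coeff_map_poly)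
    have "\<forall>k<m. coeff (jet x (dX F)) k = 0"
      by (metis Suc.prems Suc_mono T d(1) dY_jet)
    moreover have "\<forall>k<m. coeff (jet x (dY F)) k = 0"
      by (metis Suc.prems Suc_mono T d(2) dZ_jet)
    ultimately have IH: "a + b < m \<longrightarrow> eval3 (deriv3 a b 0 (dX F)) x = 0"
      "a + b < m \<longrightarrow> eval3 (deriv3 a b 0 (dY F)) x = 0" for a b
      using Suc.IH by blast+
    show ?case
    proof (intro allI impI)
      fix a b assume ab: "a + b < Suc m"
      show "eval3 (deriv3 a b 0 F) x = 0"
      proof (cases a)
        case (Suc a') then show ?thesis using IH(1)[of a' b] ab by (simp add: deriv3_Suc)
      next
        case a: 0
        show ?thesis
        proof (cases b)
          case (Suc b') then show ?thesis using IH(2)[of a b'] ab by (simp add: deriv3_Suc)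
        next
          case 0
          have "coeff (jet x F) 0 = 0" using Suc.prems by simp
          then show ?thesis by (simp add: coeff_jet_0 a 0)
        qed
      qed
    qed
  qed simp
qed

lemma mult_ge_iff_jet:
  assumes "form D F" "x $ 3 \<noteq> 0"
  shows "mult_ge F x m \<longleftrightarrow> monom 1 m dvd jet x F"
  unfolding mult_ge_planar[OF assms] jet_vanish_iff[symmetric] monom_1_dvd_iff' ..

lemma jet_nonzero:
  assumes "F \<noteq> 0" "form D F" "x $ 3 \<noteq> 0" shows "jet x F \<noteq> 0"
proof
  assume "jet x F = 0"
  then have "mult_ge F x (Suc D)" using mult_ge_iff_jet[OF assms(2,3)] by simp
  then show False using mult_ge_iff[OF assms(1,2)] multiplicity_le_degree[OF assms(1,2), of x] by simp
qed

lemma multiplicity_eq_order: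
  assumes "F \<noteq> 0" "form D F" "x $ 3 \<noteq> 0"
  shows "multiplicity_at F x = order 0 (jet x F)"
proof -
  have "m \<le> multiplicity_at F x \<longleftrightarrow> m \<le> order 0 (jet x F)" for m
    using mult_ge_iff[OF assms(1,2)] mult_ge_iff_jet[OF assms(2,3)] monom_1_dvd_iff[OF jet_nonzero[OF assms]]
    by blast
  then show ?thesis by (metis le_antisym le_refl)
qed

lemma multiplicity_mult:
  assumes "F \<noteq> 0" "form D F" "G \<noteq> 0" "form E G" "x $ 3 \<noteq> 0"
  shows "multiplicity_at (F * G) x = multiplicity_at F x + multiplicity_at G x"
proof -
  have "jet x (F * G) = jet x F * jet x G" by (rule rhomD[OF rhom_jet])
  moreover have "jet x F * jet x G \<noteq> 0" using jet_nonzero[of F] jet_nonzero[of G] assms by simp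
  ultimately show ?thesis
    using assms multiplicity_eq_order[of F D x] multiplicity_eq_order[of G E x]
      multiplicity_eq_order[of "F * G" "D + E" x] form_mult[of D F E G]
    by (simp add: order_mult)
qed

lemma mult_ge_mult:
  assumes "form D F" "form E G" "x $ 3 \<noteq> 0" "mult_ge F x a" "mult_ge G x b"
  shows "mult_ge (F * G) x (a + b)"
proof -
  have "monom 1 (a + b) = (monom 1 a * monom 1 b :: poly3)" by (simp add: mult_monom)
  then show ?thesis
    using assms mult_ge_iff_jet[of D F x a] mult_ge_iff_jet[of E G x b]
      mult_ge_iff_jet[OF form_mult[of D F E G], of x "a + b"]
    by (simp add: rhomD[OF rhom_jet] mult_dvd_mono)
qed

section \<open>Counting conditions\<close>

text \<open>
  All existence statements below come from this one: more unknowns than equations.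
\<close>

lemma underdetermined_system:
  fixes a :: "'r \<Rightarrow> 'i \<Rightarrow> complex"
  assumes "finite R" "finite I" "card R < card I"
  shows "\<exists>u. (\<exists>i\<in>I. u i \<noteq> 0) \<and> (\<forall>r\<in>R. (\<Sum>i\<in>I. a r i * u i) = 0)"
  using assms
proof (induction R arbitrary: I a rule: finite_induct)
  case empty
  then obtain i where "i \<in> I" by fastforce
  then show ?case by (intro exI[of _ "\<lambda>_. 1"]) auto
next
  case (insert r R)
  show ?case
  proof (cases "\<forall>i\<in>I. a r i = 0")
    case True
    have "card R < card I" using insert by simp
    then obtain u where "\<exists>i\<in>I. u i \<noteq> 0" "\<forall>s\<in>R. (\<Sum>i\<in>I. a s i * u i) = 0"
      using insert.IH[of I a] insert.prems by blast
    then show ?thesis using True by (intro exI[of _ u]) auto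
  next
    case False
    then obtain j where j: "j \<in> I" "a r j \<noteq> 0" by blast
    let ?I = "I - {j}"
    \<comment> \<open>the system after the unknown \<open>j\<close> has been eliminated by means of row \<open>r\<close>\<close>
    define b where "b s i = a s i - a s j * a r i / a r j" for s i
    have "card R < card ?I" using insert j by simp
    then obtain u where u: "\<exists>i\<in>?I. u i \<noteq> 0" "\<forall>s\<in>R. (\<Sum>i\<in>?I. b s i * u i) = 0"
      using insert.IH[of ?I b] insert.prems by blast
    define v where "v = u(j := - (\<Sum>i\<in>?I. a r i * u i) / a r j)"
    have vj: "v j = - (\<Sum>i\<in>?I. a r i * u i) / a r j" by (simp add: v_def)
    have split: "(\<Sum>i\<in>I. a s i * v i) = a s j * v j + (\<Sum>i\<in>?I. a s i * u i)" for s
    proof -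
      have "(\<Sum>i\<in>I. a s i * v i) = a s j * v j + (\<Sum>i\<in>?I. a s i * v i)"
        using j insert.prems by (simp add: sum.remove)
      also have "(\<Sum>i\<in>?I. a s i * v i) = (\<Sum>i\<in>?I. a s i * u i)"
        by (rule sum.cong) (auto simp: v_def)
      finally show ?thesis .
    qed
    have "(\<Sum>i\<in>I. a s i * v i) = 0" if "s \<in> R" for s
    proof -
      have "(\<Sum>i\<in>?I. b s i * u i) = (\<Sum>i\<in>?I. a s i * u i) - a s j / a r j * (\<Sum>i\<in>?I. a r i * u i)"
        unfolding sum_distrib_left sum_subtractf[symmetric] b_def
        by (rule sum.cong) (auto simp: algebra_simps)
      then show ?thesis using u(2) that by (simp add: split vj)
    qed
    moreover have "(\<Sum>i\<in>I. a r i * v i) = 0" using j by (simp add: split vj)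
    moreover have "\<exists>i\<in>I. v i \<noteq> 0" using u(1) by (auto simp: v_def)
    ultimately show ?thesis by (intro exI[of _ v]) auto
  qed
qed

definition lower_triangle :: "nat \<Rightarrow> (nat \<times> nat) set" where
  "lower_triangle m = {(a, b). a + b < m}"

lemma lower_triangle: "finite (lower_triangle m)" "2 * card (lower_triangle m) = m * (m + 1)"
proof -
  have "lower_triangle m = (case m of 0 \<Rightarrow> {} | Suc k \<Rightarrow> triangle k)"
    by (auto simp: lower_triangle_def triangle_def split: nat.split)
  then show "finite (lower_triangle m)" "2 * card (lower_triangle m) = m * (m + 1)"
    by (cases m; simp add: card_triangle)+
qed

definition conditions :: "nat \<Rightarrow> (nat \<Rightarrow> nat) \<Rightarrow> (nat \<times> nat \<times> nat) set" where
  "conditions n m = (SIGMA i:{..n}. lower_triangle (m i))"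

lemma conditions: "finite (conditions n m)" "2 * card (conditions n m) = (\<Sum>i\<le>n. m i * (m i + 1))"
  by (simp_all add: conditions_def lower_triangle sum_distrib_left del: mult_Suc_right)

definition lincomb :: "'i set \<Rightarrow> ('i \<Rightarrow> complex) \<Rightarrow> ('i \<Rightarrow> poly3) \<Rightarrow> poly3" where
  "lincomb I u b = (\<Sum>i\<in>I. scale3 (u i) (b i))"

lemma eval3_deriv3_lincomb:
  "eval3 (deriv3 a b c (lincomb I u f)) x = (\<Sum>i\<in>I. eval3 (deriv3 a b c (f i)) x * u i)"
  by (simp add: lincomb_def deriv3_sum eval3_sum deriv3_scale3 mult.commute)

lemma coeff3_lincomb: "coeff3 (lincomb I u f) i j k = (\<Sum>t\<in>I. coeff3 (f t) i j k * u t)"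
  by (simp add: lincomb_def coeff_sum mult.commute)

lemma scale3_const3: "scale3 c F = const3 c * F"
  by (simp add: scale3_def const3_def)

lemma lincomb_mult: "A * lincomb I u f = lincomb I u (\<lambda>i. A * f i)"
  by (simp add: lincomb_def sum_distrib_left scale3_def)

lemma lincomb_add: "lincomb I u f + lincomb I u g = lincomb I u (\<lambda>i. f i + g i)"
  by (simp add: lincomb_def sum.distrib[symmetric] scale3_def smult_add_right)

lemma form_lincomb: "(\<And>i. i \<in> I \<Longrightarrow> form D (f i)) \<Longrightarrow> form D (lincomb I u f)"
  unfolding lincomb_def by (intro form_sum form_scale3)

definition basis_monom :: "nat \<Rightarrow> nat \<times> nat \<Rightarrow> poly3" where
  "basis_monom D = (\<lambda>(i, j). monom3 i j (D - i - j) 1)"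

lemma form_basis_monom: "t \<in> triangle D \<Longrightarrow> form D (basis_monom D t)"
  by (auto simp: basis_monom_def triangle_def intro!: form_monom3)

lemma coeff3_lincomb_basis_monom:
  assumes "(i, j) \<in> triangle D"
  shows "coeff3 (lincomb (triangle D) u (basis_monom D)) i j (D - i - j) = u (i, j)"
proof -
  have "coeff3 (lincomb (triangle D) u (basis_monom D)) i j (D - i - j)
     = (\<Sum>t\<in>triangle D. if t = (i, j) then u (i, j) else 0)"
    unfolding coeff3_lincomb
    by (rule sum.cong) (auto simp: basis_monom_def coeff3_monom3 split: prod.splits)
  then show ?thesis using assms by simp
qed

lemma form_eq_0: "form D F \<Longrightarrow> (\<And>i j. (i, j) \<in> triangle D \<Longrightarrow> coeff3 F i j (D - i - j) = 0) \<Longrightarrow> F = 0"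
  by (subst form_sum_monom3[of D F]) (auto intro!: sum.neutral)

text \<open>
  The number of coefficients of a form of degree \<open>D\<close> is half the right hand side of the inequality, and
  the number of conditions is half the left hand side.
\<close>

theorem exists_form:
  fixes n :: nat and p :: "nat \<Rightarrow> complex ^ 3"
  assumes p: "\<And>i. i \<le> n \<Longrightarrow> p i $ 3 \<noteq> 0"
    and v: "(\<Sum>i\<le>n. m i * (m i + 1)) < (D + 1) * (D + 2)"
  shows "\<exists>F. F \<noteq> 0 \<and> form D F \<and> (\<forall>i\<le>n. mult_ge F (p i) (m i))"
proof -
  let ?a = "\<lambda>(i, a, b) t. eval3 (deriv3 a b 0 (basis_monom D t)) (p i)"
  have "card (conditions n m) < card (triangle D)"
    using v conditions(2)[of n m] card_triangle[of D] by linarith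
  from underdetermined_system[OF conditions(1) finite_triangle this, of ?a]
  obtain u where u: "\<exists>t\<in>triangle D. u t \<noteq> 0"
    and e: "\<forall>r\<in>conditions n m. (\<Sum>t\<in>triangle D. ?a r t * u t) = 0" by blast
  define F where "F = lincomb (triangle D) u (basis_monom D)"
  have F: "form D F" unfolding F_def by (intro form_lincomb form_basis_monom)
  have "F \<noteq> 0" using u coeff3_lincomb_basis_monom[of _ _ D u] unfolding F_def by auto
  moreover have "mult_ge F (p i) (m i)" if "i \<le> n" for i
    unfolding mult_ge_planar[OF F p[OF that]]
  proof (intro allI impI)
    fix a b assume "a + b < m i"
    then have "(i, a, b) \<in> conditions n m" using that by (simp add: conditions_def lower_triangle_def)
    then show "eval3 (deriv3 a b 0 F) (p i) = 0"
      unfolding F_def eval3_deriv3_lincomb using e by force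
  qed
  ultimately show ?thesis using F by blast
qed

section \<open>Bezout's inequality\<close>

text \<open>
  The exponent of the leading monomial in the lexicographic order, which is multiplicative.
\<close>

definition lead :: "poly3 \<Rightarrow> nat \<times> nat \<times> nat" where
  "lead F = (degree F, degree (lead_coeff F), degree (lead_coeff (lead_coeff F)))"

lemma coeff3_lead: "F \<noteq> 0 \<Longrightarrow> lead F = (i, j, k) \<Longrightarrow> coeff3 F i j k \<noteq> 0"
  by (auto simp: lead_def)

lemma lead_mult:
  assumes "F \<noteq> 0" "G \<noteq> 0" "lead F = (i, j, k)" "lead G = (a, b, e)"
  shows "lead (F * G) = (i + a, j + b, k + e)"
proof -
  have "lead_coeff (F * G) = lead_coeff F * lead_coeff G"
    "lead_coeff (lead_coeff F * lead_coeff G) = lead_coeff (lead_coeff F) * lead_coeff (lead_coeff G)"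
    by (rule lead_coeff_mult)+
  then have "lead (F * G) = (degree (F * G), degree (lead_coeff F * lead_coeff G),
      degree (lead_coeff (lead_coeff F) * lead_coeff (lead_coeff G)))" by (simp only: lead_def)
  moreover have "degree (F * G) = degree F + degree G"
    "degree (lead_coeff F * lead_coeff G) = degree (lead_coeff F) + degree (lead_coeff G)"
    "degree (lead_coeff (lead_coeff F) * lead_coeff (lead_coeff G))
       = degree (lead_coeff (lead_coeff F)) + degree (lead_coeff (lead_coeff G))"
    by (rule degree_mult_eq; use assms(1,2) in simp)+
  moreover have "i = degree F" "j = degree (lead_coeff F)" "k = degree (lead_coeff (lead_coeff F))"
    "a = degree G" "b = degree (lead_coeff G)" "e = degree (lead_coeff (lead_coeff G))"
    using assms(3,4) by (auto simp: lead_def)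
  ultimately show ?thesis by (simp only:)
qed

lemma jet_scale3: "jet x (scale3 c F) = const3 c * jet x F"
proof -
  have "jet x (const3 c) = const3 c" unfolding const3_monom3[of c] jet_monom3 by (simp add: const3_monom3)
  then show ?thesis by (simp add: scale3_const3 rhomD[OF rhom_jet])
qed

definition linX :: "complex ^ 3 \<Rightarrow> poly3" where
  "linX x = monom3 1 0 0 1 + monom3 0 0 1 (- (x $ 1 / x $ 3))"
definition linY :: "complex ^ 3 \<Rightarrow> poly3" where
  "linY x = monom3 0 1 0 1 + monom3 0 0 1 (- (x $ 2 / x $ 3))"
definition varZ :: poly3 where "varZ = monom3 0 0 1 1"

lemma form_lin: "form 1 (linX x)" "form 1 (linY x)" "form 1 varZ"
  by (auto simp: linX_def linY_def varZ_def intro!: form_add form_monom3)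

lemma jet_lin:
  assumes "x $ 3 \<noteq> 0"
  shows "jet x (linX x) = monom3 1 1 0 1" "jet x (linY x) = monom3 1 0 1 1" "jet x varZ = const3 (x $ 3)"
proof -
  have c: "const3 (- (b / x $ 3)) * const3 (x $ 3) = const3 (- b)" for b
    using assms by (simp add: const3_def)
  have o: "const3 1 = 1" by (simp add: const3_def one_pCons)
  have "jet x (linX x) = const3 (x $ 1) + monom3 1 1 0 1 + const3 (- x $ 1)"
    unfolding linX_def rhomD(3)[OF rhom_jet] jet_monom3 power_0 power_one_right mult_1_right o mult_1_left jetX_def c ..
  also have "\<dots> = monom3 1 1 0 1" by (rule poly3_eqI) (simp add: const3_monom3 coeff3_monom3)
  finally show "jet x (linX x) = monom3 1 1 0 1" .
  have "jet x (linY x) = const3 (x $ 2) + monom3 1 0 1 1 + const3 (- x $ 2)"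
    unfolding linY_def rhomD(3)[OF rhom_jet] jet_monom3 power_0 power_one_right mult_1_right o mult_1_left jetY_def c ..
  also have "\<dots> = monom3 1 0 1 1" by (rule poly3_eqI) (simp add: const3_monom3 coeff3_monom3)
  finally show "jet x (linY x) = monom3 1 0 1 1" .
  show "jet x varZ = const3 (x $ 3)"
    unfolding varZ_def jet_monom3 power_0 power_one_right mult_1_right o mult_1_left ..
qed

text \<open>
  The form indexed by \<open>(i, a, b)\<close> vanishes to order \<open>s k\<close> at all \<open>p k\<close> with \<open>k \<noteq> i\<close>, and its expansion at \<open>p i\<close>
  starts with a multiple of \<open>X ^ a * Y ^ b\<close>. So these forms of degree \<open>N\<close> are dual to the conditions of
  vanishing to order \<open>s i\<close> at all \<open>p i\<close>: for large \<open>N\<close> these conditions are independent.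
\<close>

definition dual_form :: "nat \<Rightarrow> (nat \<Rightarrow> complex ^ 3) \<Rightarrow> (nat \<Rightarrow> nat) \<Rightarrow> nat \<Rightarrow> nat \<times> nat \<times> nat \<Rightarrow> poly3" where
  "dual_form n p s N = (\<lambda>(i, a, b).
     (\<Prod>k\<in>{..n} - {i}. linX (p k) ^ s k) * (linX (p i) ^ a * linY (p i) ^ b * varZ ^ (N - a - b - (\<Sum>k\<in>{..n} - {i}. s k))))"

lemma form_dual_form:
  assumes "(\<Sum>k\<le>n. s k) \<le> N" "t \<in> conditions n s"
  shows "form N (dual_form n p s N t)"
proof -
  obtain i a b where t: "t = (i, a, b)" "i \<le> n" "a + b < s i"
    using assms(2) by (auto simp: conditions_def lower_triangle_def)
  let ?S = "\<Sum>k\<in>{..n} - {i}. s k"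
  have S: "(\<Sum>k\<le>n. s k) = s i + ?S" using t by (simp add: sum.remove)
  have "form (?S + (1 * a + 1 * b + 1 * (N - a - b - ?S))) (dual_form n p s N t)"
    unfolding dual_form_def t(1) prod.case
  proof (intro form_mult form_power form_lin)
    have "form (\<Sum>k\<in>{..n} - {i}. 1 * s k) (\<Prod>k\<in>{..n} - {i}. linX (p k) ^ s k)"
      by (intro form_prod form_power form_lin) simp
    then show "form ?S (\<Prod>k\<in>{..n} - {i}. linX (p k) ^ s k)" by simp
  qed
  moreover have "?S + (1 * a + 1 * b + 1 * (N - a - b - ?S)) = N"
    using S assms(1) t(3) by simp
  ultimately show ?thesis by simp
qed

text \<open>
  At \<open>p i\<close> the terms for other points are divisible by \<open>T ^ s i\<close>. What remains is a unit times
  \<open>\<Sum>(a, b). q (i, a, b) * T ^ (a + b) * X ^ a * Y ^ b\<close> up to powers of the nonzero third coordinate, and is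
  divisible by \<open>T ^ s i\<close> only if all coefficients vanish.
\<close>

lemma dual_forms_independent:
  assumes p: "\<And>i. i \<le> n \<Longrightarrow> p i $ 3 \<noteq> 0"
    and dist: "\<And>i j. i \<le> n \<Longrightarrow> j \<le> n \<Longrightarrow> i \<noteq> j \<Longrightarrow> p i $ 1 / p i $ 3 \<noteq> p j $ 1 / p j $ 3"
    and H: "H = lincomb (conditions n s) q (dual_form n p s N)"
    and N: "(\<Sum>k\<le>n. s k) \<le> N"
    and m: "\<And>i. i \<le> n \<Longrightarrow> mult_ge H (p i) (s i)"
    and t: "(i, a, b) \<in> conditions n s"
  shows "q (i, a, b) = 0"
proof -
  have i: "i \<le> n" and ab: "a + b < s i" using t by (auto simp: conditions_def lower_triangle_def)
  let ?x = "p i" and ?T = "monom 1 (s i) :: poly3"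
  let ?Q = "dual_form n p s N" and ?S = "\<Sum>k\<in>{..n} - {i}. s k"
  define K where "K = jet ?x (\<Prod>k\<in>{..n} - {i}. linX (p k) ^ s k)"
  define B where "B = (\<Sum>ab\<in>lower_triangle (s i).
      const3 (q (i, ab)) * (monom3 1 1 0 1 ^ fst ab * monom3 1 0 1 1 ^ snd ab * const3 (?x $ 3) ^ (N - fst ab - snd ab - ?S)))"
  have fH: "form N H" unfolding H by (intro form_lincomb form_dual_form[OF N])
  have "?T dvd jet ?x H" using m[OF i] mult_ge_iff_jet[OF fH p[OF i]] by simp
  moreover have jH: "jet ?x H = (\<Sum>k\<le>n. \<Sum>ab\<in>lower_triangle (s k). const3 (q (k, ab)) * jet ?x (?Q (k, ab)))"
    unfolding H lincomb_def conditions_def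
    by (subst sum.Sigma) (simp_all only: rhom_sum[OF rhom_jet] jet_scale3 lower_triangle(1) case_prod_unfold finite_atMost prod.collapse ball_triv simp_thms)
  moreover have "(\<Sum>k\<le>n. \<Sum>ab\<in>lower_triangle (s k). const3 (q (k, ab)) * jet ?x (?Q (k, ab)))
     = (\<Sum>ab\<in>lower_triangle (s i). const3 (q (i, ab)) * jet ?x (?Q (i, ab)))
     + (\<Sum>k\<in>{..n} - {i}. \<Sum>ab\<in>lower_triangle (s k). const3 (q (k, ab)) * jet ?x (?Q (k, ab)))"
    using i by (simp add: sum.remove)
  moreover have other: "?T dvd (\<Sum>k\<in>{..n} - {i}. \<Sum>ab\<in>lower_triangle (s k). const3 (q (k, ab)) * jet ?x (?Q (k, ab)))"
  proof (intro dvd_sum dvd_mult)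
    fix k ab assume k: "k \<in> {..n} - {i}"
    have "monom3 1 1 0 1 ^ s i = (?T * monom (monom 1 (s i)) 0 :: poly3)"
      by (simp add: monom3_power mult_monom) (simp add: monom3_def monom_0 one_pCons)
    then have "?T dvd jet ?x (linX ?x ^ s i)"
      unfolding rhom_power[OF rhom_jet] jet_lin[OF p[OF i]] by simp
    moreover have "linX ?x ^ s i dvd (\<Prod>l\<in>{..n} - {k}. linX (p l) ^ s l)"
      using k i by (intro dvd_prodI) auto
    then have "linX ?x ^ s i dvd ?Q (k, ab)"
      by (cases ab) (auto simp: dual_form_def)
    then obtain R where "?Q (k, ab) = linX ?x ^ s i * R" ..
    then have "jet ?x (linX ?x ^ s i) dvd jet ?x (?Q (k, ab))"
      by (simp only: rhomD(4)[OF rhom_jet] dvd_triv_left)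
    ultimately show "?T dvd jet ?x (?Q (k, ab))" by (rule dvd_trans)
  qed
  ultimately have "?T dvd (\<Sum>ab\<in>lower_triangle (s i). const3 (q (i, ab)) * jet ?x (?Q (i, ab)))"
    by (simp only: dvd_add_left_iff[OF other])
  also have "(\<Sum>ab\<in>lower_triangle (s i). const3 (q (i, ab)) * jet ?x (?Q (i, ab))) = K * B"
    unfolding B_def sum_distrib_left K_def
  proof (rule sum.cong)
    fix ab
    show "const3 (q (i, ab)) * jet ?x (?Q (i, ab)) = jet ?x (\<Prod>k\<in>{..n} - {i}. linX (p k) ^ s k) *
         (const3 (q (i, ab)) * (monom3 1 1 0 1 ^ fst ab * monom3 1 0 1 1 ^ snd ab * const3 (?x $ 3) ^ (N - fst ab - snd ab - ?S)))"
      by (simp only: dual_form_def case_prod_unfold fst_conv snd_conv rhomD(4)[OF rhom_jet]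
         rhom_power[OF rhom_jet] jet_lin[OF p[OF i]] mult_ac)
  qed simp
  finally have TKB: "?T dvd K * B" .
  have "eval3 (linX (p k)) ?x \<noteq> 0" if "k \<in> {..n} - {i}" for k
  proof
    assume "eval3 (linX (p k)) ?x = 0"
    then have "?x $ 1 = p k $ 1 / p k $ 3 * ?x $ 3" by (simp add: linX_def eval3_monom3)
    then have "?x $ 1 / ?x $ 3 = p k $ 1 / p k $ 3" using p[OF i] by simp
    then show False using dist[of i k] that i by auto
  qed
  then have "eval3 (\<Prod>k\<in>{..n} - {i}. linX (p k) ^ s k) ?x \<noteq> 0"
  proof -
    assume *: "\<And>k. k \<in> {..n} - {i} \<Longrightarrow> eval3 (linX (p k)) ?x \<noteq> 0"
    have pw: "eval3 (F ^ e) ?x = eval3 F ?x ^ e" for F e by (induction e) auto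
    have pr: "eval3 (prod f A) ?x = (\<Prod>a\<in>A. eval3 (f a) ?x)" for f and A :: "nat set"
      by (induction A rule: infinite_finite_induct) auto
    show ?thesis using * by (simp add: pr pw)
  qed
  then have K0: "coeff K 0 \<noteq> 0" unfolding K_def coeff_jet_0 by simp
  have "?T dvd B"
  proof (cases "B = 0")
    case False
    have K: "K \<noteq> 0" using K0 by auto
    have "order 0 K = 0" using K0 by (intro order_0I) (simp add: poly_0_coeff_0)
    then show ?thesis
      using TKB False K order_mult[of K B] monom_1_dvd_iff[of "K * B" "s i"] monom_1_dvd_iff[of B "s i"]
      by simp
  qed simp
  then have "coeff B (a + b) = 0" using ab by (simp add: monom_1_dvd_iff')
  then have "coeff3 B (a + b) a b = 0" by simp
  moreover have "coeff3 B (a + b) a b = q (i, a, b) * ?x $ 3 ^ (N - a - b - ?S)"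
  proof -
    have "coeff3 B (a + b) a b = (\<Sum>t\<in>lower_triangle (s i). if t = (a, b) then q (i, a, b) * ?x $ 3 ^ (N - a - b - ?S) else 0)"
      unfolding B_def coeff_sum
      by (rule sum.cong) (auto simp: const3_monom3 monom3_power monom3_mult coeff3_monom3)
    moreover have "(a, b) \<in> lower_triangle (s i)" using ab by (simp add: lower_triangle_def)
    ultimately show ?thesis by (simp only: sum.delta lower_triangle(1) if_True)
  qed
  ultimately show ?thesis using p[OF i] by simp
qed

text \<open>
  Suppose the inequality fails and look for forms \<open>U\<close>, \<open>V\<close> of degrees \<open>N - \<delta>\<close>, \<open>N - d\<close> and numbers \<open>q t\<close>, where
  \<open>N\<close> is large, such that \<open>A U + G V + \<Sum>t. q t * Q t = 0\<close> for the dual forms \<open>Q t\<close> of orders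
  \<open>s i = \<mu> i + m i\<close>, such that \<open>U\<close> and \<open>V\<close> vanish to orders \<open>m i\<close> and \<open>\<mu> i\<close> at \<open>p i\<close>, and such that \<open>U\<close> contains no
  multiple of the leading monomial of \<open>G\<close>. The number of unknowns minus the number of equations is
  \<open>(\<Sum>i\<le>n. \<mu> i * m i) - \<delta> * d > 0\<close>, because
  \<open>(s * (s + 1) - m * (m + 1) - \<mu> * (\<mu> + 1)) / 2 = \<mu> * m\<close> when \<open>s = \<mu> + m\<close>. So there is a nontrivial solution.

  But \<open>A U + G V\<close> vanishes to order \<open>s i\<close> at \<open>p i\<close>, which forces \<open>q = 0\<close> and \<open>A U = - G V\<close>. As \<open>A\<close> is prime and
  does not divide \<open>G\<close>, it divides \<open>V\<close>, so \<open>U\<close> is a multiple of \<open>G\<close>; the condition on its monomials gives \<open>U = 0\<close>,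
  and then \<open>V = 0\<close>.
\<close>

theorem bezout:
  fixes n :: nat and p :: "nat \<Rightarrow> complex ^ 3"
  assumes A: "form \<delta> A" "irreducible A" and G: "form d G" and AG: "\<not> A dvd G"
    and p: "\<And>i. i \<le> n \<Longrightarrow> p i $ 3 \<noteq> 0"
    and dist: "\<And>i j. i \<le> n \<Longrightarrow> j \<le> n \<Longrightarrow> i \<noteq> j \<Longrightarrow> p i $ 1 / p i $ 3 \<noteq> p j $ 1 / p j $ 3"
    and mA: "\<And>i. i \<le> n \<Longrightarrow> mult_ge A (p i) (\<mu> i)"
    and mG: "\<And>i. i \<le> n \<Longrightarrow> mult_ge G (p i) (m i)"
  shows "(\<Sum>i\<le>n. \<mu> i * m i) \<le> \<delta> * d"
proof (rule ccontr)
  assume less: "\<not> ?thesis"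
  have A0: "A \<noteq> 0" using A(2) by auto
  have G0: "G \<noteq> 0" using AG by auto
  define s where "s i = \<mu> i + m i" for i
  \<comment> \<open>the degree \<open>N\<close> is large enough for the dual forms and for the count of monomials\<close>
  define E where "E = (\<Sum>i\<le>n. s i)"
  define N where "N = \<delta> + d + E"
  have N: "N - \<delta> = d + E" "N - d = \<delta> + E" "N - \<delta> - d = E" by (auto simp: N_def)
  obtain i0 j0 k0 where l: "lead G = (i0, j0, k0)" by (cases "lead G") auto
  define I where "I = triangle (N - \<delta>) <+> (triangle (N - d) <+> conditions n s)"
  define R where "R = triangle N <+> (triangle E <+> (conditions n m <+> conditions n \<mu>))"
  define bU where "bU = case_sum (basis_monom (N - \<delta>)) (\<lambda>_ :: nat \<times> nat + nat \<times> nat \<times> nat. 0)"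
  define bV where "bV = case_sum (\<lambda>_ :: nat \<times> nat. 0) (case_sum (basis_monom (N - d)) (\<lambda>_ :: nat \<times> nat \<times> nat. 0))"
  define bQ where "bQ = case_sum (\<lambda>_ :: nat \<times> nat. 0) (case_sum (\<lambda>_ :: nat \<times> nat. 0) (dual_form n p s N))"
  define eqs :: "nat \<times> nat + (nat \<times> nat + (nat \<times> nat \<times> nat + nat \<times> nat \<times> nat)) \<Rightarrow> _ \<Rightarrow> complex"
    where "eqs r t = (case r of
       Inl (i, j) \<Rightarrow> coeff3 (A * bU t + G * bV t + bQ t) i j (N - i - j)
     | Inr (Inl (i, j)) \<Rightarrow> coeff3 (bU t) (i0 + i) (j0 + j) (N - \<delta> - (i0 + i) - (j0 + j))
     | Inr (Inr (Inl (i, a, b))) \<Rightarrow> eval3 (deriv3 a b 0 (bU t)) (p i)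
     | Inr (Inr (Inr (i, a, b))) \<Rightarrow> eval3 (deriv3 a b 0 (bV t)) (p i))" for r t
  have finI: "finite I" and finR: "finite R" by (auto simp: I_def R_def conditions)
  have sums: "(\<Sum>i\<le>n. s i * (s i + 1)) = (\<Sum>i\<le>n. m i * (m i + 1)) + (\<Sum>i\<le>n. \<mu> i * (\<mu> i + 1)) + 2 * (\<Sum>i\<le>n. \<mu> i * m i)"
    unfolding sum_distrib_left sum.distrib[symmetric] s_def by (rule sum.cong) (auto simp: algebra_simps)
  have poly_id: "(d + E + 1) * (d + E + 2) + (\<delta> + E + 1) * (\<delta> + E + 2) + 2 * (\<delta> * d)
      = (N + 1) * (N + 2) + (E + 1) * (E + 2)"
    by (simp add: N_def algebra_simps)
  have cI: "card I = card (triangle (d + E)) + (card (triangle (\<delta> + E)) + card (conditions n s))"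
    unfolding I_def N by (simp add: card_Plus conditions)
  have cR: "card R = card (triangle N) + (card (triangle E) + (card (conditions n m) + card (conditions n \<mu>)))"
    unfolding R_def by (simp add: card_Plus conditions)
  have "2 * card R < 2 * card I"
    using less sums poly_id cI cR card_triangle[of "d + E"] card_triangle[of "\<delta> + E"] card_triangle[of N]
      card_triangle[of E] conditions(2)[of n s] conditions(2)[of n m] conditions(2)[of n \<mu>] by linarith
  then have "card R < card I" by simp
  from underdetermined_system[OF finR finI this, of eqs]
  obtain u where u: "\<exists>t\<in>I. u t \<noteq> 0" and e: "\<And>r. r \<in> R \<Longrightarrow> (\<Sum>t\<in>I. eqs r t * u t) = 0" by blast
  define U V Q where "U = lincomb I u bU" and "V = lincomb I u bV" and "Q = lincomb I u bQ"
  have fU: "form (N - \<delta>) U" unfolding U_def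
    by (intro form_lincomb) (auto simp: I_def bU_def form_basis_monom)
  have fV: "form (N - d) V" unfolding V_def
    by (intro form_lincomb) (auto simp: I_def bV_def form_basis_monom)
  have fQ: "form N Q" unfolding Q_def
    by (intro form_lincomb) (auto simp: I_def bQ_def N_def E_def intro!: form_dual_form)
  have fAU: "form N (A * U)" using form_mult[OF A(1) fU] by (simp add: N_def add_ac)
  have fGV: "form N (G * V)" using form_mult[OF G fV] by (simp add: N_def add_ac)
  have plus: "(\<Sum>t\<in>I. f t) = (\<Sum>t\<in>triangle (N - \<delta>). f (Inl t))
      + ((\<Sum>t\<in>triangle (N - d). f (Inr (Inl t))) + (\<Sum>t\<in>conditions n s. f (Inr (Inr t))))" for f :: "_ \<Rightarrow> poly3"
    unfolding I_def by (simp add: sum.Plus conditions)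
  have s0: "scale3 c 0 = 0" for c by (simp add: scale3_def)
  have U: "U = lincomb (triangle (N - \<delta>)) (u \<circ> Inl) (basis_monom (N - \<delta>))"
    unfolding U_def lincomb_def plus bU_def by (simp add: s0)
  have V: "V = lincomb (triangle (N - d)) (u \<circ> Inr \<circ> Inl) (basis_monom (N - d))"
    unfolding V_def lincomb_def plus bV_def by (simp add: s0)
  have Q: "Q = lincomb (conditions n s) (u \<circ> Inr \<circ> Inr) (dual_form n p s N)"
    unfolding Q_def lincomb_def plus bQ_def by (simp add: s0)
  have "A * U + G * V + Q = 0"
  proof (rule form_eq_0)
    show "form N (A * U + G * V + Q)" by (intro form_add fAU fGV fQ)
    fix i j assume "(i, j) \<in> triangle N"
    then have "Inl (i, j) \<in> R" unfolding R_def by (intro InlI)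
    from e[OF this] show "coeff3 (A * U + G * V + Q) i j (N - i - j) = 0"
      unfolding U_def V_def Q_def lincomb_mult lincomb_add coeff3_lincomb by (simp add: eqs_def)
  qed
  then have Qeq: "Q = - (A * U + G * V)" by (metis eq_neg_iff_add_eq_0 add.commute)
  have mU: "mult_ge U (p i) (m i)" if "i \<le> n" for i
    unfolding mult_ge_planar[OF fU p[OF that]]
  proof (intro allI impI)
    fix a b assume "a + b < m i"
    then have "Inr (Inr (Inl (i, a, b))) \<in> R" using that unfolding R_def by (intro InlI InrI) (simp add: conditions_def lower_triangle_def)
    from e[OF this] show "eval3 (deriv3 a b 0 U) (p i) = 0"
      unfolding U_def eval3_deriv3_lincomb by (simp add: eqs_def)
  qed
  have mV: "mult_ge V (p i) (\<mu> i)" if "i \<le> n" for i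
    unfolding mult_ge_planar[OF fV p[OF that]]
  proof (intro allI impI)
    fix a b assume "a + b < \<mu> i"
    then have "Inr (Inr (Inr (i, a, b))) \<in> R" using that unfolding R_def by (intro InlI InrI) (simp add: conditions_def lower_triangle_def)
    from e[OF this] show "eval3 (deriv3 a b 0 V) (p i) = 0"
      unfolding V_def eval3_deriv3_lincomb by (simp add: eqs_def)
  qed
  have mQ: "mult_ge Q (p i) (s i)" if "i \<le> n" for i
  proof -
    have "mult_ge (A * U) (p i) (s i)"
      using mult_ge_mult[OF A(1) fU p[OF that] mA[OF that] mU[OF that]] by (simp add: s_def)
    moreover have "mult_ge (G * V) (p i) (s i)"
      using mult_ge_mult[OF G fV p[OF that] mG[OF that] mV[OF that]] by (simp add: s_def add.commute)
    ultimately have "mult_ge (scale3 (- 1) (A * U + G * V)) (p i) (s i)"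
      by (intro mult_ge_scale3 mult_ge_add)
    moreover have "scale3 (- 1) (A * U + G * V) = Q" unfolding Qeq by (rule poly3_eqI) simp
    ultimately show ?thesis by simp
  qed
  have q0: "u (Inr (Inr t)) = 0" if "t \<in> conditions n s" for t
    using dual_forms_independent[OF p dist Q _ mQ, of "fst t" "fst (snd t)" "snd (snd t)"] that
    by (simp add: N_def E_def)
  then have "Q = 0" unfolding Q lincomb_def by (intro sum.neutral) (simp add: scale3_def)
  with Qeq have "A * U + G * V = 0" by (metis neg_equal_0_iff_equal)
  then have AUGV: "A * U = - (G * V)" by (rule eq_neg_iff_add_eq_0[THEN iffD2])
  have "A dvd G * V" using AUGV by (metis dvd_minus_iff dvd_triv_left)
  then have "A dvd V" using AG A(2) prime_elem_dvd_mult_iff[of A G V] irreducible_imp_prime_elem by blast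
  then obtain V' where V': "V = A * V'" by blast
  have "A * U = A * (- (G * V'))" using AUGV by (simp add: V' algebra_simps)
  then have U': "U = - (G * V')" using A0 mult_cancel_left by blast
  \<comment> \<open>otherwise the leading monomial of \<open>U\<close> is a multiple of that of \<open>G\<close>\<close>
  have "V' = 0"
  proof (rule ccontr)
    assume nz: "V' \<noteq> 0"
    obtain i j k where l': "lead V' = (i, j, k)" by (cases "lead V'") auto
    have ne: "coeff3 U (i0 + i) (j0 + j) (k0 + k) \<noteq> 0"
      using coeff3_lead[OF _ lead_mult[OF G0 nz l l']] G0 nz by (simp add: U')
    then have deg: "(i0 + i) + (j0 + j) + (k0 + k) = N - \<delta>" using fU unfolding form_def by blast
    have "i0 + j0 + k0 = d" using coeff3_lead[OF G0 l] G unfolding form_def by blast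
    then have "(i, j) \<in> triangle E" using deg N by (auto simp: triangle_def)
    then have "Inr (Inl (i, j)) \<in> R" unfolding R_def by (intro InlI InrI)
    from e[OF this] have "coeff3 U (i0 + i) (j0 + j) (N - \<delta> - (i0 + i) - (j0 + j)) = 0"
      unfolding U_def coeff3_lincomb by (simp add: eqs_def)
    moreover have "N - \<delta> - (i0 + i) - (j0 + j) = k0 + k" using deg by linarith
    ultimately show False using ne by simp
  qed
  then have "U = 0" "V = 0" by (simp_all add: U' V')
  then have "u (Inl t) = 0" if "t \<in> triangle (N - \<delta>)" for t
    using coeff3_lincomb_basis_monom[of "fst t" "snd t" "N - \<delta>" "u \<circ> Inl"] that unfolding U by simp
  moreover have "u (Inr (Inl t)) = 0" if "t \<in> triangle (N - d)" for t
    using coeff3_lincomb_basis_monom[of "fst t" "snd t" "N - d" "u \<circ> Inr \<circ> Inl"] that \<open>V = 0\<close> unfolding V by simp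
  ultimately have "\<forall>t\<in>I. u t = 0" using q0 unfolding I_def by auto
  with u show False by blast
qed

section \<open>Multihomogeneous functions of the points\<close>

definition coord_monom :: "(nat \<times> 3 \<Rightarrow>\<^sub>0 nat) \<Rightarrow> (nat \<Rightarrow> complex ^ 3) \<Rightarrow> complex" where
  "coord_monom \<alpha> p = (\<Prod>v\<in>Poly_Mapping.keys \<alpha>. (p (fst v) $ snd v) ^ Poly_Mapping.lookup \<alpha> v)"

definition coord_degree :: "(nat \<times> 3 \<Rightarrow>\<^sub>0 nat) \<Rightarrow> nat \<Rightarrow> nat" where
  "coord_degree \<alpha> i = (\<Sum>j\<in>UNIV. Poly_Mapping.lookup \<alpha> (i, j))"

text \<open>
  Functions of the points that are given by a multihomogeneous polynomial of multidegree \<open>e\<close>. Working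
  with the functions avoids the convolution product of the polynomials.
\<close>

definition mhfun :: "nat \<Rightarrow> (nat \<Rightarrow> nat) \<Rightarrow> ((nat \<Rightarrow> complex ^ 3) \<Rightarrow> complex) \<Rightarrow> bool" where
  "mhfun n e f \<longleftrightarrow> (\<forall>i>n. e i = 0) \<and>
     (\<exists>G. (\<forall>\<alpha>\<in>Poly_Mapping.keys G. coord_degree \<alpha> = e) \<and> f = eval_coord_poly G)"

lemma eval_coord_poly_extend:
  assumes "finite S" "Poly_Mapping.keys G \<subseteq> S"
  shows "eval_coord_poly G p = (\<Sum>\<alpha>\<in>S. Poly_Mapping.lookup G \<alpha> * coord_monom \<alpha> p)"
  unfolding eval_coord_poly_def coord_monom_def[symmetric]
  using assms by (intro sum.mono_neutral_left) (auto simp: in_keys_iff)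

lemma coord_monom_extend:
  assumes "finite S" "Poly_Mapping.keys \<alpha> \<subseteq> S"
  shows "coord_monom \<alpha> p = (\<Prod>v\<in>S. (p (fst v) $ snd v) ^ Poly_Mapping.lookup \<alpha> v)"
  unfolding coord_monom_def
  using assms by (intro prod.mono_neutral_left) (auto simp: in_keys_iff)

lemma eval_coord_poly_add: "eval_coord_poly (G + H) p = eval_coord_poly G p + eval_coord_poly H p"
proof -
  let ?S = "Poly_Mapping.keys G \<union> Poly_Mapping.keys H"
  have S: "finite ?S" "Poly_Mapping.keys G \<subseteq> ?S" "Poly_Mapping.keys H \<subseteq> ?S" "Poly_Mapping.keys (G + H) \<subseteq> ?S"
    using keys_add[of G H] by auto
  show ?thesis
    unfolding eval_coord_poly_extend[OF S(1,2)] eval_coord_poly_extend[OF S(1,3)] eval_coord_poly_extend[OF S(1,4)]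
    by (simp add: lookup_add algebra_simps sum.distrib)
qed

lemma eval_coord_poly_0: "eval_coord_poly 0 p = 0"
  by (simp add: eval_coord_poly_def)

lemma eval_coord_poly_single: "eval_coord_poly (Poly_Mapping.single \<alpha> c) p = c * coord_monom \<alpha> p"
  using eval_coord_poly_extend[of "{\<alpha>}" "Poly_Mapping.single \<alpha> c" p] by simp

lemma coord_monom_add: "coord_monom (\<alpha> + \<beta>) p = coord_monom \<alpha> p * coord_monom \<beta> p"
proof -
  let ?S = "Poly_Mapping.keys \<alpha> \<union> Poly_Mapping.keys \<beta>"
  have S: "finite ?S" "Poly_Mapping.keys \<alpha> \<subseteq> ?S" "Poly_Mapping.keys \<beta> \<subseteq> ?S" "Poly_Mapping.keys (\<alpha> + \<beta>) \<subseteq> ?S"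
    using keys_add[of \<alpha> \<beta>] by auto
  show ?thesis
    unfolding coord_monom_extend[OF S(1,2)] coord_monom_extend[OF S(1,3)] coord_monom_extend[OF S(1,4)]
    by (simp add: lookup_add power_add prod.distrib)
qed

lemma coord_degree_add: "coord_degree (\<alpha> + \<beta>) = (\<lambda>i. coord_degree \<alpha> i + coord_degree \<beta> i)"
  by (simp add: coord_degree_def fun_eq_iff lookup_add sum.distrib)

lemma mhfunI:
  assumes "finite I" "\<And>t. t \<in> I \<Longrightarrow> coord_degree (\<alpha> t) = e" "\<forall>i>n. e i = 0"
  shows "mhfun n e (\<lambda>p. \<Sum>t\<in>I. c t * coord_monom (\<alpha> t) p)"
proof -
  let ?G = "\<Sum>t\<in>I. Poly_Mapping.single (\<alpha> t) (c t)"
  have "eval_coord_poly ?G p = (\<Sum>t\<in>I. c t * coord_monom (\<alpha> t) p)" for p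
    using assms(1)
    by (induction I rule: finite_induct) (simp_all add: eval_coord_poly_0 eval_coord_poly_add eval_coord_poly_single)
  moreover have "coord_degree \<beta> = e" if "\<beta> \<in> Poly_Mapping.keys ?G" for \<beta>
  proof -
    have "Poly_Mapping.keys ?G \<subseteq> (\<Union>t\<in>I. Poly_Mapping.keys (Poly_Mapping.single (\<alpha> t) (c t)))"
      by (rule keys_sum)
    then obtain t where "t \<in> I" "\<beta> \<in> Poly_Mapping.keys (Poly_Mapping.single (\<alpha> t) (c t))"
      using \<open>\<beta> \<in> Poly_Mapping.keys ?G\<close> by blast
    then show ?thesis using assms(2) by (cases "c t = 0") auto
  qed
  ultimately show ?thesis using assms(3) unfolding mhfun_def by (intro conjI exI[of _ ?G]) auto
qed

lemma mhfunE:
  assumes "mhfun n e f"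
  obtains S c where "finite S" "\<And>\<alpha>. \<alpha> \<in> S \<Longrightarrow> coord_degree \<alpha> = e" "f = (\<lambda>p. \<Sum>\<alpha>\<in>S. c \<alpha> * coord_monom \<alpha> p)" "\<forall>i>n. e i = 0"
proof -
  obtain G where G: "\<forall>\<alpha>\<in>Poly_Mapping.keys G. coord_degree \<alpha> = e" "f = eval_coord_poly G" "\<forall>i>n. e i = 0"
    using assms unfolding mhfun_def by blast
  show ?thesis
    by (rule that[of "Poly_Mapping.keys G" "Poly_Mapping.lookup G"])
       (use G eval_coord_poly_extend[of "Poly_Mapping.keys G" G] in auto)
qed

lemma mhfun_mult:
  assumes "mhfun n e f" "mhfun n e' g"
  shows "mhfun n (\<lambda>i. e i + e' i) (\<lambda>p. f p * g p)"
proof -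
  obtain S c where f: "finite S" "\<And>\<alpha>. \<alpha> \<in> S \<Longrightarrow> coord_degree \<alpha> = e"
    "f = (\<lambda>p. \<Sum>\<alpha>\<in>S. c \<alpha> * coord_monom \<alpha> p)" "\<forall>i>n. e i = 0" using mhfunE[OF assms(1)] by blast
  obtain T d where g: "finite T" "\<And>\<alpha>. \<alpha> \<in> T \<Longrightarrow> coord_degree \<alpha> = e'"
    "g = (\<lambda>p. \<Sum>\<alpha>\<in>T. d \<alpha> * coord_monom \<alpha> p)" "\<forall>i>n. e' i = 0" using mhfunE[OF assms(2)] by blast
  have "mhfun n (\<lambda>i. e i + e' i) (\<lambda>p. \<Sum>t\<in>S \<times> T. c (fst t) * d (snd t) * coord_monom (fst t + snd t) p)"
    using f g by (intro mhfunI) (auto simp: coord_degree_add)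
  also have "(\<lambda>p. \<Sum>t\<in>S \<times> T. c (fst t) * d (snd t) * coord_monom (fst t + snd t) p) = (\<lambda>p. f p * g p)"
    by (simp add: f(3) g(3) sum_product coord_monom_add sum.cartesian_product case_prod_unfold mult_ac)
  finally show ?thesis .
qed

lemma mhfun_add:
  assumes "mhfun n e f" "mhfun n e g"
  shows "mhfun n e (\<lambda>p. f p + g p)"
proof -
  obtain G H where G: "\<forall>\<alpha>\<in>Poly_Mapping.keys G. coord_degree \<alpha> = e" "f = eval_coord_poly G" "\<forall>i>n. e i = 0"
    and H: "\<forall>\<alpha>\<in>Poly_Mapping.keys H. coord_degree \<alpha> = e" "g = eval_coord_poly H"
    using assms unfolding mhfun_def by blast
  have "\<forall>\<alpha>\<in>Poly_Mapping.keys (G + H). coord_degree \<alpha> = e"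
    using G(1) H(1) keys_add[of G H] by blast
  then show ?thesis unfolding mhfun_def using G H
    by (intro conjI exI[of _ "G + H"]) (auto simp: eval_coord_poly_add)
qed

lemma mhfun_zero: "\<forall>i>n. e i = 0 \<Longrightarrow> mhfun n e (\<lambda>_. 0)"
  using mhfunI[of "{}" undefined e n] by simp

lemma mhfun_const: "mhfun n (\<lambda>_. 0) (\<lambda>_. c)"
  using mhfunI[of "{()}" "\<lambda>_. 0" "\<lambda>_. 0" n "\<lambda>_. c"] by (simp add: coord_degree_def[abs_def] coord_monom_def)

lemma mhfun_scale: "mhfun n e f \<Longrightarrow> mhfun n e (\<lambda>p. c * f p)"
  using mhfun_mult[OF mhfun_const[of n c]] by simp

lemma mhfun_diff:
  assumes "mhfun n e f" "mhfun n e g" shows "mhfun n e (\<lambda>p. f p - g p)"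
  using mhfun_add[OF assms(1) mhfun_scale[OF assms(2), of "- 1"]] by simp

lemma mhfun_coord:
  assumes "i \<le> n" shows "mhfun n (\<lambda>k. if k = i then 1 else 0) (\<lambda>p. p i $ j)"
proof -
  let ?\<alpha> = "Poly_Mapping.single (i, j) 1"
  have "coord_degree ?\<alpha> = (\<lambda>k. if k = i then 1 else 0)"
    by (auto simp: coord_degree_def fun_eq_iff lookup_single when_def)
  then show ?thesis
    using mhfunI[of "{()}" "\<lambda>_. ?\<alpha>" "\<lambda>k. if k = i then 1 else 0" n "\<lambda>_. 1"] assms
    by (simp add: coord_monom_def)
qed

lemma mhfun_power: "mhfun n e f \<Longrightarrow> mhfun n (\<lambda>i. k * e i) (\<lambda>p. f p ^ k)"
proof (induction k)
  case 0 then show ?case using mhfun_const[of n 1] by simp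
next
  case (Suc k) then show ?case using mhfun_mult[of n e f "\<lambda>i. k * e i"] by simp
qed

text \<open>
  On the line through two configurations such a function is a polynomial in one variable, so
  nonvanishing at some point means nonvanishing at almost all points of the line.
\<close>

lemma mhfun_poly_line:
  assumes "mhfun n e f"
  shows "\<exists>P. \<forall>t. poly P t = f (\<lambda>i. \<chi> j. (1 - t) * a i $ j + t * b i $ j)"
proof -
  obtain S c where f: "finite S" "f = (\<lambda>p. \<Sum>\<alpha>\<in>S. c \<alpha> * coord_monom \<alpha> p)"
    using mhfunE[OF assms] by metis
  define P where "P = (\<Sum>\<alpha>\<in>S. [:c \<alpha>:] * (\<Prod>v\<in>Poly_Mapping.keys \<alpha>.
      [:a (fst v) $ snd v, b (fst v) $ snd v - a (fst v) $ snd v:] ^ Poly_Mapping.lookup \<alpha> v))"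
  have "poly P t = f (\<lambda>i. \<chi> j. (1 - t) * a i $ j + t * b i $ j)" for t
    unfolding P_def f(2) coord_monom_def by (simp add: poly_sum poly_prod algebra_simps)
  then show ?thesis by blast
qed

lemma mhfun_common_nonzero:
  assumes "mhfun n e f" "mhfun n e' g" "f a \<noteq> 0" "g b \<noteq> 0"
  shows "\<exists>q. f q * g q \<noteq> 0"
proof -
  obtain P where P: "\<And>t. poly P t = f (\<lambda>i. \<chi> j. (1 - t) * a i $ j + t * b i $ j)"
    using mhfun_poly_line[OF assms(1), of a b] by blast
  obtain Q where Q: "\<And>t. poly Q t = g (\<lambda>i. \<chi> j. (1 - t) * a i $ j + t * b i $ j)"
    using mhfun_poly_line[OF assms(2), of a b] by blast
  have "(\<lambda>i. \<chi> j. a i $ j) = a" "(\<lambda>i. \<chi> j. b i $ j) = b" by (auto simp: vec_eq_iff)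
  then have "poly P 0 \<noteq> 0" "poly Q 1 \<noteq> 0" using assms(3,4) by (simp_all add: P Q)
  then have "P * Q \<noteq> 0" by auto
  then obtain t where "poly (P * Q) t \<noteq> 0" using poly_all_0_iff_0 by blast
  then show ?thesis by (auto simp: P Q)
qed

lemma mhfun_prod:
  assumes "finite I" "\<And>t. t \<in> I \<Longrightarrow> \<exists>e q. mhfun n e (f t) \<and> f t q \<noteq> 0"
  shows "\<exists>e q. mhfun n e (\<lambda>p. \<Prod>t\<in>I. f t p) \<and> (\<Prod>t\<in>I. f t q) \<noteq> 0"
  using assms
proof (induction I rule: finite_induct)
  case empty then show ?case using mhfun_const[of n 1] by auto
next
  case (insert t I)
  obtain e q where 1: "mhfun n e (\<lambda>p. \<Prod>t\<in>I. f t p)" "(\<Prod>t\<in>I. f t q) \<noteq> 0" using insert by blast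
  obtain e' q' where 2: "mhfun n e' (f t)" "f t q' \<noteq> 0" using insert.prems by blast
  show ?case
    using mhfun_mult[OF 2(1) 1(1)] mhfun_common_nonzero[OF 2(1) 1(1) 2(2) 1(2)] insert(1,2) by auto
qed

section \<open>Closedness of the existence of curves\<close>

text \<open>
  The condition that a linear system with multihomogeneous coefficients has a nontrivial solution lies
  in a proper closed set if it fails at some \<open>q\<close>. In place of maximal minors, eliminate one unknown:
  with a pivot \<open>a r l\<close> that does not vanish at \<open>q\<close>, the rows \<open>a r l * a s k - a s l * a r k\<close> are again
  multihomogeneous, and wherever the pivot is nonzero the smaller system has a nontrivial solution iff the given one has.
\<close>

lemma elimination:
  fixes a :: "'r \<Rightarrow> 'k \<Rightarrow> (nat \<Rightarrow> complex ^ 3) \<Rightarrow> complex"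
  assumes "finite K" "\<And>r k. r \<in> R \<Longrightarrow> k \<in> K \<Longrightarrow> mhfun n (e r) (a r k)"
    "\<And>u. \<forall>r\<in>R. (\<Sum>k\<in>K. a r k q * u k) = 0 \<Longrightarrow> \<forall>k\<in>K. u k = 0"
  shows "\<exists>G e'. mhfun n e' G \<and> G q \<noteq> 0 \<and>
    (\<forall>p u. (\<forall>r\<in>R. (\<Sum>k\<in>K. a r k p * u k) = 0) \<longrightarrow> (\<exists>k\<in>K. u k \<noteq> 0) \<longrightarrow> G p = 0)"
  using assms
proof (induction K arbitrary: a e rule: finite_induct)
  case empty then show ?case using mhfun_const[of n 1] by (intro exI[of _ "\<lambda>_. 1"] exI[of _ "\<lambda>_. 0"]) auto
next
  case (insert l K)
  have "\<exists>r\<in>R. a r l q \<noteq> 0"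
  proof (rule ccontr)
    assume "\<not> ?thesis"
    then have "\<forall>r\<in>R. (\<Sum>k\<in>insert l K. a r k q * (if k = l then 1 else 0)) = 0"
      using insert(1,2) by (auto intro!: sum.neutral)
    then show False using insert.prems(2)[of "\<lambda>k. if k = l then 1 else 0"] by auto
  qed
  then obtain r where r: "r \<in> R" "a r l q \<noteq> 0" by blast
  define b where "b s k p = a r l p * a s k p - a s l p * a r k p" for s k p
  have red: "(\<Sum>k\<in>K. b s k p * u k) = a r l p * (\<Sum>k\<in>insert l K. a s k p * u k) - a s l p * (\<Sum>k\<in>insert l K. a r k p * u k)" for s p u
    using insert(1,2) by (simp add: b_def sum_distrib_left sum_subtractf algebra_simps)
  have b: "mhfun n (\<lambda>i. e r i + e s i) (b s k)" if "s \<in> R" "k \<in> K" for s k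
  proof -
    have "mhfun n (\<lambda>i. e r i + e s i) (\<lambda>p. a r l p * a s k p)"
      using that r insert.prems(1) by (intro mhfun_mult) auto
    moreover have "mhfun n (\<lambda>i. e s i + e r i) (\<lambda>p. a s l p * a r k p)"
      using that r insert.prems(1) by (intro mhfun_mult) auto
    ultimately show ?thesis unfolding b_def by (intro mhfun_diff) (simp_all add: add.commute)
  qed
  have "\<forall>k\<in>K. u k = 0" if u: "\<forall>s\<in>R. (\<Sum>k\<in>K. b s k q * u k) = 0" for u
  proof -
    define v where "v = u(l := - (\<Sum>k\<in>K. a r k q * u k) / a r l q)"
    have v: "(\<Sum>k\<in>K. a s k q * v k) = (\<Sum>k\<in>K. a s k q * u k)" for s
      using insert(2) by (intro sum.cong) (auto simp: v_def)
    have vr: "(\<Sum>k\<in>insert l K. a r k q * v k) = 0"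
      using insert(1,2) r by (simp add: v) (simp add: v_def)
    have bv: "(\<Sum>k\<in>K. b s k q * v k) = (\<Sum>k\<in>K. b s k q * u k)" for s
      using insert(2) by (intro sum.cong) (auto simp: v_def)
    have "\<forall>s\<in>R. (\<Sum>k\<in>insert l K. a s k q * v k) = 0"
    proof
      fix s assume "s \<in> R"
      with u bv[of s] have "(\<Sum>k\<in>K. b s k q * v k) = 0" by simp
      then show "(\<Sum>k\<in>insert l K. a s k q * v k) = 0" using red[of s q v] r(2) vr by simp
    qed
    then have "\<forall>k\<in>insert l K. v k = 0" by (rule insert.prems(2))
    then show ?thesis using insert(2) by (auto simp: v_def split: if_splits)
  qed
  from insert.IH[of "\<lambda>s i. e r i + e s i" b, OF b this] obtain G e' where G: "mhfun n e' G" "G q \<noteq> 0"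
    "\<And>p u. \<forall>s\<in>R. (\<Sum>k\<in>K. b s k p * u k) = 0 \<Longrightarrow> \<exists>k\<in>K. u k \<noteq> 0 \<Longrightarrow> G p = 0" by blast
  have "a r l p * G p = 0" if u: "\<forall>s\<in>R. (\<Sum>k\<in>insert l K. a s k p * u k) = 0" and nz: "\<exists>k\<in>insert l K. u k \<noteq> 0" for p u
  proof (cases "a r l p = 0")
    case False
    have "\<exists>k\<in>K. u k \<noteq> 0"
    proof (rule ccontr)
      assume *: "\<not> ?thesis"
      then have "(\<Sum>k\<in>insert l K. a r k p * u k) = a r l p * u l" using insert(1,2) by simp
      with u r False have "u l = 0" by auto
      with * nz show False by auto
    qed
    moreover have "\<forall>s\<in>R. (\<Sum>k\<in>K. b s k p * u k) = 0" using u r by (auto simp: red)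
    ultimately show ?thesis using G(3) by simp
  qed simp
  moreover have "mhfun n (\<lambda>i. e r i + e' i) (\<lambda>p. a r l p * G p)"
    using insert.prems(1)[OF r(1)] G(1) by (intro mhfun_mult) auto
  ultimately show ?case using r(2) G(2)
    by (intro exI[of _ "\<lambda>p. a r l p * G p"] exI[of _ "\<lambda>i. e r i + e' i"]) auto
qed

text \<open>
  The linear system of degree \<open>D\<close> and multiplicities \<open>m\<close> at \<open>p\<close> is not empty.
\<close>

definition has_section :: "nat \<Rightarrow> (nat \<Rightarrow> complex ^ 3) \<Rightarrow> nat \<Rightarrow> (nat \<Rightarrow> nat) \<Rightarrow> bool" where
  "has_section n p D m \<longleftrightarrow> (\<exists>F. F \<noteq> 0 \<and> form D F \<and> (\<forall>i\<le>n. mult_ge F (p i) (m i)))"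

lemma deriv3_monom3: "deriv3 a b c (monom3 i j k r) =
  (if a \<le> i \<and> b \<le> j \<and> c \<le> k then monom3 (i - a) (j - b) (k - c)
     (pochhammer (of_nat (Suc (i - a))) a * pochhammer (of_nat (Suc (j - b))) b * pochhammer (of_nat (Suc (k - c))) c * r) else 0)"
  by (rule poly3_eqI) (auto simp: coeff3_deriv3 coeff3_monom3 simp del: of_nat_Suc)

lemma mhfun_monom_conditions:
  assumes "t \<le> n" "i + j + k = D"
  shows "mhfun n (\<lambda>s. if s = t then D - (a + b + c) else 0) (\<lambda>p. eval3 (deriv3 a b c (monom3 i j k 1)) (p t))"
proof (cases "a \<le> i \<and> b \<le> j \<and> c \<le> k")
  case True
  let ?c = "\<lambda>s. if s = t then 1 else 0 :: nat"
  have "mhfun n (\<lambda>s. (i - a) * ?c s + ((j - b) * ?c s + (k - c) * ?c s)) (\<lambda>p. (p t $ 1) ^ (i - a) * ((p t $ 2) ^ (j - b) * (p t $ 3) ^ (k - c)))"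
    by (intro mhfun_mult mhfun_power mhfun_coord assms(1))
  moreover have "(\<lambda>s. (i - a) * ?c s + ((j - b) * ?c s + (k - c) * ?c s)) = (\<lambda>s. if s = t then D - (a + b + c) else 0)"
    using True assms(2) by (auto simp: fun_eq_iff)
  ultimately show ?thesis
    using mhfun_scale[of n "\<lambda>s. if s = t then D - (a + b + c) else 0"] True
    by (simp add: deriv3_monom3 eval3_monom3 mult.assoc)
next
  case False
  have "(\<lambda>p :: nat \<Rightarrow> complex ^ 3. eval3 (deriv3 a b c (monom3 i j k 1)) (p t)) = (\<lambda>_. 0)"
    unfolding deriv3_monom3 if_not_P[OF False] by simp
  then show ?thesis using assms by (simp add: mhfun_zero)
qed

lemma no_section_open:
  fixes q :: "nat \<Rightarrow> complex ^ 3"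
  assumes q: "\<not> has_section n q D m"
  shows "\<exists>G e. mhfun n e G \<and> G q \<noteq> 0 \<and> (\<forall>p. has_section n p D m \<longrightarrow> G p = 0)"
proof -
  define R where "R = {(t, a, b, c). t \<le> n \<and> a + b + c < m t}"
  define A :: "nat \<times> nat \<times> nat \<times> nat \<Rightarrow> nat \<times> nat \<Rightarrow> (nat \<Rightarrow> complex ^ 3) \<Rightarrow> complex"
    where "A = (\<lambda>(t, a, b, c) k p. eval3 (deriv3 a b c (basis_monom D k)) (p t))"
  define e :: "nat \<times> nat \<times> nat \<times> nat \<Rightarrow> nat \<Rightarrow> nat"
    where "e = (\<lambda>(t, a, b, c) s. if s = t then D - (a + b + c) else 0)"
  have A: "mhfun n (e r) (A r k)" if "r \<in> R" "k \<in> triangle D" for r k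
  proof -
    obtain t a b c where r: "r = (t, a, b, c)" by (cases r) auto
    obtain i j where k: "k = (i, j)" by force
    show ?thesis
      using that mhfun_monom_conditions[of t n i j "D - i - j" D a b c]
      by (simp add: r k R_def A_def e_def basis_monom_def triangle_def)
  qed
  have sec: "has_section n p D m \<longleftrightarrow> (\<exists>u. (\<forall>r\<in>R. (\<Sum>k\<in>triangle D. A r k p * u k) = 0) \<and> (\<exists>k\<in>triangle D. u k \<noteq> 0))" for p
  proof
    assume "has_section n p D m"
    then obtain F where F: "F \<noteq> 0" "form D F" "\<And>i. i \<le> n \<Longrightarrow> mult_ge F (p i) (m i)"
      unfolding has_section_def by blast
    define u where "u = (\<lambda>(i, j). coeff3 F i j (D - i - j))"
    have Fu: "F = lincomb (triangle D) u (basis_monom D)"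
    proof (rule trans[OF form_sum_monom3[OF F(2)]])
      show "(\<Sum>(i, j)\<in>triangle D. monom3 i j (D - i - j) (coeff3 F i j (D - i - j))) = lincomb (triangle D) u (basis_monom D)"
        unfolding lincomb_def
        by (rule sum.cong) (auto simp: u_def basis_monom_def scale3_const3 const3_monom3 monom3_mult)
    qed
    have "\<exists>k\<in>triangle D. u k \<noteq> 0"
    proof (rule ccontr)
      assume "\<not> ?thesis"
      then have "lincomb (triangle D) u (basis_monom D) = 0" unfolding lincomb_def by (simp add: scale3_def)
      with F(1) Fu show False by simp
    qed
    moreover have "(\<Sum>k\<in>triangle D. A r k p * u k) = 0" if "r \<in> R" for r
    proof -
      obtain t a b c where r: "r = (t, a, b, c)" by (cases r) auto
      have "eval3 (deriv3 a b c F) (p t) = 0" using F(3)[of t] that by (auto simp: r R_def mult_ge_def)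
      then show ?thesis unfolding Fu eval3_deriv3_lincomb by (simp add: r A_def)
    qed
    ultimately show "\<exists>u. (\<forall>r\<in>R. (\<Sum>k\<in>triangle D. A r k p * u k) = 0) \<and> (\<exists>k\<in>triangle D. u k \<noteq> 0)" by blast
  next
    assume "\<exists>u. (\<forall>r\<in>R. (\<Sum>k\<in>triangle D. A r k p * u k) = 0) \<and> (\<exists>k\<in>triangle D. u k \<noteq> 0)"
    then obtain u where u: "\<And>r. r \<in> R \<Longrightarrow> (\<Sum>k\<in>triangle D. A r k p * u k) = 0" "\<exists>k\<in>triangle D. u k \<noteq> 0" by blast
    let ?F = "lincomb (triangle D) u (basis_monom D)"
    have "?F \<noteq> 0" using u(2) coeff3_lincomb_basis_monom[of _ _ D u] by auto
    moreover have "form D ?F" by (intro form_lincomb form_basis_monom)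
    moreover have "mult_ge ?F (p i) (m i)" if "i \<le> n" for i
      unfolding mult_ge_def
    proof (intro allI impI)
      fix a b c assume "a + b + c < m i"
      then have "(i, a, b, c) \<in> R" using that by (simp add: R_def)
      from u(1)[OF this] show "eval3 (deriv3 a b c ?F) (p i) = 0"
        by (simp add: A_def eval3_deriv3_lincomb)
    qed
    ultimately show "has_section n p D m" unfolding has_section_def by blast
  qed
  have ker: "\<forall>k\<in>triangle D. u k = 0" if "\<forall>r\<in>R. (\<Sum>k\<in>triangle D. A r k q * u k) = 0" for u
  proof (rule ccontr)
    assume "\<not> ?thesis"
    then have "\<exists>u. (\<forall>r\<in>R. (\<Sum>k\<in>triangle D. A r k q * u k) = 0) \<and> (\<exists>k\<in>triangle D. u k \<noteq> 0)"
      using that by (intro exI[of _ u] conjI) simp_all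
    then show False using q unfolding sec by (rule notE[rotated])
  qed
  have "\<exists>G e'. mhfun n e' G \<and> G q \<noteq> 0 \<and> (\<forall>p u. (\<forall>r\<in>R. (\<Sum>k\<in>triangle D. A r k p * u k) = 0)
      \<longrightarrow> (\<exists>k\<in>triangle D. u k \<noteq> 0) \<longrightarrow> G p = 0)"
    by (rule elimination[of "triangle D" R n e A q], rule finite_triangle, erule (1) A, erule ker)
  then obtain G e' where G: "mhfun n e' G \<and> G q \<noteq> 0 \<and> (\<forall>p u. (\<forall>r\<in>R. (\<Sum>k\<in>triangle D. A r k p * u k) = 0)
      \<longrightarrow> (\<exists>k\<in>triangle D. u k \<noteq> 0) \<longrightarrow> G p = 0)" by (elim exE)
  have "G p = 0" if s: "has_section n p D m" for p
  proof -
    obtain u where "\<forall>r\<in>R. (\<Sum>k\<in>triangle D. A r k p * u k) = 0" "\<exists>k\<in>triangle D. u k \<noteq> 0"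
      using s[unfolded sec] by (elim exE conjE)
    with G show ?thesis by simp
  qed
  with G show ?thesis by (intro exI[of _ G] exI[of _ e'] conjI allI impI) simp_all
qed

text \<open>
  The bound \<open>B\<close> on the degree leaves finitely many classes, as a multiplicity cannot exceed the degree.
\<close>

definition good :: "nat \<Rightarrow> nat \<Rightarrow> (nat \<Rightarrow> complex ^ 3) \<Rightarrow> bool" where
  "good n B p \<longleftrightarrow> (\<forall>i\<le>n. p i $ 3 \<noteq> 0) \<and>
     (\<forall>i\<le>n. \<forall>j\<le>n. i \<noteq> j \<longrightarrow> p i $ 1 / p i $ 3 \<noteq> p j $ 1 / p j $ 3) \<and>
     (\<forall>D m. D \<le> B \<longrightarrow> has_section n p D m \<longrightarrow> (\<forall>q\<in>point_tuples n. has_section n q D m))"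

lemma has_section_cong: "(\<And>i. i \<le> n \<Longrightarrow> m i = m' i) \<Longrightarrow> has_section n p D m = has_section n p D m'"
  unfolding has_section_def by (metis (no_types, lifting))

lemma has_section_mult_le:
  assumes "has_section n p D m" "i \<le> n" shows "m i \<le> D"
proof -
  obtain F where "F \<noteq> 0" "form D F" "mult_ge F (p i) (m i)" using assms by (auto simp: has_section_def)
  then show ?thesis using mult_ge_iff multiplicity_le_degree le_trans by blast
qed

text \<open>
  The exceptional set is the zero set of one product: of the functions of \<open>no_section_open\<close> for the finitely many
  classes that are empty somewhere, of the third coordinates, and of the differences of the affine first coordinates. That
  product is not identically zero, since none of its factors is.
\<close>

theorem good_general: "for_general_points n (good n B)"
proof -
  define C where "C = {c \<in> {..B} \<times> ({..n} \<rightarrow>\<^sub>E {..B}). \<exists>q\<in>point_tuples n. \<not> has_section n q (fst c) (snd c)}"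
  have finC: "finite C" unfolding C_def
    by (rule finite_subset[of _ "{..B} \<times> ({..n} \<rightarrow>\<^sub>E {..B})"]) (auto intro!: finite_PiE)
  have "\<forall>c\<in>C. \<exists>G. (\<exists>e q. mhfun n e G \<and> G q \<noteq> 0) \<and> (\<forall>p. has_section n p (fst c) (snd c) \<longrightarrow> G p = 0)"
  proof
    fix c assume "c \<in> C"
    then obtain q where "\<not> has_section n q (fst c) (snd c)" by (auto simp: C_def)
    then obtain G e where "mhfun n e G" "G q \<noteq> 0" "\<forall>p. has_section n p (fst c) (snd c) \<longrightarrow> G p = 0"
      by (elim no_section_open[THEN exE] exE conjE)
    then show "\<exists>G. (\<exists>e q. mhfun n e G \<and> G q \<noteq> 0) \<and> (\<forall>p. has_section n p (fst c) (snd c) \<longrightarrow> G p = 0)"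
      by (intro exI[of _ G] conjI exI[of _ e] exI[of _ q])
  qed
  from bchoice[OF this] obtain G where
    "\<forall>c\<in>C. (\<exists>e q. mhfun n e (G c) \<and> G c q \<noteq> 0) \<and> (\<forall>p. has_section n p (fst c) (snd c) \<longrightarrow> G c p = 0)" ..
  then have G: "\<And>c. c \<in> C \<Longrightarrow> \<exists>e q. mhfun n e (G c) \<and> G c q \<noteq> 0"
    "\<And>c p. c \<in> C \<Longrightarrow> has_section n p (fst c) (snd c) \<Longrightarrow> G c p = 0" by simp_all
  define H3 where "H3 = (\<lambda>i (p :: nat \<Rightarrow> complex ^ 3). p i $ 3)"
  define HX where "HX = (\<lambda>(i, j) (p :: nat \<Rightarrow> complex ^ 3). p i $ 1 * p j $ 3 - p j $ 1 * p i $ 3)"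
  define I where "I = {(i, j). i \<le> n \<and> j \<le> n \<and> i \<noteq> j}"
  have finI: "finite I" by (rule finite_subset[of _ "{..n} \<times> {..n}"]) (auto simp: I_def)
  define P1 where "P1 = (\<lambda>p. \<Prod>c\<in>C. G c p)"
  define P2 where "P2 = (\<lambda>p. \<Prod>i\<in>{..n}. H3 i p)"
  define P3 where "P3 = (\<lambda>p. \<Prod>t\<in>I. HX t p)"
  obtain e1 q1 where 1: "mhfun n e1 P1" "P1 q1 \<noteq> 0"
    using mhfun_prod[of C n G, OF finC G(1)] unfolding P1_def by blast
  have "\<exists>e q. mhfun n e (H3 i) \<and> H3 i q \<noteq> 0" if "i \<in> {..n}" for i
    using mhfun_coord[of i n 3] that unfolding H3_def
    by (intro exI[of _ "\<lambda>k. if k = i then 1 else 0"] exI[of _ "\<lambda>_. \<chi> _. 1"]) auto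
  then obtain e2 q2 where 2: "mhfun n e2 P2" "P2 q2 \<noteq> 0"
    using mhfun_prod[of "{..n}" n H3] unfolding P2_def by blast
  have "\<exists>e q. mhfun n e (HX t) \<and> HX t q \<noteq> 0" if tI: "t \<in> I" for t
  proof -
    obtain i j where t: "t = (i, j)" "i \<le> n" "j \<le> n" "i \<noteq> j" using tI unfolding I_def by blast
    let ?e = "\<lambda>k. (if k = i then 1 else 0) + (if k = j then 1 else 0) :: nat"
    have "mhfun n ?e (\<lambda>p. p i $ 1 * p j $ 3)" using t by (intro mhfun_mult mhfun_coord)
    moreover have "mhfun n (\<lambda>k. (if k = j then 1 else 0) + (if k = i then 1 else 0)) (\<lambda>p. p j $ 1 * p i $ 3)"
      using t by (intro mhfun_mult mhfun_coord)
    ultimately have "mhfun n ?e (HX t)" unfolding HX_def t(1) prod.case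
      by (intro mhfun_diff) (simp_all add: add.commute)
    moreover have "HX t (\<lambda>k. \<chi> l. if l = 1 then of_nat k else 1) \<noteq> 0"
      using t by (simp add: HX_def)
    ultimately show ?thesis by blast
  qed
  then obtain e3 q3 where 3: "mhfun n e3 P3" "P3 q3 \<noteq> 0"
    using mhfun_prod[of I n HX] finI unfolding P3_def by blast
  have "\<exists>e q. mhfun n e (\<lambda>p. P2 p * P3 p) \<and> P2 q * P3 q \<noteq> 0"
    using mhfun_mult[OF 2(1) 3(1)] mhfun_common_nonzero[OF 2(1) 3(1) 2(2) 3(2)] by blast
  then obtain e4 q4 where 4: "mhfun n e4 (\<lambda>p. P2 p * P3 p)" "P2 q4 * P3 q4 \<noteq> 0" by blast
  have "\<exists>e q. mhfun n e (\<lambda>p. P1 p * (P2 p * P3 p)) \<and> P1 q * (P2 q * P3 q) \<noteq> 0"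
    using mhfun_mult[OF 1(1) 4(1)] mhfun_common_nonzero[OF 1(1) 4(1) 1(2) 4(2)] by blast
  then obtain e q where f: "mhfun n e (\<lambda>p. P1 p * (P2 p * P3 p))" "P1 q * (P2 q * P3 q) \<noteq> 0" by blast
  then obtain K where K: "\<forall>i>n. e i = 0" "\<forall>\<alpha>\<in>Poly_Mapping.keys K. coord_degree \<alpha> = e"
    "(\<lambda>p. P1 p * (P2 p * P3 p)) = eval_coord_poly K" unfolding mhfun_def by blast
  define Z where "Z = {p \<in> point_tuples n. eval_coord_poly K p = 0}"
  have "multihomogeneous n K"
    using K(1,2) unfolding multihomogeneous_def coord_degree_def by (intro exI[of _ e]) auto
  then have "zariski_closed n Z" unfolding zariski_closed_def Z_def by (intro exI[of _ "{K}"]) auto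
  moreover have P2: "p i $ 3 \<noteq> 0" if "P2 p \<noteq> 0" "i \<le> n" for p i
    using that by (simp add: P2_def H3_def)
  have "q \<in> point_tuples n"
    unfolding point_tuples_def
  proof (intro CollectI allI impI notI)
    fix i assume "i \<le> n" "q i = 0"
    then show False using P2[of q i] f(2) by simp
  qed
  then have "Z \<noteq> point_tuples n" using f(2) K(3)[THEN fun_cong, of q] by (auto simp: Z_def)
  moreover have "good n B p" if "p \<in> point_tuples n - Z" for p
  proof -
    have nz: "P1 p \<noteq> 0" "P2 p \<noteq> 0" "P3 p \<noteq> 0"
      using that K(3)[THEN fun_cong, of p] by (auto simp: Z_def)
    have d: "p i $ 1 / p i $ 3 \<noteq> p j $ 1 / p j $ 3" if "i \<le> n" "j \<le> n" "i \<noteq> j" for i j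
    proof -
      have "(i, j) \<in> I" using that by (simp add: I_def)
      then have "HX (i, j) p \<noteq> 0" using nz(3) finI by (simp add: P3_def)
      then show ?thesis using P2[OF nz(2)] that by (simp add: HX_def frac_eq_eq)
    qed
    have s: "has_section n q D m" if D: "D \<le> B" and s: "has_section n p D m" and q: "q \<in> point_tuples n" for D m q
    proof (rule ccontr)
      assume no: "\<not> has_section n q D m"
      let ?m = "restrict m {..n}"
      have m: "has_section n r D ?m = has_section n r D m" for r by (rule has_section_cong) simp
      have "?m \<in> {..n} \<rightarrow>\<^sub>E {..B}" 
        using has_section_mult_le[OF s] D by (intro PiE_I) (auto intro: le_trans)
      then have "(D, ?m) \<in> C" using no q D by (auto simp: C_def m)
      then have "G (D, ?m) p = 0" using G(2) s m by simp
      with \<open>(D, ?m) \<in> C\<close> nz(1) finC show False by (auto simp: P1_def)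
    qed
    show ?thesis unfolding good_def
      by (intro conjI allI impI ballI) (erule P2[OF nz(2)], erule (2) d, erule (2) s)
  qed
  ultimately show ?thesis unfolding for_general_points_def by blast
qed

section \<open>Classes of curves and their intersection numbers\<close>

text \<open>
  With negative \<open>k\<close> this adds curves to a class.
\<close>

definition minus_mult :: "system \<Rightarrow> int \<Rightarrow> system \<Rightarrow> system" where
  "minus_mult E k c = (fst E - k * fst c, \<lambda>i. snd E i - k * snd c i)"

definition permute :: "(nat \<Rightarrow> nat) \<Rightarrow> system \<Rightarrow> system" where
  "permute \<sigma> c = (fst c, snd c \<circ> \<sigma>)"

text \<open>
  A negative multiplicity imposes no condition, so subtracting curves never leaves this notion.
\<close>

definition effective :: "nat \<Rightarrow> (nat \<Rightarrow> complex ^ 3) \<Rightarrow> system \<Rightarrow> bool" where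
  "effective n p c \<longleftrightarrow> 0 \<le> fst c \<and> has_section n p (nat (fst c)) (\<lambda>i. nat (snd c i))"

lemma intersection_number_alt:
  "intersection_number n E c = fst E * fst c - (\<Sum>i\<le>n. snd E i * snd c i)"
  by (simp add: intersection_number_def case_prod_unfold)

lemma intersection_commute: "intersection_number n E c = intersection_number n c E"
  by (simp add: intersection_number_alt mult.commute)

lemma fst_minus_mult [simp]: "fst (minus_mult E k c) = fst E - k * fst c"
  and snd_minus_mult [simp]: "snd (minus_mult E k c) i = snd E i - k * snd c i"
  by (simp_all add: minus_mult_def)

lemma intersection_minus_mult:
  "intersection_number n (minus_mult E k c) c' = intersection_number n E c' - k * intersection_number n c c'"
  by (simp add: intersection_number_alt sum_subtractf sum_distrib_left algebra_simps)

lemma intersection_permute: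
  assumes "\<sigma> permutes {..n}"
  shows "intersection_number n (permute \<sigma> E) (permute \<sigma> c) = intersection_number n E c"
  using sum.permute[OF assms, of "\<lambda>i. snd E i * snd c i"]
  by (simp add: intersection_number_alt permute_def o_def)

lemma permute_minus_mult: "permute \<sigma> (minus_mult E k c) = minus_mult (permute \<sigma> E) k (permute \<sigma> c)"
  by (simp add: permute_def minus_mult_def fun_eq_iff)

lemma twice_half: "2 * (x * (x + 1) div 2) = x * (x + 1)" "2 * (x * (x + 3) div 2) = x * (x + 3)"
  "2 * (x * (x - 1) div 2) = x * (x - 1)" "2 * ((x - 1) * (x - 2) div 2) = (x - 1) * (x - 2)" for x :: int
  by (rule dvd_mult_div_cancel; simp)+

lemma virtual_dim_twice: "2 * virtual_dim n c = fst c * (fst c + 3) - (\<Sum>i\<le>n. snd c i * (snd c i + 1))"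
  by (simp add: virtual_dim_def case_prod_unfold right_diff_distrib sum_distrib_left twice_half del: distrib_left_numeral)

lemma genus_twice: "2 * genus n c = (fst c - 1) * (fst c - 2) - (\<Sum>i\<le>n. snd c i * (snd c i - 1))"
  by (simp add: genus_def case_prod_unfold right_diff_distrib sum_distrib_left twice_half del: right_diff_distrib_numeral)

lemma intersection_cong:
  "fst c = fst c' \<Longrightarrow> (\<And>i. i \<le> n \<Longrightarrow> snd c i = snd c' i) \<Longrightarrow> intersection_number n E c = intersection_number n E c'"
  by (simp add: intersection_number_alt)

section \<open>Effective classes at good configurations\<close>

lemma goodD:
  assumes "good n B p"
  shows "i \<le> n \<Longrightarrow> p i $ 3 \<noteq> 0"
    "i \<le> n \<Longrightarrow> j \<le> n \<Longrightarrow> i \<noteq> j \<Longrightarrow> p i $ 1 / p i $ 3 \<noteq> p j $ 1 / p j $ 3"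
    "D \<le> B \<Longrightarrow> has_section n p D m \<Longrightarrow> q \<in> point_tuples n \<Longrightarrow> has_section n q D m"
  using assms unfolding good_def by blast+

lemma effective_degree: "effective n p c \<Longrightarrow> 0 \<le> fst c"
  by (simp add: effective_def)

lemma effective_mult_le: "effective n p c \<Longrightarrow> i \<le> n \<Longrightarrow> snd c i \<le> fst c"
  unfolding effective_def using has_section_mult_le[of n p "nat (fst c)" "\<lambda>i. nat (snd c i)" i]
  by (simp add: nat_le_iff)

text \<open>
  A curve of the class at \<open>p\<close> yields one at the reordered configuration \<open>p \<circ> inv \<sigma>\<close>, because \<open>p\<close> is good;
  read at \<open>p\<close>, that curve has the permuted multiplicities.
\<close>

lemma effective_permute:
  assumes g: "good n B p" and \<sigma>: "\<sigma> permutes {..n}" and E: "effective n p c" "fst c \<le> int B"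
  shows "effective n p (permute \<sigma> c)"
proof -
  let ?q = "p \<circ> inv \<sigma>"
  have inv: "inv \<sigma> i \<le> n \<longleftrightarrow> i \<le> n" for i
    using permutes_in_image[OF permutes_inv[OF \<sigma>], of i] by simp
  have "?q \<in> point_tuples n" unfolding point_tuples_def
  proof (intro CollectI allI impI notI)
    fix i assume "i \<le> n" "?q i = 0"
    then show False using goodD(1)[OF g, of "inv \<sigma> i"] inv by simp
  qed
  then have "has_section n ?q (nat (fst c)) (\<lambda>i. nat (snd c i))"
    using goodD(3)[OF g, of "nat (fst c)"] E by (simp add: effective_def)
  then obtain F where F: "F \<noteq> 0" "form (nat (fst c)) F" "\<forall>i\<le>n. mult_ge F (?q i) (nat (snd c i))"
    unfolding has_section_def by blast
  have "mult_ge F (p i) (nat (snd c (\<sigma> i)))" if "i \<le> n" for i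
  proof -
    have "\<sigma> i \<le> n" using permutes_in_image[OF \<sigma>, of i] that by simp
    then show ?thesis using F(3)[rule_format, of "\<sigma> i"] permutes_inverses(2)[OF \<sigma>] by simp
  qed
  then show ?thesis using F E unfolding effective_def has_section_def permute_def by auto
qed

lemma exists_section:
  assumes g: "good n B p" and c: "0 \<le> fst c" "\<And>i. i \<le> n \<Longrightarrow> 0 \<le> snd c i" "0 \<le> virtual_dim n c"
  shows "effective n p c"
proof -
  have "int (\<Sum>i\<le>n. nat (snd c i) * (nat (snd c i) + 1)) = (\<Sum>i\<le>n. snd c i * (snd c i + 1))"
    unfolding int_sum by (rule sum.cong) (use c(2) in \<open>simp_all add: algebra_simps\<close>)
  also have "\<dots> \<le> fst c * (fst c + 3)" using c(3) virtual_dim_twice[of n c] by linarith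
  also have "\<dots> < int ((nat (fst c) + 1) * (nat (fst c) + 2))" using c(1) by (simp add: algebra_simps)
  finally have "(\<Sum>i\<le>n. nat (snd c i) * (nat (snd c i) + 1)) < (nat (fst c) + 1) * (nat (fst c) + 2)"
    by (simp only: of_nat_less_iff)
  then show ?thesis
    using exists_form[of n p "\<lambda>i. nat (snd c i)" "nat (fst c)"] goodD(1)[OF g] c(1)
    unfolding effective_def has_section_def by blast
qed

definition curve :: "poly3 \<Rightarrow> bool" where
  "curve A \<longleftrightarrow> irreducible A \<and> homogeneous A"

lemma curveD:
  assumes "curve A"
  shows "irreducible A" "A \<noteq> 0" "form (total_degree A) A" "mult_ge A x m \<longleftrightarrow> m \<le> multiplicity_at A x"
proof -
  show "irreducible A" "A \<noteq> 0" using assms by (auto simp: curve_def)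
  show "form (total_degree A) A" using assms by (auto simp: curve_def homogeneous_form)
  then show "mult_ge A x m \<longleftrightarrow> m \<le> multiplicity_at A x" using mult_ge_iff \<open>A \<noteq> 0\<close> by blast
qed

lemma fst_curve_data [simp]: "fst (curve_data p A) = int (total_degree A)"
  and snd_curve_data [simp]: "snd (curve_data p A) i = int (multiplicity_at A (p i))"
  by (simp_all add: curve_data_def)

lemma form0_unit:
  assumes "form 0 F" "F \<noteq> 0" shows "F dvd 1"
proof -
  have "F = const3 (coeff3 F 0 0 0)"
  proof (rule poly3_eqI)
    fix i j k show "coeff3 F i j k = coeff3 (const3 (coeff3 F 0 0 0)) i j k"
      using assms(1) by (cases "i = 0 \<and> j = 0 \<and> k = 0") (auto simp: const3_monom3 coeff3_monom3 form_def)
  qed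
  moreover from this have "coeff3 F 0 0 0 \<noteq> 0" using assms(2) by (auto simp: const3_def)
  ultimately have "const3 (1 / coeff3 F 0 0 0) * F = 1"
    by (metis const3_monom3 monom3_mult add_0 monom3_0001 nonzero_eq_divide_eq)
  then show ?thesis by (metis dvd_triv_right)
qed

lemma curve_degree_pos: assumes "curve A" shows "0 < total_degree A"
proof (rule ccontr)
  assume "\<not> ?thesis"
  then have "A dvd 1" using curveD[OF assms] form0_unit[of A] by simp
  then show False using curveD(1)[OF assms] by (simp add: irreducible_def)
qed

lemma curve_mult_le_degree: "curve A \<Longrightarrow> multiplicity_at A x \<le> total_degree A"
  using curveD[of A] multiplicity_le_degree by blast

lemma negative_intersection_divides:
  assumes g: "good n B p" and A: "curve A" and F: "form D F" "\<And>i. i \<le> n \<Longrightarrow> mult_ge F (p i) (m i)"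
    and neg: "int D * int (total_degree A) < (\<Sum>i\<le>n. int (m i) * int (multiplicity_at A (p i)))"
  shows "A dvd F"
proof (rule ccontr)
  assume "\<not> ?thesis"
  then have "(\<Sum>i\<le>n. multiplicity_at A (p i) * m i) \<le> total_degree A * D"
    using bezout[of "total_degree A" A D F n p "\<lambda>i. multiplicity_at A (p i)" m] curveD[OF A] goodD(1,2)[OF g] F
    by blast
  then have "int (\<Sum>i\<le>n. multiplicity_at A (p i) * m i) \<le> int (total_degree A * D)" by (simp only: of_nat_le_iff)
  with neg show False by (simp add: mult.commute)
qed

lemma quotient_section:
  assumes g: "good n B p" and A: "curve A" and F: "F \<noteq> 0" "form D F" "F = A * H"
  shows "H \<noteq> 0" "total_degree A \<le> D" "form (D - total_degree A) H"
    "\<And>i. i \<le> n \<Longrightarrow> multiplicity_at F (p i) = multiplicity_at A (p i) + multiplicity_at H (p i)"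
proof -
  show H: "H \<noteq> 0" using F by auto
  obtain e where e: "form e H"
    using form_factor[of D H A] F by (auto simp: mult.commute)
  then have "form (total_degree A + e) F" using form_mult[OF curveD(3)[OF A] e] F(3) by simp
  then have D: "D = total_degree A + e" using F form_unique_degree by blast
  then show "total_degree A \<le> D" "form (D - total_degree A) H" using e by auto
  show "\<And>i. i \<le> n \<Longrightarrow> multiplicity_at F (p i) = multiplicity_at A (p i) + multiplicity_at H (p i)"
    using multiplicity_mult[OF curveD(2,3)[OF A] H e] goodD(1)[OF g] F(3) by simp
qed

text \<open>
  What is needed of an irreducible curve of class \<open>c\<close>: it is a component of every curve that it meets negatively.
  This is a property of classes, so it passes to permuted classes, for which an irreducible curve is not
  known to exist.
\<close>

definition subtractable :: "nat \<Rightarrow> nat \<Rightarrow> (nat \<Rightarrow> complex ^ 3) \<Rightarrow> system \<Rightarrow> bool" where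
  "subtractable n B p c \<longleftrightarrow> (\<forall>E. fst E \<le> int B \<longrightarrow> effective n p E \<longrightarrow> intersection_number n E c < 0
      \<longrightarrow> effective n p (minus_mult E 1 c))"

lemma subtractableD:
  "subtractable n B p c \<Longrightarrow> fst E \<le> int B \<Longrightarrow> effective n p E \<Longrightarrow> intersection_number n E c < 0
    \<Longrightarrow> effective n p (minus_mult E 1 c)"
  unfolding subtractable_def by blast

lemma subtractable_curve:
  assumes g: "good n B p" and A: "curve A"
  shows "subtractable n B p (curve_data p A)"
  unfolding subtractable_def
proof (intro allI impI)
  fix E assume E: "effective n p E" and neg: "intersection_number n E (curve_data p A) < 0"
  define D where "D = nat (fst E)"
  define m where "m i = nat (snd E i)" for i
  have D: "fst E = int D" using E by (simp add: D_def effective_def)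
  obtain F where F: "F \<noteq> 0" "form D F" "\<And>i. i \<le> n \<Longrightarrow> mult_ge F (p i) (m i)"
    using E unfolding effective_def has_section_def D_def m_def by blast
  have "(\<Sum>i\<le>n. snd E i * int (multiplicity_at A (p i))) \<le> (\<Sum>i\<le>n. int (m i) * int (multiplicity_at A (p i)))"
    by (intro sum_mono mult_right_mono) (auto simp: m_def)
  then have "int D * int (total_degree A) < (\<Sum>i\<le>n. int (m i) * int (multiplicity_at A (p i)))"
    using neg by (simp add: intersection_number_alt D)
  then have "A dvd F" using negative_intersection_divides[OF g A F(2,3)] by blast
  then obtain H where "F = A * H" ..
  note H = quotient_section[OF g A F(1,2) this]
  have "mult_ge H (p i) (nat (snd E i - int (multiplicity_at A (p i))))" if "i \<le> n" for i
    using H(4)[OF that] F(3)[OF that] unfolding mult_ge_iff[OF F(1,2)] mult_ge_iff[OF H(1,3)] m_def by linarith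
  then show "effective n p (minus_mult E 1 (curve_data p A))"
    using H unfolding effective_def has_section_def
    by (auto simp: D nat_diff_distrib intro!: exI[of _ H])
qed

text \<open>
  Permute \<open>E\<close> back, subtract \<open>c\<close>, and permute forth.
\<close>

lemma subtractable_permute:
  assumes g: "good n B p" and \<sigma>: "\<sigma> permutes {..n}" and c: "subtractable n B p c" "0 \<le> fst c"
  shows "subtractable n B p (permute \<sigma> c)"
  unfolding subtractable_def
proof (intro allI impI)
  fix E assume E: "fst E \<le> int B" "effective n p E" "intersection_number n E (permute \<sigma> c) < 0"
  let ?E = "permute (inv \<sigma>) E"
  have inv: "inv \<sigma> permutes {..n}" by (rule permutes_inv[OF \<sigma>])
  have undo: "permute \<sigma> ?E = E"
    using permutes_inverses(2)[OF \<sigma>] by (simp add: permute_def o_def)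
  have "intersection_number n ?E c = intersection_number n E (permute \<sigma> c)"
    using intersection_permute[OF \<sigma>, of ?E c] undo by simp
  moreover have "effective n p ?E" "fst ?E \<le> int B"
    using effective_permute[OF g inv E(2,1)] E(1) by (simp_all add: permute_def)
  ultimately have "effective n p (minus_mult ?E 1 c)" using subtractableD[OF c(1), of ?E] E(3) by simp
  moreover have "fst (minus_mult ?E 1 c) \<le> int B" using E(1) c(2) by (simp add: permute_def)
  ultimately show "effective n p (minus_mult E 1 (permute \<sigma> c))"
    using effective_permute[OF g \<sigma>, of "minus_mult ?E 1 c"] undo by (simp add: permute_minus_mult)
qed

lemma subtractable_iterate:
  assumes c: "subtractable n B p c" "0 \<le> fst c" "intersection_number n c c = - 1"
    and E: "effective n p E" "fst E \<le> int B"
  shows "intersection_number n E c \<le> - int k \<Longrightarrow> effective n p (minus_mult E (int k) c)"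
proof (induction k)
  case 0
  have "minus_mult E 0 c = E" by (simp add: minus_mult_def prod_eq_iff)
  then show ?case using E by simp
next
  case (Suc k)
  let ?E = "minus_mult E (int k) c"
  have "effective n p ?E" using Suc by simp
  moreover have "intersection_number n ?E c < 0" using Suc.prems c(3) by (simp add: intersection_minus_mult)
  moreover have "0 \<le> int k * fst c" using c(2) by simp
  then have "fst ?E \<le> int B" using E(2) by simp
  ultimately have "effective n p (minus_mult ?E 1 c)" using subtractableD[OF c(1)] by blast
  moreover have "minus_mult ?E 1 c = minus_mult E (int (Suc k)) c"
    by (simp add: minus_mult_def fun_eq_iff algebra_simps)
  ultimately show ?case by simp
qed

text \<open>
  If \<open>t = c \<cdot> c' \<ge> 1\<close>, then \<open>L - x c - y c'\<close> meets \<open>c\<close> in \<open>L \<cdot> c + x - t y < 0\<close> when \<open>x \<le> y\<close>, and meets \<open>c'\<close> in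
  \<open>L \<cdot> c' + y - t x < 0\<close> when \<open>y \<le> x\<close>. So one of the two can always be subtracted again, until the degree is negative.
\<close>

lemma no_meeting_negative_curves:
  assumes c: "subtractable n B p c" "1 \<le> fst c" "intersection_number n c c = - 1"
    and c': "subtractable n B p c'" "fst c' = fst c" "intersection_number n c' c' = - 1"
    and L: "effective n p L" "fst L \<le> int B" "intersection_number n L c < 0" "intersection_number n L c' < 0"
  shows "intersection_number n c c' \<le> 0"
proof (rule ccontr)
  assume "\<not> ?thesis"
  then have t: "1 \<le> intersection_number n c c'" by simp
  have t': "intersection_number n c' c = intersection_number n c c'" by (rule intersection_commute)
  have "\<exists>x y. x + y = k \<and> effective n p (minus_mult (minus_mult L (int x) c) (int y) c')" for k
  proof (induction k)
    case 0
    have "minus_mult (minus_mult L (int 0) c) (int 0) c' = L" by (simp add: minus_mult_def prod_eq_iff)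
    then show ?case using L by (metis add_0)
  next
    case (Suc k)
    then obtain x y where xy: "x + y = k" "effective n p (minus_mult (minus_mult L (int x) c) (int y) c')" (is "effective n p ?E")
      by blast
    have "0 \<le> int x * fst c" "0 \<le> int y * fst c" using c(2) by simp_all
    then have B: "fst ?E \<le> int B" using L(2) c' by simp
    show ?case
    proof (cases "x \<le> y")
      case True
      have "int x * 1 \<le> int y * intersection_number n c c'" using True t by (intro mult_mono) auto
      then have "intersection_number n ?E c < 0" using L(3) c(3) by (simp add: intersection_minus_mult t')
      then have "effective n p (minus_mult ?E 1 c)" using subtractableD[OF c(1) B xy(2)] by blast
      moreover have "minus_mult ?E 1 c = minus_mult (minus_mult L (int (Suc x)) c) (int y) c'"
        by (simp add: minus_mult_def fun_eq_iff algebra_simps)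
      ultimately show ?thesis using xy(1) by (intro exI[of _ "Suc x"] exI[of _ y]) simp
    next
      case False
      have "int y * 1 \<le> int x * intersection_number n c c'" using False t by (intro mult_mono) auto
      then have "intersection_number n ?E c' < 0" using L(4) c'(3) by (simp add: intersection_minus_mult)
      then have "effective n p (minus_mult ?E 1 c')" using subtractableD[OF c'(1) B xy(2)] by blast
      moreover have "minus_mult ?E 1 c' = minus_mult (minus_mult L (int x) c) (int (Suc y)) c'"
        by (simp add: minus_mult_def fun_eq_iff algebra_simps)
      ultimately show ?thesis using xy(1) by (intro exI[of _ x] exI[of _ "Suc y"]) simp
    qed
  qed
  then obtain x y where xy: "x + y = nat (fst L + 1)" "effective n p (minus_mult (minus_mult L (int x) c) (int y) c')"
    by blast
  have "fst L - int x * fst c - int y * fst c \<ge> 0" using effective_degree[OF xy(2)] c'(2) by simp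
  moreover have "int x * 1 \<le> int x * fst c" "int y * 1 \<le> int y * fst c" using c(2) by (intro mult_left_mono; simp)+
  moreover have "int x + int y = fst L + 1" using xy(1) effective_degree[OF L(1)] by linarith
  ultimately show False by linarith
qed

lemma subtract_disjoint_family:
  assumes T: "finite T"
    and c: "\<And>t. t \<in> T \<Longrightarrow> subtractable n B p (c t)" "\<And>t. t \<in> T \<Longrightarrow> 0 \<le> fst (c t)"
      "\<And>t. t \<in> T \<Longrightarrow> intersection_number n (c t) (c t) = - 1"
      "\<And>t u. t \<in> T \<Longrightarrow> u \<in> T \<Longrightarrow> t \<noteq> u \<Longrightarrow> intersection_number n (c t) (c u) = 0"
    and L: "effective n p L" "fst L \<le> int B" "\<And>t. t \<in> T \<Longrightarrow> intersection_number n L (c t) \<le> - int k"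
  shows "effective n p (fst L - int k * (\<Sum>t\<in>T. fst (c t)), \<lambda>i. snd L i - int k * (\<Sum>t\<in>T. snd (c t) i))"
  using T c L(3)
proof (induction T rule: finite_induct)
  case empty
  then show ?case using L by (simp add: effective_def)
next
  case (insert u T)
  let ?E = "(fst L - int k * (\<Sum>t\<in>T. fst (c t)), \<lambda>i. snd L i - int k * (\<Sum>t\<in>T. snd (c t) i))"
  have E: "effective n p ?E" using insert by simp
  have "0 \<le> int k * (\<Sum>t\<in>T. fst (c t))" using insert.prems(2) by (intro mult_nonneg_nonneg sum_nonneg) auto
  then have B: "fst ?E \<le> int B" using L(2) by simp
  have "intersection_number n ?E (c u) = intersection_number n L (c u) - int k * (\<Sum>t\<in>T. intersection_number n (c t) (c u))"
    unfolding intersection_number_alt fst_conv snd_conv sum_subtractf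
    by (simp add: algebra_simps sum_subtractf sum_distrib_left sum_distrib_right sum.swap[of _ T])
  also have "(\<Sum>t\<in>T. intersection_number n (c t) (c u)) = 0"
    using insert.prems(4) insert.hyps(2) by (intro sum.neutral) auto
  finally have "intersection_number n ?E (c u) \<le> - int k" using insert.prems(5)[of u] by simp
  then have "effective n p (minus_mult ?E (int k) (c u))"
    using insert.prems by (intro subtractable_iterate[OF _ _ _ E B]) auto
  moreover have "minus_mult ?E (int k) (c u) = (fst L - int k * (\<Sum>t\<in>insert u T. fst (c t)), \<lambda>i. snd L i - int k * (\<Sum>t\<in>insert u T. snd (c t) i))"
    using insert.hyps by (simp add: minus_mult_def fun_eq_iff algebra_simps)
  ultimately show ?case by simp
qed

lemma effective_add_curve:
  assumes g: "good n B p" and A: "curve A" and E: "effective n p E"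
  shows "effective n p (minus_mult E (- int k) (curve_data p A))"
proof (induction k)
  case 0
  have "minus_mult E (- int 0) (curve_data p A) = E" by (simp add: minus_mult_def prod_eq_iff)
  then show ?case using E by simp
next
  case (Suc k)
  let ?E = "minus_mult E (- int k) (curve_data p A)" and ?F = "minus_mult E (- int (Suc k)) (curve_data p A)"
  obtain F where F: "F \<noteq> 0" "form (nat (fst ?E)) F" "\<And>i. i \<le> n \<Longrightarrow> mult_ge F (p i) (nat (snd ?E i))"
    and D: "0 \<le> fst ?E"
    using Suc unfolding effective_def has_section_def by blast
  have AF: "A * F \<noteq> 0" using F curveD(2)[OF A] by simp
  have deg: "nat (fst ?F) = total_degree A + nat (fst ?E)" using D by (simp add: nat_add_distrib algebra_simps)
  have fAF: "form (nat (fst ?F)) (A * F)" unfolding deg by (rule form_mult[OF curveD(3)[OF A] F(2)])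
  have "mult_ge (A * F) (p i) (nat (snd ?F i))" if "i \<le> n" for i
  proof -
    have "multiplicity_at (A * F) (p i) = multiplicity_at A (p i) + multiplicity_at F (p i)"
      by (rule multiplicity_mult[OF curveD(2,3)[OF A] F(1,2) goodD(1)[OF g that]])
    then show ?thesis using F(3)[OF that] unfolding mult_ge_iff[OF F(1,2)] mult_ge_iff[OF AF fAF]
      by (simp add: algebra_simps nat_le_iff)
  qed
  moreover have "0 \<le> fst ?F" using D by (simp add: algebra_simps)
  ultimately show ?case unfolding effective_def has_section_def using AF fAF by blast
qed

lemma effective_from_residual:
  assumes g: "good n B p" and A: "\<And>j. j < r \<Longrightarrow> curve (A j)" and N: "\<And>j. j < r \<Longrightarrow> 0 \<le> N j"
    and M: "effective n p (residual p L r N A)"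
  shows "effective n p L"
  using A N M
proof (induction r)
  case 0 then show ?case by (simp add: residual_def)
next
  case (Suc r)
  have "effective n p (minus_mult (residual p L (Suc r) N A) (- int (nat (N r))) (curve_data p (A r)))"
    using Suc.prems by (intro effective_add_curve[OF g]) auto
  also have "minus_mult (residual p L (Suc r) N A) (- int (nat (N r))) (curve_data p (A r)) = residual p L r N A"
    using Suc.prems(2)[of r] by (simp add: minus_mult_def residual_def)
  finally show ?case using Suc by simp
qed

section \<open>Negative curves of quasi-homogeneous systems\<close>

lemma sum_atMost_split: "(\<Sum>i\<le>n. f i) = f 0 + (\<Sum>i=1..n. f i)" for f :: "nat \<Rightarrow> int"
  by (simp add: atMost_atLeast0 sum.atLeast_Suc_atMost)

lemma minus_one_curve_numerics:
  assumes "minus_one_curve n p A"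
  shows "curve A" "intersection_number n (curve_data p A) (curve_data p A) = - 1"
    "3 * fst (curve_data p A) - (\<Sum>i\<le>n. snd (curve_data p A) i) = 1"
proof -
  let ?c = "curve_data p A"
  show "curve A" using assms by (simp add: minus_one_curve_def curve_def)
  show *: "intersection_number n ?c ?c = - 1" using assms by (simp add: minus_one_curve_def)
  have "2 * genus n ?c = 0" using assms by (simp add: minus_one_curve_def)
  then have "(fst ?c - 1) * (fst ?c - 2) = (\<Sum>i\<le>n. snd ?c i * snd ?c i) - (\<Sum>i\<le>n. snd ?c i)"
    unfolding genus_twice by (simp only: right_diff_distrib sum_subtractf mult_1_right)
  moreover have "fst ?c * fst ?c - (\<Sum>i\<le>n. snd ?c i * snd ?c i) = - 1"
    using * by (simp only: intersection_number_alt)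
  ultimately show "3 * fst ?c - (\<Sum>i\<le>n. snd ?c i) = 1" by (simp only: left_diff_distrib right_diff_distrib)
qed

text \<open>
  The permuted class has the same self-intersection, so this is the identity
  \<open>2 * (c \<cdot> c') = c \<cdot> c + c' \<cdot> c' - (c - c') \<cdot> (c - c')\<close>.
\<close>

lemma intersection_permute_self:
  assumes "\<sigma> permutes {..n}" "intersection_number n c c = - 1"
  shows "2 * intersection_number n c (permute \<sigma> c) = (\<Sum>i\<le>n. (snd c i - snd c (\<sigma> i))\<^sup>2) - 2"
proof -
  have "(\<Sum>i\<le>n. snd c (\<sigma> i) * snd c (\<sigma> i)) = (\<Sum>i\<le>n. snd c i * snd c i)"
    using sum.permute[OF assms(1), of "\<lambda>i. snd c i * snd c i"] by (simp add: o_def)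
  moreover have "(\<Sum>i\<le>n. (snd c i - snd c (\<sigma> i))\<^sup>2)
      = (\<Sum>i\<le>n. snd c i * snd c i) + (\<Sum>i\<le>n. snd c (\<sigma> i) * snd c (\<sigma> i)) - 2 * (\<Sum>i\<le>n. snd c i * snd c (\<sigma> i))"
    unfolding sum_distrib_left sum.distrib[symmetric] sum_subtractf[symmetric]
    by (rule sum.cong) (auto simp: power2_eq_square algebra_simps)
  ultimately show ?thesis using assms(2) by (simp add: intersection_number_alt permute_def)
qed

text \<open>
  Here \<open>\<sigma>\<close> fixes \<open>p 0\<close>, so it preserves \<open>L\<close>, and \<open>c\<close> and its permuted copy both meet \<open>L\<close> negatively.
\<close>

lemma permuted_multiplicities_close:
  assumes g: "good n B p" and c: "subtractable n B p c" "1 \<le> fst c" "intersection_number n c c = - 1"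
    and L: "effective n p L" "fst L \<le> int B" "intersection_number n L c < 0"
    and sym: "\<And>i. i \<in> {1..n} \<Longrightarrow> snd L i = l" and \<sigma>: "\<sigma> permutes {1..n}"
  shows "(\<Sum>i\<le>n. (snd c i - snd c (\<sigma> i))\<^sup>2) \<le> 2"
proof -
  have \<sigma>': "\<sigma> permutes {..n}" by (rule permutes_subset[OF \<sigma>]) auto
  have L': "snd (permute \<sigma> L) i = snd L i" if "i \<le> n" for i
  proof (cases "i \<in> {1..n}")
    case True
    then have "\<sigma> i \<in> {1..n}" using permutes_in_image[OF \<sigma>] by blast
    then show ?thesis using True sym by (simp add: permute_def)
  next
    case False
    then show ?thesis using permutes_not_in[OF \<sigma> False] by (simp add: permute_def)
  qed
  have "intersection_number n L (permute \<sigma> c) = intersection_number n (permute \<sigma> L) (permute \<sigma> c)"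
    unfolding intersection_number_alt using L' by (auto simp: permute_def intro!: sum.cong)
  then have "intersection_number n L (permute \<sigma> c) < 0" using L(3) intersection_permute[OF \<sigma>'] by simp
  moreover have "intersection_number n (permute \<sigma> c) (permute \<sigma> c) = - 1"
    using c(3) intersection_permute[OF \<sigma>'] by simp
  moreover have "subtractable n B p (permute \<sigma> c)" using subtractable_permute[OF g \<sigma>' c(1)] c(2) by simp
  ultimately have "intersection_number n c (permute \<sigma> c) \<le> 0"
    using no_meeting_negative_curves[OF c, of "permute \<sigma> c" L] L by (simp add: permute_def)
  then show ?thesis using intersection_permute_self[OF \<sigma>' c(3)] by linarith
qed

lemma square_le_1: "(x :: int)\<^sup>2 \<le> 1 \<Longrightarrow> \<bar>x\<bar> \<le> 1"
  using abs_le_square_iff[of x 1] by simp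

lemma square_ge_1: "x \<noteq> 0 \<Longrightarrow> 1 \<le> (x :: int)\<^sup>2"
  using zero_less_power2[of x] by linarith

text \<open>
  If \<open>f i \<noteq> f j\<close>, and neither \<open>i\<close> nor \<open>j\<close> is the only exception, there are \<open>k \<noteq> i\<close> and \<open>l \<noteq> j\<close> with \<open>f k \<noteq> f j\<close> and
  \<open>f l \<noteq> f i\<close>. For \<open>k = l\<close> there would be three distinct values that pairwise differ by at most \<open>1\<close>; for
  \<open>k \<noteq> l\<close> the pairs \<open>(k, j)\<close> and \<open>(l, i)\<close> contradict the second hypothesis.
\<close>

lemma almost_constant:
  fixes f :: "nat \<Rightarrow> int"
  assumes close: "\<And>i j. i \<in> X \<Longrightarrow> j \<in> X \<Longrightarrow> \<bar>f i - f j\<bar> \<le> 1"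
    and pairs: "\<And>i j k l. {i, j, k, l} \<subseteq> X \<Longrightarrow> distinct [i, j, k, l] \<Longrightarrow> f i = f j \<or> f k = f l"
  shows "(\<exists>a. \<forall>i\<in>X. f i = a) \<or> (\<exists>a s t. s \<in> X \<and> t \<in> X \<and> s \<noteq> t \<and> \<bar>f s - a\<bar> = 1 \<and> (\<forall>i\<in>X - {s}. f i = a))"
proof (cases "\<forall>i\<in>X. \<forall>j\<in>X. f i = f j")
  case True
  then have "\<forall>i\<in>X. f i = f (SOME x. x \<in> X)" by (metis someI)
  then show ?thesis by blast
next
  case False
  then obtain i j where ij: "i \<in> X" "j \<in> X" "f i \<noteq> f j" by blast
  have one: "\<bar>f i - f j\<bar> = 1" "\<bar>f j - f i\<bar> = 1" using close[OF ij(1,2)] ij(3) by linarith+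
  show ?thesis
  proof (cases "\<forall>k\<in>X - {i}. f k = f j")
    case True
    then show ?thesis using ij one by (intro disjI2 exI[of _ "f j"] exI[of _ i] exI[of _ j]) auto
  next
    case False
    then obtain k where k: "k \<in> X" "k \<noteq> i" "f k \<noteq> f j" by blast
    have "f l = f i" if l: "l \<in> X - {j}" for l
    proof (rule ccontr)
      assume nl: "f l \<noteq> f i"
      show False
      proof (cases "k = l")
        case True
        then show False using close[of k i] close[of k j] close[of i j] ij k nl by auto
      next
        case False
        then show False using pairs[of k j l i] ij k l nl by auto
      qed
    qed
    then show ?thesis using ij one by (intro disjI2 exI[of _ "f i"] exI[of _ j] exI[of _ i]) auto
  qed
qed

text \<open>
  A transposition shows that two multiplicities differ by at most \<open>1\<close>, and a product of two disjoint
  transpositions shows that two disjoint pairs cannot both differ.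
\<close>

lemma multiplicities_almost_constant:
  assumes g: "good n B p" and c: "subtractable n B p c" "1 \<le> fst c" "intersection_number n c c = - 1"
    and L: "effective n p L" "fst L \<le> int B" "intersection_number n L c < 0"
    and sym: "\<And>i. i \<in> {1..n} \<Longrightarrow> snd L i = l"
  shows "(\<exists>a. \<forall>i\<in>{1..n}. snd c i = a) \<or>
    (\<exists>a s t. s \<in> {1..n} \<and> t \<in> {1..n} \<and> s \<noteq> t \<and> \<bar>snd c s - a\<bar> = 1 \<and> (\<forall>i\<in>{1..n} - {s}. snd c i = a))"
proof (rule almost_constant)
  note P = permuted_multiplicities_close[OF g c L sym]
  fix i j assume ij: "i \<in> {1..n}" "j \<in> {1..n}"
  show "\<bar>snd c i - snd c j\<bar> \<le> 1"
  proof (cases "i = j")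
    case False
    let ?\<sigma> = "Transposition.transpose i j"
    have "?\<sigma> permutes {1..n}" using ij by (intro permutes_swap_id)
    from P[OF _ this] have "(\<Sum>k\<le>n. (snd c k - snd c (?\<sigma> k))\<^sup>2) \<le> 2" by blast
    moreover have "(\<Sum>k\<in>{i, j}. (snd c k - snd c (?\<sigma> k))\<^sup>2) \<le> (\<Sum>k\<le>n. (snd c k - snd c (?\<sigma> k))\<^sup>2)"
      using ij by (intro sum_mono2) auto
    ultimately have "2 * (snd c i - snd c j)\<^sup>2 \<le> 2" using False by (simp add: power2_commute)
    then show ?thesis by (intro square_le_1) simp
  qed simp
next
  note P = permuted_multiplicities_close[OF g c L sym]
  fix i j k l assume X: "{i, j, k, l} \<subseteq> {1..n}" and d: "distinct [i, j, k, l]"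
  show "snd c i = snd c j \<or> snd c k = snd c l"
  proof (rule ccontr)
    assume no: "\<not> ?thesis"
    let ?\<sigma> = "Transposition.transpose i j \<circ> Transposition.transpose k l"
    have "?\<sigma> permutes {1..n}" using X by (intro permutes_compose permutes_swap_id) auto
    from P[OF _ this] have "(\<Sum>t\<le>n. (snd c t - snd c (?\<sigma> t))\<^sup>2) \<le> 2" by blast
    moreover have "(\<Sum>t\<in>{i, j, k, l}. (snd c t - snd c (?\<sigma> t))\<^sup>2) \<le> (\<Sum>t\<le>n. (snd c t - snd c (?\<sigma> t))\<^sup>2)"
      using X by (intro sum_mono2) auto
    moreover have "(\<Sum>t\<in>{i, j, k, l}. (snd c t - snd c (?\<sigma> t))\<^sup>2)
        = (snd c i - snd c j)\<^sup>2 + (snd c j - snd c i)\<^sup>2 + (snd c k - snd c l)\<^sup>2 + (snd c l - snd c k)\<^sup>2"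
      using d by (simp add: Transposition.transpose_def)
    moreover have "1 \<le> (snd c i - snd c j)\<^sup>2" "1 \<le> (snd c j - snd c i)\<^sup>2" "1 \<le> (snd c k - snd c l)\<^sup>2"
      using no by (auto intro!: square_ge_1)
    moreover have "0 \<le> (snd c l - snd c k)\<^sup>2" by simp
    ultimately show False by linarith
  qed
qed

text \<open>
  If one multiplicity differs from the others, the orbit of the curve consists of \<open>n\<close> pairwise disjoint
  classes, all of which meet \<open>L\<close> in \<open>-N\<close>; all of them can be subtracted \<open>N\<close> times.
\<close>

lemma odd_one_out_orbit:
  assumes g: "good n B p" and c: "subtractable n B p c" "1 \<le> fst c" "intersection_number n c c = - 1"
    and L: "effective n p L" "fst L \<le> int B" "intersection_number n L c = - int N"
    and sym: "\<And>i. i \<in> {1..n} \<Longrightarrow> snd L i = l"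
    and s: "s \<in> {1..n}" "\<bar>snd c s - a\<bar> = 1" "\<And>i. i \<in> {1..n} - {s} \<Longrightarrow> snd c i = a"
  shows "effective n p (fst L - int N * (int n * fst c),
      \<lambda>i. snd L i - int N * (\<Sum>t\<in>{1..n}. snd (permute (Transposition.transpose s t) c) i))"
proof -
  let ?c = "\<lambda>t. permute (Transposition.transpose s t) c"
  have perm: "Transposition.transpose s t permutes {..n}" if "t \<in> {1..n}" for t
    using that s by (intro permutes_swap_id) auto
  have val: "snd (?c t) i = (if i = t then snd c s else if i = 0 then snd c 0 else a)" if "t \<in> {1..n}" "i \<le> n" for t i
    using that s by (auto simp: permute_def Transposition.transpose_def)
  have "effective n p (fst L - int N * (\<Sum>t\<in>{1..n}. fst (?c t)), \<lambda>i. snd L i - int N * (\<Sum>t\<in>{1..n}. snd (?c t) i))"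
  proof (rule subtract_disjoint_family[where B = B])
    show "subtractable n B p (?c t)" if "t \<in> {1..n}" for t
      using subtractable_permute[OF g perm[OF that] c(1)] c(2) by simp
    show "0 \<le> fst (?c t)" for t using c(2) by (simp add: permute_def)
    show self: "intersection_number n (?c t) (?c t) = - 1" if "t \<in> {1..n}" for t
      using intersection_permute[OF perm[OF that]] c(3) by simp
    show "intersection_number n (?c t) (?c u) = 0" if "t \<in> {1..n}" "u \<in> {1..n}" "t \<noteq> u" for t u
    proof -
      let ?b = "snd c s"
      have "intersection_number n (?c t) (?c u) - intersection_number n (?c t) (?c t)
          = (\<Sum>i\<le>n. snd (?c t) i * (snd (?c t) i - snd (?c u) i))"
        by (simp add: intersection_number_alt permute_def right_diff_distrib sum_subtractf)
      also have "\<dots> = (\<Sum>i\<le>n. (if i = t then ?b * (?b - a) else 0) + (if i = u then a * (a - ?b) else 0))"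
        using that by (intro sum.cong) (auto simp: val)
      also have "\<dots> = (?b - a)\<^sup>2"
        using that by (simp add: sum.distrib power2_eq_square algebra_simps)
      also have "\<dots> = 1" using s(2) by (metis power2_abs one_power2)
      finally show ?thesis using self[OF that(1)] by simp
    qed
    show "intersection_number n L (?c t) \<le> - int N" if "t \<in> {1..n}" for t
    proof -
      have "snd L (Transposition.transpose s t i) = snd L i" for i
        using s(1) that sym by (auto simp: Transposition.transpose_def)
      then have "permute (Transposition.transpose s t) L = L" by (simp add: permute_def o_def)
      then show ?thesis using intersection_permute[OF perm[OF that], of L c] L(3) by simp
    qed
  qed (use L in auto)
  then show ?thesis by (simp add: permute_def)
qed

section \<open>Numerical classification\<close>

lemma factor_pairs:
  fixes x y :: int
  shows "x * y = 2 \<Longrightarrow> (x, y) \<in> {(1, 2), (2, 1), (- 1, - 2), (- 2, - 1)}"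
    and "x * y = 4 \<Longrightarrow> (x, y) \<in> {(1, 4), (2, 2), (4, 1), (- 1, - 4), (- 2, - 2), (- 4, - 1)}"
    and "x * y = 5 \<Longrightarrow> (x, y) \<in> {(1, 5), (5, 1), (- 1, - 5), (- 5, - 1)}"
proof -
  have bound: "x \<in> {- k..k}" if "x * y = k" "0 < k" for k
  proof -
    have "x dvd k" using that by auto
    then have "\<bar>x\<bar> \<le> k" using that zdvd_imp_le[of "\<bar>x\<bar>" k] by simp
    then show ?thesis by auto
  qed
  show "(x, y) \<in> {(1, 2), (2, 1), (- 1, - 2), (- 2, - 1)}" if "x * y = 2"
  proof -
    have "x \<in> {-2, -1, 0, 1, 2}" using bound[OF that] by auto
    with that show ?thesis by auto
  qed
  show "(x, y) \<in> {(1, 4), (2, 2), (4, 1), (- 1, - 4), (- 2, - 2), (- 4, - 1)}" if "x * y = 4"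
  proof -
    have "x \<in> {-4, -3, -2, -1, 0, 1, 2, 3, 4}" using bound[OF that] by auto
    with that show ?thesis by (elim insertE; simp; presburger?)
  qed
  show "(x, y) \<in> {(1, 5), (5, 1), (- 1, - 5), (- 5, - 1)}" if "x * y = 5"
  proof -
    have "x \<in> {-5, -4, -3, -2, -1, 0, 1, 2, 3, 4, 5}" using bound[OF that] by simp presburger
    with that show ?thesis by (elim insertE; simp; presburger?)
  qed
qed

text \<open>
  The second equation is used to eliminate \<open>n\<close> (or \<open>y\<close>, if \<open>a = 0\<close>); the first one then factors, for \<open>a = 1\<close> as
  \<open>(x - y - 1) * (x + y - 2) = 0\<close> and for \<open>a = 2\<close> as \<open>(x - y - 2) * (x + y - 4) = 5\<close>.
\<close>

lemma homogeneous_minus_one_numerics: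
  fixes x y n a :: int
  assumes "1 \<le> x" "0 \<le> y" "0 \<le> n" "a \<in> {0, 1, 2}"
    and self: "x * x - y * y - n * (a * a) = - 1" and K: "3 * x - y - n * a = 1"
  shows "a = 1 \<and> (y = x - 1 \<and> n = 2 * x \<or> x = 1 \<and> y = 1 \<and> n = 1 \<or> x = 2 \<and> y = 0 \<and> n = 5)
    \<or> a = 2 \<and> x = 6 \<and> y = 3 \<and> n = 7"
proof -
  consider "a = 0" | "a = 1" | "a = 2" using assms(4) by auto
  then show ?thesis
  proof cases
    case 1
    then have y: "y = 3 * x - 1" using K by simp
    have "x * (8 * x - 6) = 0" using self unfolding 1 y by (simp add: algebra_simps)
    then show ?thesis using assms(1) by (auto; presburger)
  next
    case 2
    then have n: "n = 3 * x - y - 1" using K by simp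
    have "(x - y - 1) * (x + y - 2) = 0" using self unfolding 2 n by (simp add: algebra_simps)
    then show ?thesis using assms(1,2) 2 n by auto
  next
    case 3
    then have n: "2 * n = 3 * x - y - 1" using K by simp
    have "(x - y - 2) * (x + y - 4) = 5"
      using self n unfolding 3 by (simp add: algebra_simps)
    from factor_pairs(3)[OF this] show ?thesis using assms(1,2) 3 n by auto
  qed
qed

lemma odd_one_out_numerics:
  fixes x y n a b :: int
  assumes "1 \<le> x" "0 \<le> y" "2 \<le> n" "a \<in> {0, 1, 2}" "b \<in> {0, 1, 2}" "\<bar>b - a\<bar> = 1"
    and self: "x * x - y * y - (n - 1) * (a * a) - b * b = - 1" and K: "3 * x - y - (n - 1) * a - b = 1"
  shows "a = 0 \<and> b = 1 \<and> x = 1 \<and> y = 1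
    \<or> a = 1 \<and> b = 0 \<and> (y = x - 1 \<and> n = 2 * x + 1 \<or> x = 1 \<and> y = 1 \<and> n = 2 \<or> x = 2 \<and> y = 0 \<and> n = 6)
    \<or> a = 1 \<and> b = 2 \<and> (x = 3 \<and> y = 1 \<and> n = 6 \<or> x = 3 \<and> y = 0 \<and> n = 7)
    \<or> a = 2 \<and> b = 1 \<and> x = 5 \<and> y = 1 \<and> n = 7"
proof -
  consider "a = 0" "b = 1" | "a = 1" "b = 0" | "a = 1" "b = 2" | "a = 2" "b = 1" using assms(4-6) by auto
  then show ?thesis
  proof cases
    case 1
    then have y: "y = 3 * x - 2" using K by simp
    have "(x - 1) * (2 * x - 1) = 0" using self unfolding 1 y by (simp add: algebra_simps)
    then show ?thesis using 1 y by (auto; presburger)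
  next
    case 2
    then have n: "n = 3 * x - y" using K by simp
    have "(x - y - 1) * (x + y - 2) = 0" using self unfolding 2 n by (simp add: algebra_simps)
    then show ?thesis using assms(1-3) 2 n by auto
  next
    case 3
    then have n: "n = 3 * x - y - 2" using K by simp
    have "(x - y - 1) * (x + y - 2) = 2" using self unfolding 3 n by (simp add: algebra_simps)
    from factor_pairs(1)[OF this] show ?thesis using assms(1-3) 3 n by auto
  next
    case 4
    then have n: "2 * n = 3 * x - y" using K by simp
    have "(x - y - 2) * (x + y - 4) = 4"
      using self n unfolding 4 by (simp add: algebra_simps)
    from factor_pairs(2)[OF this] show ?thesis using assms(1-3) 4 n by (auto; presburger)
  qed
qed

text \<open>
  The line through \<open>p 0\<close> and \<open>p t\<close>.
\<close>

definition line_class :: "nat \<Rightarrow> nat \<Rightarrow> system \<Rightarrow> bool" where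
  "line_class n t c \<longleftrightarrow> t \<in> {1..n} \<and> fst c = 1 \<and> snd c 0 = 1 \<and> snd c t = 1 \<and> (\<forall>i\<in>{1..n} - {t}. snd c i = 0)"

definition constant_class :: "nat \<Rightarrow> int \<Rightarrow> int \<Rightarrow> int \<Rightarrow> system \<Rightarrow> bool" where
  "constant_class n x y a c \<longleftrightarrow> fst c = x \<and> snd c 0 = y \<and> (\<forall>i\<in>{1..n}. snd c i = a)"

lemma quasi_homogeneous_simps [simp]:
  "fst (quasi_homogeneous d m0 m) = int d" "snd (quasi_homogeneous d m0 m) 0 = int m0"
  "0 < i \<Longrightarrow> snd (quasi_homogeneous d m0 m) i = int m"
  by (simp_all add: quasi_homogeneous_def)

lemma intersection_quasi_homogeneous:
  "intersection_number n (quasi_homogeneous d m0 m) c = int d * fst c - int m0 * snd c 0 - int m * (\<Sum>i=1..n. snd c i)"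
  by (simp add: intersection_number_alt sum_atMost_split sum_distrib_left)

lemma virtual_dim_quasi_homogeneous:
  "2 * virtual_dim n (quasi_homogeneous d m0 4) = int d * (int d + 3) - int m0 * (int m0 + 1) - 20 * int n"
  by (simp add: virtual_dim_twice sum_atMost_split)

lemma sum_odd_one_out:
  fixes f :: "nat \<Rightarrow> int"
  assumes "s \<in> {1..n}" "\<And>i. i \<in> {1..n} - {s} \<Longrightarrow> f i = a"
  shows "(\<Sum>i=1..n. f i) = f s + (int n - 1) * a"
proof -
  have "(\<Sum>i=1..n. f i) = f s + (\<Sum>i\<in>{1..n} - {s}. f i)" using assms(1) by (intro sum.remove) auto
  also have "(\<Sum>i\<in>{1..n} - {s}. f i) = (\<Sum>i\<in>{1..n} - {s}. a)" by (rule sum.cong) (use assms in auto)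
  finally show ?thesis using assms(1) by (simp add: of_nat_diff)
qed

text \<open>
  The bound \<open>N * \<mu> i \<le> 4\<close> makes the multiplicities at most \<open>2\<close>, so the numerical classifications apply. If one
  multiplicity differs, the whole orbit can be subtracted \<open>N\<close> times, and therefore
  \<open>N * n * x \<le> d\<close> for the degree \<open>x\<close> of the curve. Against \<open>L \<cdot> A = -N\<close> this excludes everything but lines and, for
  \<open>n = 3\<close>, the sides of a triangle, where \<open>d = 6\<close> and \<open>m0 = 0\<close>.
\<close>

lemma very_negative_curve_classes:
  assumes g: "good n B p" and B: "d \<le> B" and L: "effective n p (quasi_homogeneous d m0 4)"
    and A: "minus_one_curve n p A"
    and N: "intersection_number n (quasi_homogeneous d m0 4) (curve_data p A) = - N" "2 \<le> N"
    and le: "\<And>i. i \<in> {1..n} \<Longrightarrow> N * snd (curve_data p A) i \<le> 4"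
  shows "(\<exists>t. line_class n t (curve_data p A)) \<or>
    (\<exists>e. constant_class n e (e - 1) 1 (curve_data p A) \<and> int n = 2 * e) \<or>
    (constant_class n 2 0 1 (curve_data p A) \<and> n = 5) \<or>
    (constant_class n 6 3 2 (curve_data p A) \<and> n = 7) \<or>
    (d = 6 \<and> m0 = 0 \<and> n = 3)"
proof -
  let ?L = "quasi_homogeneous d m0 4"
  define c where "c = curve_data p A"
  define x y where "x = fst c" and "y = snd c 0"
  note num = minus_one_curve_numerics[OF A, folded c_def]
  have sub: "subtractable n B p c" unfolding c_def by (rule subtractable_curve[OF g num(1)])
  have x1: "1 \<le> fst c" using curve_degree_pos[OF num(1)] by (simp add: c_def)
  have nonneg: "0 \<le> snd c i" for i by (simp add: c_def)
  have m0d: "int m0 \<le> int d" using effective_mult_le[OF L, of 0] by simp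
  have neg: "intersection_number n ?L c < 0" using N by (simp add: c_def)
  have self: "x * x - y * y - (\<Sum>i=1..n. snd c i * snd c i) = - 1"
    using num(2) unfolding x_def y_def intersection_number_alt sum_atMost_split by linarith
  have K: "3 * x - y - (\<Sum>i=1..n. snd c i) = 1"
    using num(3) unfolding x_def y_def sum_atMost_split by linarith
  have LN: "int d * x - int m0 * y - 4 * (\<Sum>i=1..n. snd c i) = - N"
    using N(1) unfolding c_def[symmetric] intersection_quasi_homogeneous x_def y_def by simp
  have small: "snd c i \<in> {0, 1, 2}" if "i \<in> {1..n}" for i
  proof -
    have "2 * snd c i \<le> N * snd c i" using N(2) nonneg by (intro mult_right_mono) auto
    then have "snd c i \<le> 2" using le[OF that] by (simp add: c_def)
    then show ?thesis using nonneg[of i] by auto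
  qed
  have "(\<exists>a. \<forall>i\<in>{1..n}. snd c i = a) \<or>
    (\<exists>a s t. s \<in> {1..n} \<and> t \<in> {1..n} \<and> s \<noteq> t \<and> \<bar>snd c s - a\<bar> = 1 \<and> (\<forall>i\<in>{1..n} - {s}. snd c i = a))"
    by (rule multiplicities_almost_constant[OF g sub x1 num(2) L _ neg]) (use B in auto)
  then show ?thesis
  proof (elim disjE exE conjE)
    fix a' assume a': "\<forall>i\<in>{1..n}. snd c i = a'"
    \<comment> \<open>for \<open>n = 0\<close> the common value is arbitrary, and \<open>0\<close> is the one excluded by the numerics\<close>
    define a where "a = (if n = 0 then 0 else a')"
    have a: "\<forall>i\<in>{1..n}. snd c i = a" using a' by (simp add: a_def)
    have a3: "a \<in> {0, 1, 2}"
      using small[of 1] a'[rule_format, of 1] by (cases "n = 0") (simp_all add: a_def)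
    have "(\<Sum>i=1..n. snd c i) = int n * a" "(\<Sum>i=1..n. snd c i * snd c i) = int n * (a * a)"
      using a by simp_all
    with self K have "x * x - y * y - int n * (a * a) = - 1" "3 * x - y - int n * a = 1" by simp_all
    from homogeneous_minus_one_numerics[OF _ _ _ a3 this] x1 nonneg[of 0]
    have "a = 1 \<and> (y = x - 1 \<and> int n = 2 * x \<or> x = 1 \<and> y = 1 \<and> int n = 1 \<or> x = 2 \<and> y = 0 \<and> int n = 5)
       \<or> a = 2 \<and> x = 6 \<and> y = 3 \<and> int n = 7" by (simp add: x_def y_def)
    moreover have "line_class n 1 c" if "a = 1" "x = 1" "y = 1" "n = 1"
      using that a by (auto simp: line_class_def x_def y_def)
    ultimately show ?thesis using a unfolding c_def[symmetric]
      by (auto simp: constant_class_def x_def y_def)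
  next
    fix a s t assume s: "s \<in> {1..n}" "t \<in> {1..n}" "s \<noteq> t" "\<bar>snd c s - a\<bar> = 1" "\<forall>i\<in>{1..n} - {s}. snd c i = a"
    define b where "b = snd c s"
    have a3: "a \<in> {0, 1, 2}" using small[of t] s by auto
    have b3: "b \<in> {0, 1, 2}" using small[of s] s by (simp add: b_def)
    have n2: "2 \<le> int n" using s(1-3) by auto
    have S1: "(\<Sum>i=1..n. snd c i) = b + (int n - 1) * a"
      unfolding b_def by (rule sum_odd_one_out[OF s(1)]) (use s in auto)
    have S2: "(\<Sum>i=1..n. snd c i * snd c i) = b * b + (int n - 1) * (a * a)"
      unfolding b_def by (rule sum_odd_one_out[OF s(1)]) (use s in auto)
    have ab: "\<bar>b - a\<bar> = 1" using s(4) by (simp add: b_def)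
    have num1: "x * x - y * y - (int n - 1) * (a * a) - b * b = - 1" using self S2 by linarith
    have num2: "3 * x - y - (int n - 1) * a - b = 1" using K S1 by linarith
    have x1': "1 \<le> x" and y0: "0 \<le> y" using x1 nonneg[of 0] by (simp_all add: x_def y_def)
    note cases = odd_one_out_numerics[OF x1' y0 n2 a3 b3 ab num1 num2]
    let ?E = "(fst ?L - int (nat N) * (int n * fst c),
      \<lambda>i. snd ?L i - int (nat N) * (\<Sum>t\<in>{1..n}. snd (permute (Transposition.transpose s t) c) i))"
    have "effective n p ?E"
      by (rule odd_one_out_orbit[OF g sub x1 num(2) L]) (use B N s in \<open>auto simp: c_def\<close>)
    moreover have "(\<Sum>t\<in>{1..n}. snd (permute (Transposition.transpose s t) c) 0) = int n * y"
      using s(1) by (simp add: permute_def Transposition.transpose_def y_def)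
    ultimately have E: "0 \<le> int d - N * (int n * x)" "int m0 - N * (int n * y) \<le> int d - N * (int n * x)"
      using effective_degree[of n p ?E] effective_mult_le[of n p ?E 0] N(2) by (simp_all add: x_def)
    from cases show ?thesis
    proof (elim disjE conjE)
      assume "a = 0" "b = 1" "x = 1" "y = 1"
      then have "line_class n s c" using s by (auto simp: line_class_def x_def y_def b_def)
      then show ?thesis unfolding c_def by blast
    next
      assume "a = 1" "b = 0" "x = 1" "y = 1" "int n = 2"
      then have "n = 2" by simp
      then have "{1..n} = {1, 2}" by auto
      then have "line_class n t c"
        using s \<open>a = 1\<close> \<open>b = 0\<close> \<open>x = 1\<close> \<open>y = 1\<close> by (auto simp: line_class_def x_def y_def b_def)
      then show ?thesis unfolding c_def by blast
    next
      assume e: "a = 1" "b = 0" "y = x - 1" "int n = 2 * x + 1"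
      have "int m0 * (x - 1) \<le> int d * (x - 1)" using m0d x1' by (intro mult_right_mono) auto
      then have d8: "int d \<le> 8 * x - N" using LN S1 e by (simp add: algebra_simps)
      have "x = 1"
      proof (rule ccontr)
        assume "x \<noteq> 1"
        then have "5 * x \<le> int n * x" using x1' e by (intro mult_right_mono) auto
        then have "2 * (5 * x) \<le> N * (int n * x)" using N(2) x1' by (intro mult_mono) auto
        then show False using E(1) d8 N(2) x1' by linarith
      qed
      then show ?thesis using E d8 e N(2) LN S1 by auto
    next
      assume "a = 1" "b = 0" "x = 2" "y = 0" "int n = 6"
      then show ?thesis using E LN S1 N(2) by auto
    next
      assume "a = 1" "b = 2" "x = 3" "y = 1" "int n = 6"
      then show ?thesis using E LN S1 N(2) m0d by auto
    next
      assume "a = 1" "b = 2" "x = 3" "y = 0" "int n = 7"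
      then show ?thesis using E LN S1 N(2) by auto
    next
      assume "a = 2" "b = 1" "x = 5" "y = 1" "int n = 7"
      then show ?thesis using E LN S1 N(2) m0d by auto
    qed
  qed
qed

section \<open>The residual system\<close>

lemma residual_Suc: "residual p L (Suc r) N A = minus_mult (residual p L r N A) (N r) (curve_data p (A r))"
  by (simp add: residual_def minus_mult_def fun_eq_iff)

lemma residual_0: "residual p L 0 N A = L"
  by (simp add: residual_def)

lemma intersection_residual:
  "intersection_number n (residual p L r N A) c
    = intersection_number n L c - (\<Sum>j<r. N j * intersection_number n (curve_data p (A j)) c)"
  by (induction r) (simp_all add: residual_0 residual_Suc intersection_minus_mult)

lemma virtual_dim_minus_mult:
  assumes "intersection_number n c c = - 1" "3 * fst c - (\<Sum>i\<le>n. snd c i) = 1"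
  shows "2 * virtual_dim n (minus_mult E k c) = 2 * virtual_dim n E - 2 * k * intersection_number n E c - k * k - k"
proof -
  have v: "2 * virtual_dim n c = intersection_number n c c + (3 * fst c - (\<Sum>i\<le>n. snd c i))" for c
    unfolding virtual_dim_twice intersection_number_alt by (simp add: algebra_simps sum.distrib)
  have "intersection_number n (minus_mult E k c) (minus_mult E k c)
     = intersection_number n E E - 2 * k * intersection_number n E c - k * k"
    using assms(1) by (simp add: intersection_minus_mult intersection_commute[of n _ "minus_mult E k c"])
      (simp add: intersection_commute[of n c E] algebra_simps)
  moreover have "3 * fst (minus_mult E k c) - (\<Sum>i\<le>n. snd (minus_mult E k c) i)
     = (3 * fst E - (\<Sum>i\<le>n. snd E i)) - k * (3 * fst c - (\<Sum>i\<le>n. snd c i))"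
    by (simp add: sum_subtractf sum_distrib_left[symmetric] algebra_simps)
  ultimately show ?thesis using assms(2) by (simp add: v)
qed

text \<open>
  Subtracting \<open>N j\<close> times a \<open>(-1)\<close> curve that meets the class in \<open>- N j\<close> raises the virtual dimension by
  \<open>N j * (N j - 1) / 2\<close>; disjointness keeps the remaining intersection numbers unchanged.
\<close>

lemma virtual_dim_residual:
  assumes A: "\<And>j. j < r \<Longrightarrow> minus_one_curve n p (A j)"
    and disj: "\<And>i j. i < r \<Longrightarrow> j < r \<Longrightarrow> i \<noteq> j \<Longrightarrow> disjoint_curves n p (A i) (A j)"
    and N: "\<And>j. j < r \<Longrightarrow> intersection_number n L (curve_data p (A j)) = - N j"
  shows "2 * virtual_dim n (residual p L r N A) = 2 * virtual_dim n L + (\<Sum>j<r. N j * (N j - 1))"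
  using assms
proof (induction r)
  case 0 then show ?case by (simp add: residual_0)
next
  case (Suc r)
  have "(\<Sum>j<r. N j * intersection_number n (curve_data p (A j)) (curve_data p (A r))) = 0"
    using Suc.prems(2) by (intro sum.neutral) (auto simp: disjoint_curves_def)
  then have "intersection_number n (residual p L r N A) (curve_data p (A r)) = - N r"
    using Suc.prems(3) by (simp add: intersection_residual)
  then have "2 * virtual_dim n (residual p L (Suc r) N A)
      = 2 * virtual_dim n (residual p L r N A) - 2 * N r * (- N r) - N r * N r - N r"
    unfolding residual_Suc
    using virtual_dim_minus_mult[OF minus_one_curve_numerics(2,3)[OF Suc.prems(1)[OF lessI]], of "residual p L r N A" "N r"]
    by simp
  moreover have "2 * virtual_dim n (residual p L r N A) = 2 * virtual_dim n L + (\<Sum>j<r. N j * (N j - 1))"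
    by (rule Suc.IH) (use Suc.prems in auto)
  ultimately show ?case by (simp add: right_diff_distrib)
qed

section \<open>Special systems are listed\<close>

text \<open>
  The list, with its inequalities rewritten over the integers.
\<close>

definition listed :: "int \<Rightarrow> int \<Rightarrow> int \<Rightarrow> bool" where
  "listed d m n \<longleftrightarrow>
     1 \<le> n \<and> (m = d \<and> 4 * n \<le> d \<or> m = d - 1 \<and> 7 * n \<le> 2 * d \<or> m = d - 2 \<and> 3 * n + 1 \<le> d) \<or>
     (\<exists>e\<ge>1. n = 2 * e \<and> (d, m) \<in> {(6 * e, 6 * e - 2), (5 * e, 5 * e - 3), (5 * e + 1, 5 * e - 2),
         (4 * e, 4 * e - 4), (4 * e + 1, 4 * e - 3), (4 * e + 2, 4 * e - 2)}) \<or>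
     (d, m, n) \<in> {(5, 0, 2), (6, 1, 2), (8, 3, 4), (9, 4, 4), (12, 7, 6), (15, 10, 8),
         (6, 0, 2), (6, 0, 3), (8, 2, 4), (12, 6, 7),
         (9, 2, 5), (8, 0, 5), (9, 1, 5), (9, 0, 5)}"

text \<open>
  Put \<open>k = d - m\<close>. The equation gives \<open>m = 8 * e - e * k - N\<close>, and the inequalities say \<open>N \<le> k \<le> 8 - N\<close>.
\<close>

lemma rational_curve_bounds:
  fixes e d m N :: int
  assumes "1 \<le> e" "N \<in> {2, 3, 4}" and N: "d * e - m * (e - 1) - 8 * e = - N"
    and res: "0 \<le> m - N * (e - 1)" "m - N * (e - 1) \<le> d - N * e"
  shows "(d, m) \<in> {(6 * e, 6 * e - 2), (5 * e, 5 * e - 3), (5 * e + 1, 5 * e - 2),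
         (4 * e, 4 * e - 4), (4 * e + 1, 4 * e - 3), (4 * e + 2, 4 * e - 2)} \<or>
    N = 2 \<and> d = 3 * e + 3 \<and> m = 3 * e - 2 \<or> N = 3 \<and> d = 3 * e + 2 \<and> m = 3 * e - 3 \<or>
    N = 2 \<and> d = 2 * e + 4 \<and> m = 2 * e - 2"
proof -
  define k where "k = d - m"
  have d: "d = m + k" by (simp add: k_def)
  have m: "m = 8 * e - e * k - N" using N unfolding d by (simp add: algebra_simps)
  have kN: "N \<le> k" using res(2) by (simp add: k_def algebra_simps)
  have "e * k \<le> e * (8 - N)" using res(1) unfolding m by (simp add: algebra_simps)
  then have k8: "k \<le> 8 - N" using assms(1) by simp
  have "N = 2 \<and> (k = 2 \<or> k = 3 \<or> k = 4 \<or> k = 5 \<or> k = 6) \<or> N = 3 \<and> (k = 3 \<or> k = 4 \<or> k = 5) \<or> N = 4 \<and> k = 4"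
  proof -
    have "N = 2 \<or> N = 3 \<or> N = 4" using assms(2) by simp
    then show ?thesis using kN k8 by presburger
  qed
  then show ?thesis using d m by (elim disjE conjE) simp_all
qed

text \<open>
  Only the curves with \<open>N j \<ge> 2\<close> contribute to the virtual dimension of the residual system, and their classes
  are known. If all of them are lines through \<open>p 0\<close>, there are at most \<open>n\<close> of them, with \<open>N j = 4 - (d - m0)\<close>, and a nonnegative
  virtual dimension is one of the first three inequalities. Otherwise there is a rational curve,
  a conic or a sextic. Where the equations alone leave systems outside the list, lines have \<open>N j < 2\<close>, so that
  curve is the only contribution, and the virtual dimension bounds \<open>e\<close> or \<open>m0\<close>.
\<close>

theorem special_imp_listed:
  assumes g: "good n B p" and B: "d \<le> B"
    and special: "minus_one_special n p (quasi_homogeneous d m0 4)"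
  shows "listed (int d) (int m0) (int n)"
proof -
  let ?L = "quasi_homogeneous d m0 4"
  obtain r A N where H: "(\<forall>j<r. minus_one_curve n p (A j)) \<and>
        (\<forall>i<r. \<forall>j<r. i \<noteq> j \<longrightarrow> disjoint_curves n p (A i) (A j)) \<and>
        (\<forall>j<r. intersection_number n ?L (curve_data p (A j)) = - N j \<and> N j \<ge> 1) \<and>
        (\<exists>j<r. N j \<ge> 2) \<and> fst (residual p ?L r N A) \<ge> 0 \<and> (\<forall>i\<le>n. snd (residual p ?L r N A) i \<ge> 0) \<and>
        virtual_dim n (residual p ?L r N A) \<ge> 0 \<and>
        (\<forall>j<r. intersection_number n (residual p ?L r N A) (curve_data p (A j)) \<ge> 0)"
    using special unfolding minus_one_special_def Let_def by (elim exE)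
  have A: "\<And>j. j < r \<Longrightarrow> minus_one_curve n p (A j)"
    and disj: "\<And>i j. i < r \<Longrightarrow> j < r \<Longrightarrow> i \<noteq> j \<Longrightarrow> disjoint_curves n p (A i) (A j)"
    and N: "\<And>j. j < r \<Longrightarrow> intersection_number n ?L (curve_data p (A j)) = - N j" "\<And>j. j < r \<Longrightarrow> N j \<ge> 1"
    and ex2: "\<exists>j<r. N j \<ge> 2"
    and M: "fst (residual p ?L r N A) \<ge> 0" "\<And>i. i \<le> n \<Longrightarrow> snd (residual p ?L r N A) i \<ge> 0"
      "virtual_dim n (residual p ?L r N A) \<ge> 0"
    using H by simp_all
  let ?c = "\<lambda>j. curve_data p (A j)"
  have L: "effective n p ?L"
  proof (rule effective_from_residual[OF g])
    show "curve (A j)" if "j < r" for j by (rule minus_one_curve_numerics(1)[OF A[OF that]])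
    show "0 \<le> N j" if "j < r" for j using N(2)[OF that] by simp
    show "effective n p (residual p ?L r N A)" by (rule exists_section[OF g M])
  qed
  have bound: "N j * snd (?c j) i \<le> snd ?L i" if "j < r" "i \<le> n" for i j
  proof -
    have "N j * snd (?c j) i \<le> (\<Sum>j<r. N j * snd (?c j) i)"
    proof (rule member_le_sum)
      show "0 \<le> N j * snd (?c j) i" if "j \<in> {..<r} - {k}" for j k
        using N(2)[of j] that by simp
    qed (use that in simp_all)
    then show ?thesis using M(2)[OF that(2)] by (simp add: residual_def)
  qed
  have bound4: "N j * snd (?c j) i \<le> 4" if "j < r" "i \<in> {1..n}" for i j
    using bound[OF that(1), of i] that(2) by simp
  have part: "int m0 - N j * snd (?c j) 0 \<le> int d - N j * fst (?c j)" if "j < r" for j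
  proof -
    note num = minus_one_curve_numerics[OF A[OF that]]
    have k: "int (nat (N j)) = N j" using N(2)[OF that] by simp
    have "effective n p (minus_mult ?L (int (nat (N j))) (?c j))"
    proof (rule subtractable_iterate[OF subtractable_curve[OF g num(1)] _ num(2) L])
      show "intersection_number n ?L (?c j) \<le> - int (nat (N j))" unfolding k using N(1)[OF that] by simp
    qed (use B in simp_all)
    from effective_mult_le[OF this, of 0] show ?thesis unfolding k by simp
  qed
  define S where "S = {j. j < r \<and> 2 \<le> N j}"
  have S: "finite S" "S \<noteq> {}" using ex2 by (auto simp: S_def)
  have "(\<Sum>j<r. N j * (N j - 1)) = (\<Sum>j\<in>S. N j * (N j - 1))"
  proof (rule sum.mono_neutral_right)
    show "\<forall>j\<in>{..<r} - S. N j * (N j - 1) = 0"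
    proof
      fix j assume "j \<in> {..<r} - S"
      then have "j < r" "\<not> 2 \<le> N j" by (simp_all add: S_def)
      then have "N j = 1" using N(2)[of j] by linarith
      then show "N j * (N j - 1) = 0" by simp
    qed
  qed (auto simp: S_def)
  then have v: "0 \<le> int d * (int d + 3) - int m0 * (int m0 + 1) - 20 * int n + (\<Sum>j\<in>S. N j * (N j - 1))"
  proof -
    have "2 * virtual_dim n (residual p ?L r N A) = 2 * virtual_dim n ?L + (\<Sum>j<r. N j * (N j - 1))"
      by (rule virtual_dim_residual) (erule A, erule (2) disj, erule N(1))
    then show ?thesis using M(3) virtual_dim_quasi_homogeneous[of n d m0]
        \<open>(\<Sum>j<r. N j * (N j - 1)) = (\<Sum>j\<in>S. N j * (N j - 1))\<close> by linarith
  qed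
  have classes: "(\<exists>t. line_class n t (?c j)) \<or>
    (\<exists>e. constant_class n e (e - 1) 1 (?c j) \<and> int n = 2 * e) \<or>
    (constant_class n 2 0 1 (?c j) \<and> n = 5) \<or> (constant_class n 6 3 2 (?c j) \<and> n = 7) \<or>
    (d = 6 \<and> m0 = 0 \<and> n = 3)" if "j \<in> S" for j
  proof -
    have j: "j < r" "2 \<le> N j" using that by (simp_all add: S_def)
    show ?thesis by (rule very_negative_curve_classes[OF g B L A[OF j(1)] N(1)[OF j(1)] j(2) bound4[OF j(1)]])
  qed
  have different: "\<not> (fst (?c i) = fst (?c j) \<and> (\<forall>k\<le>n. snd (?c i) k = snd (?c j) k))"
    if "i < r" "j < r" "i \<noteq> j" for i j
  proof
    assume "fst (?c i) = fst (?c j) \<and> (\<forall>k\<le>n. snd (?c i) k = snd (?c j) k)"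
    then have "intersection_number n (?c i) (?c j) = intersection_number n (?c i) (?c i)"
      by (intro intersection_cong) auto
    then show False using disj[OF that] minus_one_curve_numerics(2)[OF A[OF that(1)]]
      by (simp add: disjoint_curves_def)
  qed
  have constant_eq: "i = j" if "i \<in> S" "j \<in> S" "constant_class n x y a (?c i)" "constant_class n x y a (?c j)" for i j x y a
  proof (rule ccontr)
    assume "i \<noteq> j"
    moreover have "snd (?c i) k = snd (?c j) k" if "k \<le> n" for k
      using that \<open>constant_class n x y a (?c i)\<close> \<open>constant_class n x y a (?c j)\<close>
      by (cases "k = 0") (auto simp: constant_class_def)
    ultimately show False using different[of i j] that by (auto simp: S_def constant_class_def)
  qed
  have m0d: "int m0 \<le> int d" using effective_mult_le[OF L, of 0] by simp
  have lineN: "N j = 4 - (int d - int m0)" "t \<in> {1..n}" if "j \<in> S" "line_class n t (?c j)" for j t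
  proof -
    show t: "t \<in> {1..n}" using that by (simp add: line_class_def)
    have "(\<Sum>i=1..n. snd (?c j) i) = snd (?c j) t + (int n - 1) * 0"
      by (rule sum_odd_one_out[OF t]) (use that in \<open>auto simp: line_class_def\<close>)
    then show "N j = 4 - (int d - int m0)"
      using N(1)[of j] that unfolding intersection_quasi_homogeneous by (simp add: line_class_def S_def)
  qed
  have constN: "int d * x - int m0 * y - 4 * (int n * a) = - N j" if "j \<in> S" "constant_class n x y a (?c j)" for j x y a
    using N(1)[of j] that unfolding intersection_quasi_homogeneous by (simp add: constant_class_def S_def)
  show ?thesis
  proof (cases "d = 6 \<and> m0 = 0 \<and> n = 3")
    case True then show ?thesis by (simp add: listed_def)
  next
    case nexc: False
    consider (lines) "\<forall>j\<in>S. \<exists>t. line_class n t (?c j)"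
      | (rational) j e where "j \<in> S" "constant_class n e (e - 1) 1 (?c j)" "int n = 2 * e"
      | (conic) j where "j \<in> S" "constant_class n 2 0 1 (?c j)" "n = 5"
      | (sextic) j where "j \<in> S" "constant_class n 6 3 2 (?c j)" "n = 7"
      using classes nexc by blast
    then show ?thesis
    proof cases
      case lines
      from bchoice[OF this] obtain t where "\<forall>j\<in>S. line_class n (t j) (?c j)" ..
      then have t: "line_class n (t j) (?c j)" if "j \<in> S" for j using that by simp
      have "inj_on t S"
      proof (rule inj_onI, rule ccontr)
        fix i j assume ij: "i \<in> S" "j \<in> S" "t i = t j" "i \<noteq> j"
        have "snd (?c i) k = snd (?c j) k" if "k \<le> n" for k
          using t[OF ij(1)] t[OF ij(2)] ij(3) that
          by (cases "k = 0"; cases "k = t i") (auto simp: line_class_def)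
        then show False using different[of i j] ij t[OF ij(1)] t[OF ij(2)] by (auto simp: S_def line_class_def)
      qed
      moreover have "t ` S \<subseteq> {1..n}" using lineN(2) t by blast
      ultimately have "card S \<le> card {1..n}" by (intro card_inj_on_le) auto
      then have card: "int (card S) \<le> int n" by simp
      define k where "k = int d - int m0"
      obtain j where j: "j \<in> S" using S by blast
      have n1: "1 \<le> n" using lineN(2)[OF j t[OF j]] by simp
      have k: "0 \<le> k" "k \<le> 2" using m0d lineN(1)[OF j t[OF j]] j by (auto simp: k_def S_def)
      have "(\<Sum>j\<in>S. N j * (N j - 1)) = (\<Sum>j\<in>S. (4 - k) * (3 - k))"
      proof (rule sum.cong[OF refl])
        fix j assume "j \<in> S"
        then have "N j = 4 - k" using lineN(1)[OF _ t] by (simp add: k_def)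
        then show "N j * (N j - 1) = (4 - k) * (3 - k)" by simp
      qed
      also have "\<dots> = int (card S) * ((4 - k) * (3 - k))" by simp
      also have "\<dots> \<le> int n * ((4 - k) * (3 - k))" using card k by (intro mult_right_mono) auto
      finally have v': "0 \<le> int d * (int d + 3) - int m0 * (int m0 + 1) - 20 * int n + int n * ((4 - k) * (3 - k))"
        using v by linarith
      have m: "int m0 = int d - k" by (simp add: k_def)
      have n1': "1 \<le> int n" using n1 by simp
      consider "k = 0" | "k = 1" | "k = 2" using k by linarith
      then show ?thesis
      proof cases
        case 1
        have "4 * int n \<le> int d" using v' unfolding m 1 by (simp add: algebra_simps)
        then show ?thesis using n1' m 1 unfolding listed_def by (intro disjI1 conjI) simp_all
      next
        case 2
        have "7 * int n \<le> 2 * int d" using v' unfolding m 2 by (simp add: algebra_simps)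
        moreover have "int m0 = int d - 1" using m 2 by simp
        ultimately show ?thesis unfolding listed_def
          by (intro disjI1[OF conjI[OF n1']] disjI2[OF disjI1[OF conjI]])
      next
        case 3
        have "6 * int n + 2 - 1 \<le> 2 * int d" using v' unfolding m 3 by (simp add: algebra_simps)
        then have "3 * int n + 1 \<le> int d" by linarith
        moreover have "int m0 = int d - 2" using m 3 by simp
        ultimately show ?thesis unfolding listed_def
          by (intro disjI1[OF conjI[OF n1']] disjI2[OF disjI2[OF conjI]])
      qed
    next
      case (rational j e)
      have jr: "j < r" "2 \<le> N j" using rational(1) by (simp_all add: S_def)
      have "fst (?c j) = e" using rational(2) by (simp add: constant_class_def)
      then have e1: "1 \<le> e" using curve_degree_pos[OF minus_one_curve_numerics(1)[OF A[OF jr(1)]]] by simp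
      then have n: "1 \<in> {1..n}" using rational(3) by simp
      have "snd (?c j) 1 = 1" using rational(2) n unfolding constant_class_def by blast
      then have "N j \<le> 4" using bound4[OF jr(1) n] by simp
      then have N4: "N j \<in> {2, 3, 4}" using jr(2) by (simp; presburger)
      have eq: "int d * e - int m0 * (e - 1) - 8 * e = - N j" using constN[OF rational(1,2)] rational(3) by simp
      have res: "0 \<le> int m0 - N j * (e - 1)" "int m0 - N j * (e - 1) \<le> int d - N j * e"
        using bound[OF jr(1), of 0] part[OF jr(1)] rational(2) unfolding constant_class_def by simp_all
      \<comment> \<open>lines have \<open>N i = 4 - (d - m0) < 0\<close>, and the other types need odd \<open>n\<close>\<close>
      have single: "S = {j}" if "5 \<le> int d - int m0"
      proof -
        have "i = j" if i: "i \<in> S" for i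
        proof -
          have nl: "\<not> line_class n t (?c i)" for t
            using lineN(1)[OF i, of t] \<open>5 \<le> int d - int m0\<close> i by (auto simp: S_def)
          have "n \<noteq> 5" "n \<noteq> 7" "n \<noteq> 3" using rational(3) by presburger+
          with classes[OF i] nl have "\<exists>e. constant_class n e (e - 1) 1 (?c i) \<and> int n = 2 * e" by simp
          then obtain e' where e': "constant_class n e' (e' - 1) 1 (?c i)" "int n = 2 * e'" by (elim exE conjE)
          have "e' = e" using e'(2) rational(3) by simp
          then show ?thesis using constant_eq[OF i rational(1)] rational(2) e'(1) by simp
        qed
        then show ?thesis using rational(1) by blast
      qed
      have vs: "0 \<le> int d * (int d + 3) - int m0 * (int m0 + 1) - 40 * e + N j * (N j - 1)" if "5 \<le> int d - int m0"
        using v unfolding single[OF that] rational(3) by simp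
      from rational_curve_bounds[OF e1 N4 eq res] show ?thesis
      proof (elim disjE conjE)
        assume "(int d, int m0) \<in> {(6 * e, 6 * e - 2), (5 * e, 5 * e - 3), (5 * e + 1, 5 * e - 2),
         (4 * e, 4 * e - 4), (4 * e + 1, 4 * e - 3), (4 * e + 2, 4 * e - 2)}"
        then show ?thesis using rational(3) e1 unfolding listed_def
          by (intro disjI2 disjI1 exI[of _ e] conjI)
      next
        assume h: "N j = 2" "int d = 3 * e + 3" "int m0 = 3 * e - 2"
        have "5 \<le> int d - int m0" unfolding h by simp
        from vs[OF this] have "e \<le> 4" unfolding h by (simp add: algebra_simps)
        then have "e = 1 \<or> e = 2 \<or> e = 3 \<or> e = 4" using e1 by presburger
        then show ?thesis using h(2,3) rational(3) by (elim disjE) (simp_all add: listed_def)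
      next
        assume h: "N j = 3" "int d = 3 * e + 2" "int m0 = 3 * e - 3"
        have "5 \<le> int d - int m0" unfolding h by simp
        from vs[OF this] have "e \<le> 2" unfolding h by (simp add: algebra_simps)
        then have "e = 1 \<or> e = 2" using e1 by presburger
        then show ?thesis using h(2,3) rational(3) by (elim disjE) (simp_all add: listed_def)
      next
        assume h: "N j = 2" "int d = 2 * e + 4" "int m0 = 2 * e - 2"
        have "5 \<le> int d - int m0" unfolding h by simp
        from vs[OF this] have "e \<le> 2" unfolding h by (simp add: algebra_simps)
        then have "e = 1 \<or> e = 2" using e1 by presburger
        then show ?thesis using h(2,3) rational(3) by (elim disjE) (simp_all add: listed_def)
      qed
    next
      case (conic j)
      have jr: "j < r" "2 \<le> N j" using conic by (auto simp: S_def)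
      have eq: "2 * int d - 20 = - N j" using constN[OF conic(1,2)] conic(3) by simp
      have N4: "N j \<le> 4" using bound4[OF jr(1), of 1] conic by (simp add: constant_class_def)
      have m5: "int m0 \<le> int d - 2 * N j" using part[OF jr(1)] conic(2) by (simp add: constant_class_def mult.commute)
      have "d = 8 \<and> N j = 4 \<or> d = 9 \<and> N j = 2" using eq N4 jr(2) by presburger
      then show ?thesis
      proof (elim disjE conjE)
        assume "d = 8" "N j = 4"
        then show ?thesis using m5 conic(3) by (auto simp: listed_def)
      next
        assume d9: "d = 9" "N j = 2"
        have "i = j" if i: "i \<in> S" for i
        proof -
          have nl: "\<not> line_class n t (?c i)" for t
            using lineN(1)[OF i, of t] d9 m5 i by (auto simp: S_def)
          have "int n \<noteq> 2 * e" for e using conic(3) by presburger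
          with classes[OF i] nl conic(3) have "constant_class n 2 0 1 (?c i)" by simp
          then show ?thesis using constant_eq[OF i conic(1)] conic by auto
        qed
        then have "S = {j}" using conic(1) by blast
        then have "0 \<le> 10 - int m0 * (int m0 + 1)" using v d9 conic(3) by simp
        moreover have "3 * 4 \<le> int m0 * (int m0 + 1)" if "3 \<le> int m0" using that by (intro mult_mono) auto
        ultimately have "\<not> 3 \<le> int m0" by linarith
        then have "m0 = 0 \<or> m0 = 1 \<or> m0 = 2" by linarith
        then show ?thesis using d9 conic(3) by (elim disjE) (simp_all add: listed_def)
      qed
    next
      case (sextic j)
      have jr: "j < r" "2 \<le> N j" using sextic by (auto simp: S_def)
      have N4: "N j = 2" using bound4[OF jr(1), of 1] sextic jr by (auto simp: constant_class_def)
      have eq: "6 * int d - 3 * int m0 - 56 = - 2" using constN[OF sextic(1,2)] sextic(3) N4 by simp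
      have m6: "6 \<le> int m0" "int m0 - 6 \<le> int d - 12"
        using part[OF jr(1)] bound[OF jr(1), of 0] sextic(2) N4 by (simp_all add: constant_class_def)
      have "d = 12" "m0 = 6" using eq m6 by linarith+
      then show ?thesis using sextic(3) by (simp add: listed_def)
    qed
  qed
qed

section \<open>Points in special position carrying no rational curve\<close>

lemma eval3_form:
  assumes "form D F"
  shows "eval3 F x = (\<Sum>(a, b)\<in>triangle D. coeff3 F a b (D - a - b) * (x $ 1) ^ a * (x $ 2) ^ b * (x $ 3) ^ (D - a - b))"
proof -
  have "eval3 F x = eval3 (\<Sum>(a, b)\<in>triangle D. monom3 a b (D - a - b) (coeff3 F a b (D - a - b))) x"
    using form_sum_monom3[OF assms] by (rule arg_cong)
  then show ?thesis by (simp add: eval3_sum eval3_monom3 case_prod_unfold)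
qed

lemma many_roots_zero:
  fixes c :: "nat \<Rightarrow> complex"
  assumes "card S = Suc m" "\<And>i. i \<in> S \<Longrightarrow> (\<Sum>b\<le>m. c b * of_nat i ^ b) = 0" "b \<le> m"
  shows "c b = 0"
proof -
  define P where "P = (\<Sum>b\<le>m. monom (c b) b)"
  have deg: "degree P \<le> m"
    unfolding P_def by (intro degree_sum_le) (auto intro: order_trans[OF degree_monom_le])
  have "P = 0"
  proof (rule ccontr)
    assume P: "P \<noteq> 0"
    have "of_nat ` S \<subseteq> {x. poly P x = 0}"
      using assms(2) by (auto simp: P_def poly_sum poly_monom)
    then have "card (of_nat ` S :: complex set) \<le> card {x. poly P x = 0}"
      by (intro card_mono poly_roots_finite P)
    moreover have "card (of_nat ` S :: complex set) = Suc m"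
      using assms(1) by (subst card_image) (auto simp: inj_on_def)
    ultimately show False using card_poly_roots_bound[OF P] deg by linarith
  qed
  have "coeff P b = (\<Sum>k\<le>m. if k = b then c b else 0)"
    unfolding P_def coeff_sum by (rule sum.cong) auto
  then show ?thesis using \<open>P = 0\<close> assms(3) by simp
qed

lemma vanishing_at_vertex_coeff:
  assumes F: "form D F" "mult_ge F x (D - 1)" and x: "x $ 1 = 1" "x $ 2 = 0" "x $ 3 = 0"
    and a: "2 \<le> a" "a + b + c = D"
  shows "coeff3 F a b c = 0"
proof -
  let ?G = "deriv3 0 b c F"
  have fG: "form a ?G" using form_deriv3[OF F(1), of 0 b c] a by (simp add: algebra_simps flip: a(2))
  have "eval3 ?G x = (\<Sum>t\<in>triangle a. if t = (a, 0) then coeff3 ?G a 0 0 else 0)"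
    unfolding eval3_form[OF fG]
  proof (rule sum.cong[OF refl])
    fix t assume "t \<in> triangle a"
    then show "(case t of (i, j) \<Rightarrow> coeff3 ?G i j (a - i - j) * (x $ 1) ^ i * (x $ 2) ^ j * (x $ 3) ^ (a - i - j))
      = (if t = (a, 0) then coeff3 ?G a 0 0 else 0)"
      by (cases t) (auto simp: x triangle_def power_0_left)
  qed
  also have "\<dots> = coeff3 ?G a 0 0"
  proof -
    have "(a, 0) \<in> triangle a" by (simp add: triangle_def)
    then show ?thesis by (simp only: sum.delta finite_triangle if_True)
  qed
  finally have "coeff3 ?G a 0 0 = 0" using F(2) a by (simp add: mult_ge_def)
  then show ?thesis using pochhammer_Suc_neq_0[of 0 b] pochhammer_Suc_neq_0[of 0 c] by (simp add: coeff3_deriv3)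
qed

text \<open>
  The class of the rational curves of degree \<open>x\<close> with a point of multiplicity \<open>x - 1\<close> at \<open>p i0\<close> and simple points on \<open>S\<close>.
  For \<open>x = 1\<close> nothing is required at \<open>p i0\<close>, and \<open>i0\<close> may then be an index beyond \<open>n\<close>.
\<close>

definition rational_mult :: "nat \<Rightarrow> nat set \<Rightarrow> nat \<Rightarrow> nat \<Rightarrow> nat" where
  "rational_mult i0 S x i = (if i = i0 then x - 1 else if i \<in> S then 1 else 0)"

text \<open>
  Put \<open>p i0\<close> at \<open>(1, 0, 0)\<close>. Then the form is \<open>X * f (Y, Z) + g (Y, Z)\<close> with \<open>f\<close>, \<open>g\<close> of degrees \<open>x - 1\<close>, \<open>x\<close>. With \<open>x + 1\<close> of
  the simple points on the line \<open>X = 0\<close> and \<open>x\<close> of them on \<open>X = Z\<close>, first \<open>g\<close> and then \<open>f\<close> has too many zeros.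
\<close>

lemma no_rational_section:
  assumes S: "S \<subseteq> {..n}" "i0 \<notin> S" "card S = 2 * x + 1" and x: "1 \<le> x" "i0 \<le> n \<or> x = 1"
  shows "\<exists>q\<in>point_tuples n. \<not> has_section n q x (rational_mult i0 S x)"
proof -
  have finS: "finite S" using S(1) finite_subset by blast
  obtain S1 where S1: "S1 \<subseteq> S" "card S1 = Suc x" using obtain_subset_with_card_n[of "Suc x" S] S(3) x(1) by force
  define S2 where "S2 = S - S1"
  have S2: "card S2 = x" using S1 S(3) finS by (simp add: S2_def card_Diff_subset finite_subset)
  define q :: "nat \<Rightarrow> complex ^ 3" where
    "q i = vector [if i \<in> S1 then 0 else 1, if i \<in> S then of_nat i else 0, if i \<in> S then 1 else 0]" for i
  have q: "q i $ 1 = (if i \<in> S1 then 0 else 1)" "q i $ 2 = (if i \<in> S then of_nat i else 0)"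
    "q i $ 3 = (if i \<in> S then 1 else 0)" for i
    by (simp_all add: q_def)
  have "q i \<noteq> 0" for i
  proof
    assume "q i = 0"
    then have "q i $ 1 = 0" "q i $ 3 = 0" by simp_all
    then show False using S1(1) by (auto simp: q split: if_splits)
  qed
  then have "q \<in> point_tuples n" by (simp add: point_tuples_def)
  moreover have "\<not> has_section n q x (rational_mult i0 S x)"
  proof
    assume "has_section n q x (rational_mult i0 S x)"
    then obtain F where F: "F \<noteq> 0" "form x F" "\<And>i. i \<le> n \<Longrightarrow> mult_ge F (q i) (rational_mult i0 S x i)"
      unfolding has_section_def by blast
    have high: "coeff3 F a b c = 0" if "2 \<le> a" for a b c
    proof (cases "a + b + c = x")
      case True
      then have "i0 \<le> n" using x(2) that by auto
      moreover have "q i0 $ 1 = 1" "q i0 $ 2 = 0" "q i0 $ 3 = 0" using S(2) S1(1) by (auto simp: q)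
      ultimately show ?thesis
        using vanishing_at_vertex_coeff[OF F(2) _ _ _ _ that True, of "q i0"] F(3)[of i0] by (simp add: rational_mult_def)
    next
      case False
      then show ?thesis using F(2) unfolding form_def by blast
    qed
    let ?c0 = "\<lambda>b. coeff3 F 0 b (x - b)" and ?c1 = "\<lambda>b. coeff3 F 1 b (x - 1 - b)"
    have ev: "eval3 F (q i) = (\<Sum>b\<le>x. ?c0 b * of_nat i ^ b) + (if i \<in> S1 then 0 else \<Sum>b\<le>x - 1. ?c1 b * of_nat i ^ b)"
      if "i \<in> S" for i
    proof -
      let ?t = "\<lambda>a b. coeff3 F a b (x - a - b) * (q i $ 1) ^ a * of_nat i ^ b"
      have "eval3 F (q i) = (\<Sum>(a, b)\<in>triangle x. ?t a b)"
        unfolding eval3_form[OF F(2)] using that by (simp add: q)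
      also have "\<dots> = (\<Sum>(a, b)\<in>({0} \<times> {..x}) \<union> ({1} \<times> {..x - 1}). ?t a b)"
      proof (rule sum.mono_neutral_right)
        show "{0} \<times> {..x} \<union> {1} \<times> {..x - 1} \<subseteq> triangle x" using x(1) by (auto simp: triangle_def)
        show "\<forall>t\<in>triangle x - ({0} \<times> {..x} \<union> {1} \<times> {..x - 1}). (case t of (a, b) \<Rightarrow> ?t a b) = 0"
        proof
          fix t assume t: "t \<in> triangle x - ({0} \<times> {..x} \<union> {1} \<times> {..x - 1})"
          obtain a b where ab: "t = (a, b)" by force
          then have "2 \<le> a" using t by (cases a; cases "a - 1") (auto simp: triangle_def)
          then show "(case t of (a, b) \<Rightarrow> ?t a b) = 0" by (simp add: ab high)
        qed
      qed simp
      also have "\<dots> = (\<Sum>(a, b)\<in>{0} \<times> {..x}. ?t a b) + (\<Sum>(a, b)\<in>{1} \<times> {..x - 1}. ?t a b)"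
        by (rule sum.union_disjoint) auto
      also have "(\<Sum>(a, b)\<in>{0} \<times> {..x}. ?t a b) = (\<Sum>b\<le>x. ?c0 b * of_nat i ^ b)"
        by (subst sum.cartesian_product[symmetric]) simp
      also have "(\<Sum>(a, b)\<in>{1} \<times> {..x - 1}. ?t a b) = (if i \<in> S1 then 0 else \<Sum>b\<le>x - 1. ?c1 b * of_nat i ^ b)"
        by (subst sum.cartesian_product[symmetric]) (simp add: q)
      finally show ?thesis .
    qed
    have zero: "eval3 F (q i) = 0" if "i \<in> S" for i
    proof -
      have "i \<le> n" "i \<noteq> i0" using that S(1,2) by auto
      then have "mult_ge F (q i) 1" using F(3)[of i] that by (simp add: rational_mult_def)
      then have "eval3 (deriv3 0 0 0 F) (q i) = 0" unfolding mult_ge_def by simp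
      then show ?thesis by simp
    qed
    have c0: "?c0 b = 0" if "b \<le> x" for b
    proof (rule many_roots_zero[OF S1(2) _ that])
      fix i assume "i \<in> S1"
      then show "(\<Sum>b\<le>x. ?c0 b * of_nat i ^ b) = 0" using ev[of i] zero[of i] S1(1) by auto
    qed
    have c1: "?c1 b = 0" if "b \<le> x - 1" for b
    proof (rule many_roots_zero[OF _ _ that])
      show "card S2 = Suc (x - 1)" using S2 x(1) by simp
      fix i assume i: "i \<in> S2"
      have "(\<Sum>b\<le>x. ?c0 b * of_nat i ^ b) = 0" using c0 by (intro sum.neutral) auto
      then show "(\<Sum>b\<le>x - 1. ?c1 b * of_nat i ^ b) = 0" using ev[of i] zero[of i] i by (auto simp: S2_def)
    qed
    have "F = 0"
    proof (rule form_eq_0[OF F(2)])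
      fix a b assume ab: "(a, b) \<in> triangle x"
      consider "a = 0" | "a = 1" | "2 \<le> a" by linarith
      then show "coeff3 F a b (x - a - b) = 0"
        using c0[of b] c1[of b] high ab by cases (auto simp: triangle_def)
    qed
    then show False using F(1) by simp
  qed
  ultimately show ?thesis by blast
qed

section \<open>Curves through points in general position\<close>

text \<open>
  For \<open>x = 1\<close> and \<open>i0 > n\<close>: no three points lie on a line.
\<close>

lemma few_simple_points:
  assumes g: "good n B p" and F: "F \<noteq> 0" "form x F" and x: "1 \<le> x" "x \<le> B" "i0 \<le> n \<or> x = 1"
    and m: "i0 \<le> n \<Longrightarrow> x - 1 \<le> multiplicity_at F (p i0)"
  shows "card {i. i \<le> n \<and> i \<noteq> i0 \<and> 1 \<le> multiplicity_at F (p i)} \<le> 2 * x"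
proof (rule ccontr)
  let ?T = "{i. i \<le> n \<and> i \<noteq> i0 \<and> 1 \<le> multiplicity_at F (p i)}"
  assume "\<not> ?thesis"
  then obtain S where S: "S \<subseteq> ?T" "card S = 2 * x + 1"
    using obtain_subset_with_card_n[of "2 * x + 1" ?T] by force
  have "has_section n p x (rational_mult i0 S x)"
    unfolding has_section_def
  proof (intro exI[of _ F] conjI allI impI F)
    fix i assume "i \<le> n"
    then show "mult_ge F (p i) (rational_mult i0 S x i)"
      using S(1) m unfolding mult_ge_iff[OF F] rational_mult_def by auto
  qed
  moreover obtain q where "q \<in> point_tuples n" "\<not> has_section n q x (rational_mult i0 S x)"
    using no_rational_section[of S n i0 x] S x by auto
  ultimately show False using goodD(3)[OF g x(2)] by blast
qed

text \<open>
  A curve of degree greater than that of \<open>E\<close> is not a component of a curve of class \<open>E\<close>.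
\<close>

lemma nonnegative_intersection_degree:
  assumes g: "good n B p" and b: "curve b" and E: "effective n p E" "fst E \<le> int B" "fst E < int (total_degree b)"
  shows "0 \<le> intersection_number n E (curve_data p b)"
proof (rule ccontr)
  assume "\<not> ?thesis"
  then have "effective n p (minus_mult E 1 (curve_data p b))"
    using subtractableD[OF subtractable_curve[OF g b] E(2,1)] by simp
  then show False using effective_degree[of n p "minus_mult E 1 (curve_data p b)"] E(3) by simp
qed

text \<open>
  Intersect with the line through the two points.
\<close>

lemma two_multiplicities_le_degree:
  assumes g: "good n B p" and b: "curve b" "2 \<le> total_degree b" and B: "1 \<le> B" and ij: "i \<le> n" "j \<le> n" "i \<noteq> j"
  shows "multiplicity_at b (p i) + multiplicity_at b (p j) \<le> total_degree b"
proof -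
  let ?E = "(1, \<lambda>k. if k = i then 1 else if k = j then 1 else 0) :: system"
  have two: "(\<Sum>k\<le>n. if k = i then f i else if k = j then f j else 0) = f i + f j" for f :: "nat \<Rightarrow> int"
  proof -
    have "(\<Sum>k\<le>n. if k = i then f i else if k = j then f j else 0)
        = (\<Sum>k\<le>n. (if k = i then f i else 0) + (if k = j then f j else 0))"
      using ij by (intro sum.cong) auto
    then show ?thesis using ij by (simp add: sum.distrib)
  qed
  have "(\<Sum>k\<le>n. snd ?E k * (snd ?E k + 1)) = (\<Sum>k\<le>n. if k = i then 2 else if k = j then 2 else 0)"
    by (rule sum.cong) auto
  then have "2 * virtual_dim n ?E = 0" using two[of "\<lambda>_. 2"] by (simp add: virtual_dim_twice)
  then have "effective n p ?E" by (intro exists_section[OF g]) auto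
  then have "0 \<le> intersection_number n ?E (curve_data p b)"
    using b B by (intro nonnegative_intersection_degree[OF g b(1)]) auto
  moreover have "(\<Sum>k\<le>n. snd ?E k * int (multiplicity_at b (p k))) = int (multiplicity_at b (p i)) + int (multiplicity_at b (p j))"
    using two[of "\<lambda>k. int (multiplicity_at b (p k))"] by (subst two[symmetric]) (rule sum.cong, auto)
  ultimately show ?thesis by (simp add: intersection_number_alt)
qed

lemma negative_factor:
  assumes g: "good n B p" and F: "F \<noteq> 0" "form x F" "intersection_number n w (curve_data p F) < 0"
  shows "\<exists>b H. curve b \<and> F = b * H \<and> intersection_number n w (curve_data p b) < 0"
  using F
proof (induction x arbitrary: F rule: less_induct)
  case (less x)
  have F: "homogeneous F" "total_degree F = x" using form_homogeneous less.prems by auto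
  show ?case
  proof (cases "irreducible F")
    case True
    then show ?thesis using F less.prems(3) by (intro exI[of _ F] exI[of _ 1]) (simp add: curve_def)
  next
    case False
    have "\<not> F dvd 1"
    proof
      assume "F dvd 1"
      then obtain G where FG: "F * G = 1" by (metis dvdE)
      then obtain e where e: "form e G" using form_factor[of 0 G F] form_1 by (auto simp: mult.commute)
      have "G \<noteq> 0" using FG by auto
      have "form (x + e) 1" using form_mult[OF less.prems(2) e] FG by simp
      then have "x = 0" using form_unique_degree[OF _ _ form_1, of "x + e"] by simp
      then have "multiplicity_at F (p i) = 0" for i
        using multiplicity_le_degree[OF less.prems(1,2)] by simp
      then show False using less.prems(3) F \<open>x = 0\<close> by (simp add: intersection_number_alt)
    qed
    then obtain G H where GH: "F = G * H" "\<not> G dvd 1" "\<not> H dvd 1"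
      using False less.prems(1) by (auto simp: irreducible_def)
    obtain y where y: "form y G" using form_factor[of x G H] less.prems GH(1) by auto
    obtain z where z: "form z H" using form_factor[of x H G] less.prems GH(1) by (auto simp: mult.commute)
    have nz: "G \<noteq> 0" "H \<noteq> 0" using GH(1) less.prems(1) by auto
    have yz: "0 < y" "0 < z" using form0_unit nz y z GH(2,3) by (auto intro: gr0I)
    have x: "x = y + z" using form_unique_degree[OF less.prems(1,2)] form_mult[OF y z] GH(1) by simp
    have tot: "total_degree G = y" "total_degree H = z" using form_homogeneous nz y z by auto
    have "multiplicity_at F (p i) = multiplicity_at G (p i) + multiplicity_at H (p i)" if "i \<le> n" for i
      using multiplicity_mult[OF nz(1) y nz(2) z goodD(1)[OF g that]] GH(1) by simp
    then have "(\<Sum>i\<le>n. snd w i * int (multiplicity_at F (p i)))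
        = (\<Sum>i\<le>n. snd w i * int (multiplicity_at G (p i))) + (\<Sum>i\<le>n. snd w i * int (multiplicity_at H (p i)))"
      unfolding sum.distrib[symmetric] by (intro sum.cong) (auto simp: algebra_simps)
    then have "intersection_number n w (curve_data p F) = intersection_number n w (curve_data p G) + intersection_number n w (curve_data p H)"
      by (simp add: intersection_number_alt F tot x algebra_simps)
    then consider "intersection_number n w (curve_data p G) < 0" | "intersection_number n w (curve_data p H) < 0"
      using less.prems(3) by linarith
    then show ?thesis
    proof cases
      case 1
      then obtain b K where "curve b" "G = b * K" "intersection_number n w (curve_data p b) < 0"
        using less.IH[of y G] x yz nz y by auto
      then show ?thesis using GH(1) by (intro exI[of _ b] exI[of _ "K * H"]) (simp add: mult.assoc)
    next
      case 2
      then obtain b K where "curve b" "H = b * K" "intersection_number n w (curve_data p b) < 0"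
        using less.IH[of z H] x yz nz z by auto
      then show ?thesis using GH(1) by (intro exI[of _ b] exI[of _ "G * K"]) (simp add: mult_ac)
    qed
  qed
qed

text \<open>
  The actual multiplicities of a curve of class \<open>w\<close> are at least those of \<open>w\<close>, so \<open>w\<close> meets it negatively, and hence
  meets one of its components negatively. The last conjunct says that the residual curve cannot have a multiplicity
  exceeding its degree.
\<close>

lemma negative_component:
  assumes g: "good n B p" and w: "effective n p w" "intersection_number n w w < 0" "\<And>i. i \<le> n \<Longrightarrow> 0 \<le> snd w i"
  shows "\<exists>b. curve b \<and> intersection_number n w (curve_data p b) < 0 \<and> int (total_degree b) \<le> fst w \<and>
    (\<forall>i\<le>n. snd w i - int (multiplicity_at b (p i)) \<le> fst w - int (total_degree b))"
proof -
  define x where "x = nat (fst w)"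
  have x: "fst w = int x" using w(1) by (simp add: x_def effective_def)
  obtain F where F: "F \<noteq> 0" "form x F" "\<And>i. i \<le> n \<Longrightarrow> mult_ge F (p i) (nat (snd w i))"
    using w(1) unfolding effective_def has_section_def x_def by blast
  have m: "snd w i \<le> int (multiplicity_at F (p i))" if "i \<le> n" for i
    using F(3)[OF that] unfolding mult_ge_iff[OF F(1,2)] by (simp add: nat_le_iff)
  have "(\<Sum>i\<le>n. snd w i * snd w i) \<le> (\<Sum>i\<le>n. snd w i * int (multiplicity_at F (p i)))"
    using m w(3) by (intro sum_mono mult_left_mono) auto
  then have "intersection_number n w (curve_data p F) < 0"
    using w(2) form_homogeneous[OF F(1,2)] by (simp add: intersection_number_alt x)
  from negative_factor[OF g F(1,2) this] obtain b H where b: "curve b" "F = b * H" "intersection_number n w (curve_data p b) < 0"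
    by (elim exE conjE)
  note q = quotient_section[OF g b(1) F(1,2) b(2)]
  have "snd w i - int (multiplicity_at b (p i)) \<le> fst w - int (total_degree b)" if "i \<le> n" for i
    using m[OF that] q(4)[OF that] multiplicity_le_degree[OF q(1,3), of "p i"] q(2) by (simp add: x)
  then show ?thesis using b q(2) by (intro exI[of _ b]) (simp add: x)
qed

text \<open>
  The class \<open>w\<close> has virtual dimension \<open>0\<close> and self-intersection \<open>-1\<close>. Let \<open>b\<close>, of degree \<open>y\<close> with multiplicities \<open>\<beta>\<close>, be a
  component that \<open>w\<close> meets negatively. Since a curve of class \<open>w\<close> has multiplicity at least \<open>x - 1\<close> at \<open>p i0\<close>, the component
  has \<open>\<beta> i0 \<ge> y - 1\<close>. If it is not a cone over \<open>p i0\<close>, it has at most \<open>2 * y\<close> further points (\<open>few_simple_points\<close>), and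
  \<open>w \<cdot> b < 0\<close> gives at least \<open>x + y\<close> of them in \<open>S\<close>; therefore \<open>y = x\<close>, and these points are exactly \<open>S\<close>.
\<close>

theorem rational_curve:
  assumes g: "good n B p" and x: "1 \<le> x" "x \<le> B" "i0 \<le> n \<or> x = 1"
    and S: "S \<subseteq> {..n}" "i0 \<notin> S" "card S = 2 * x"
  shows "\<exists>b. curve b \<and> total_degree b = x \<and> (\<forall>i\<le>n. multiplicity_at b (p i) = rational_mult i0 S x i)"
proof -
  have finS: "finite S" using S(1) finite_subset by blast
  define w :: system where "w = (int x, \<lambda>i. int (rational_mult i0 S x i))"
  have sum_w: "(\<Sum>i\<le>n. snd w i * f i) = (int x - 1) * f i0 + (\<Sum>i\<in>S. f i)" for f
  proof -
    have "(\<Sum>i\<le>n. snd w i * f i) = (\<Sum>i\<le>n. (if i = i0 then (int x - 1) * f i0 else 0) + (if i \<in> S then f i else 0))"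
      using S(2) x(1) by (intro sum.cong) (auto simp: w_def rational_mult_def of_nat_diff)
    also have "\<dots> = (if i0 \<le> n then (int x - 1) * f i0 else 0) + (\<Sum>i\<in>{..n} \<inter> S. f i)"
      by (simp add: sum.distrib sum.inter_restrict)
    also have "{..n} \<inter> S = S" using S(1) by auto
    finally show ?thesis using x(3) by auto
  qed
  have wS: "(\<Sum>i\<in>S. snd w i) = 2 * int x"
  proof -
    have "(\<Sum>i\<in>S. snd w i) = (\<Sum>i\<in>S. 1)" using S(2) by (intro sum.cong) (auto simp: w_def rational_mult_def)
    then show ?thesis using S(3) by simp
  qed
  have w0: "snd w i0 = int x - 1" "fst w = int x" using x(1) by (simp_all add: w_def rational_mult_def of_nat_diff)
  have self: "intersection_number n w w = - 1"
    unfolding intersection_number_alt sum_w wS w0 by (simp add: algebra_simps)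
  have ww: "(\<Sum>i\<le>n. snd w i * (snd w i + 1)) = (int x - 1) * (int x - 1 + 1) + 4 * int x"
    unfolding sum_w[of "\<lambda>i. snd w i + 1"] using wS S(3) by (simp add: w0 sum.distrib)
  have "2 * virtual_dim n w = 0" unfolding virtual_dim_twice ww w0 by (simp add: algebra_simps)
  then have "effective n p w" by (intro exists_section[OF g]) (simp_all add: w_def)
  from negative_component[OF g this] obtain b where b: "curve b" "intersection_number n w (curve_data p b) < 0"
    "total_degree b \<le> x" "\<And>i. i \<le> n \<Longrightarrow> snd w i - int (multiplicity_at b (p i)) \<le> int x - int (total_degree b)"
    using self by (auto simp: w_def)
  define y where "y = total_degree b"
  define \<beta> where "\<beta> i = multiplicity_at b (p i)" for i
  have y: "1 \<le> y" "y \<le> x" using curve_degree_pos[OF b(1)] b(3) by (auto simp: y_def)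
  have by_deg: "\<beta> i \<le> y" for i unfolding \<beta>_def y_def by (rule curve_mult_le_degree[OF b(1)])
  have neg: "int x * int y - (int x - 1) * int (\<beta> i0) - (\<Sum>i\<in>S. int (\<beta> i)) < 0"
    using b(2) unfolding intersection_number_alt fst_curve_data snd_curve_data
      sum_w[of "\<lambda>i. int (\<beta> i)"] w0(2) y_def[symmetric] \<beta>_def[symmetric] by linarith
  have \<beta>0: "y - 1 \<le> \<beta> i0" if "i0 \<le> n"
    using b(4)[OF that] y by (simp add: w0 y_def \<beta>_def)
  have T: "card {i. i \<le> n \<and> i \<noteq> i0 \<and> 1 \<le> \<beta> i} \<le> 2 * y"
    using few_simple_points[OF g curveD(2,3)[OF b(1)], of i0] \<beta>0 y x by (auto simp: y_def \<beta>_def)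
  have pair: "\<beta> i + \<beta> j \<le> y" if "2 \<le> y" "i \<le> n" "j \<le> n" "i \<noteq> j" for i j
    using two_multiplicities_le_degree[OF g b(1)] that x unfolding y_def \<beta>_def by simp
  \<comment> \<open>a cone over \<open>p i0\<close> would be a line through \<open>p i0\<close> and at most one other point\<close>
  have not_cone: "\<not> (i0 \<le> n \<and> y \<le> \<beta> i0)" if x2: "2 \<le> x"
  proof
    assume c: "i0 \<le> n \<and> y \<le> \<beta> i0"
    then have c': "\<beta> i0 = y" using by_deg[of i0] by simp
    show False
    proof (cases "2 \<le> y")
      case True
      have "\<beta> t = 0" if "t \<in> S" for t
      proof -
        have "t \<le> n" "i0 \<noteq> t" using that S(1,2) by auto
        then show ?thesis using pair[OF True, of i0 t] c by simp
      qed
      then have "(\<Sum>i\<in>S. int (\<beta> i)) = 0" by simp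
      then show False using neg y by (simp add: c' algebra_simps)
    next
      case False
      then have y1: "y = 1" using y by simp
      let ?U = "{i. i \<le> n \<and> i \<noteq> Suc n \<and> 1 \<le> \<beta> i}" and ?V = "{t \<in> S. 1 \<le> \<beta> t}"
      have "card ?U \<le> 2"
        using few_simple_points[OF g curveD(2,3)[OF b(1)], of "Suc n"] y1 x by (simp add: y_def \<beta>_def)
      moreover have "insert i0 ?V \<subseteq> ?U" using S(1) c y1 by auto
      then have "card (insert i0 ?V) \<le> card ?U" by (intro card_mono) auto
      moreover have "card (insert i0 ?V) = Suc (card ?V)" using finS S(2) by simp
      ultimately have V: "card ?V \<le> 1" by linarith
      have "(\<Sum>i\<in>S. int (\<beta> i)) = (\<Sum>i\<in>?V. int (\<beta> i))"
        using finS by (intro sum.mono_neutral_right) auto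
      also have "\<dots> \<le> (\<Sum>i\<in>?V. 1)" using by_deg y1 by (intro sum_mono) simp
      finally have "(\<Sum>i\<in>S. int (\<beta> i)) \<le> 1" using V by simp
      then show False using neg by (simp add: c' y1)
    qed
  qed
  have le1: "\<beta> t \<le> 1" if "t \<in> S" for t
  proof (cases "2 \<le> y")
    case True
    then have "i0 \<le> n" using x y by auto
    then show ?thesis using pair[OF True, of i0 t] that S(1,2) \<beta>0 by force
  next
    case False
    then show ?thesis using by_deg[of t] y by simp
  qed
  let ?V = "{t \<in> S. 1 \<le> \<beta> t}" and ?T = "{i. i \<le> n \<and> i \<noteq> i0 \<and> 1 \<le> \<beta> i}"
  have VT: "?V \<subseteq> ?T" using S(1,2) by auto
  then have cardV: "card ?V \<le> card ?T" by (intro card_mono) auto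
  have "(\<Sum>i\<in>S. int (\<beta> i)) = (\<Sum>i\<in>?V. int (\<beta> i))"
    using finS by (intro sum.mono_neutral_right) auto
  also have "\<dots> \<le> (\<Sum>i\<in>?V. 1)" using le1 by (intro sum_mono) simp
  finally have sumV: "(\<Sum>i\<in>S. int (\<beta> i)) \<le> int (card ?V)" by simp
  have "(int x - 1) * int (\<beta> i0) \<le> (int x - 1) * (int y - 1)"
  proof (cases "x = 1")
    case False
    then have "\<beta> i0 < y" using not_cone x by auto
    then show ?thesis using x(1) by (intro mult_left_mono) auto
  qed simp
  then have big: "int x + int y \<le> int (card ?V)" using neg sumV by (simp add: algebra_simps)
  then have xy: "y = x" using cardV T y by linarith
  have "?V = S"
  proof (rule card_subset_eq[OF finS])
    have "card ?V \<le> card S" by (intro card_mono finS) auto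
    then show "card ?V = card S" using big xy S(3) by simp
  qed auto
  moreover have "?V = ?T"
    using big xy cardV T VT by (intro card_subset_eq) auto
  ultimately have TS: "?T = S" by simp
  have "\<beta> i = rational_mult i0 S x i" if "i \<le> n" for i
  proof (cases "i = i0")
    case True
    show ?thesis
    proof (cases "x = 1")
      case True
      let ?U = "{i. i \<le> n \<and> i \<noteq> Suc n \<and> 1 \<le> \<beta> i}"
      have "card ?U \<le> 2"
        using few_simple_points[OF g curveD(2,3)[OF b(1)], of "Suc n"] xy True x by (simp add: y_def \<beta>_def)
      moreover have "S \<subseteq> ?U" using TS by auto
      ultimately have "?U = S" using S(3) True by (intro card_seteq[symmetric]) auto
      then have "\<beta> i0 = 0" using S(2) that \<open>i = i0\<close> by (cases "\<beta> i0") auto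
      then show ?thesis using True \<open>i = i0\<close> by (simp add: rational_mult_def)
    next
      case False
      then show ?thesis using not_cone \<beta>0 x xy that \<open>i = i0\<close> by (auto simp: rational_mult_def)
    qed
  next
    case False
    show ?thesis
    proof (cases "i \<in> S")
      case True
      then have "1 \<le> \<beta> i" using TS by auto
      then show ?thesis using le1[OF True] True False by (simp add: rational_mult_def)
    next
      case nS: False
      then have "\<not> 1 \<le> \<beta> i" using TS that False by auto
      then show ?thesis using nS False by (simp add: rational_mult_def)
    qed
  qed
  then show ?thesis using b(1) xy by (intro exI[of _ b]) (auto simp: y_def \<beta>_def)
qed

section \<open>The negative curves that occur\<close>

lemma minus_one_curveI:
  assumes "curve b"
    and self: "fst c * fst c - snd c 0 * snd c 0 - (\<Sum>i=1..n. snd c i * snd c i) = - 1"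
    and K: "3 * fst c - snd c 0 - (\<Sum>i=1..n. snd c i) = 1"
    and c: "c = curve_data p b"
  shows "minus_one_curve n p b"
proof -
  have "intersection_number n c c = - 1" using self unfolding intersection_number_alt sum_atMost_split by linarith
  moreover have "(\<Sum>i\<le>n. snd c i * (snd c i - 1)) = (\<Sum>i\<le>n. snd c i * snd c i) - (\<Sum>i\<le>n. snd c i)"
    by (simp add: right_diff_distrib sum_subtractf)
  then have "2 * genus n c = 0"
    using self K unfolding genus_twice sum_atMost_split by (simp add: algebra_simps)
  ultimately show ?thesis using assms(1) unfolding minus_one_curve_def c curve_def by simp
qed

lemma intersection_line:
  assumes "line_class n t c"
  shows "intersection_number n E c = fst E - snd E 0 - snd E t"
proof -
  have "(\<Sum>i=1..n. snd E i * snd c i) = snd E t * snd c t + (int n - 1) * 0"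
    by (rule sum_odd_one_out) (use assms in \<open>auto simp: line_class_def\<close>)
  then show ?thesis using assms by (simp add: intersection_number_alt sum_atMost_split line_class_def)
qed

lemma intersection_constant:
  assumes "constant_class n x y a c"
  shows "intersection_number n E c = fst E * x - snd E 0 * y - a * (\<Sum>i=1..n. snd E i)"
proof -
  have "(\<Sum>i=1..n. snd E i * snd c i) = (\<Sum>i=1..n. a * snd E i)"
    by (rule sum.cong) (use assms in \<open>auto simp: constant_class_def\<close>)
  then show ?thesis using assms
    by (simp add: intersection_number_alt sum_atMost_split constant_class_def sum_distrib_left)
qed

lemma line_exists:
  assumes g: "good n B p" and B: "1 \<le> B" and t: "t \<in> {1..n}"
  shows "\<exists>b. minus_one_curve n p b \<and> line_class n t (curve_data p b)"
proof -
  have "\<exists>b. curve b \<and> total_degree b = 1 \<and> (\<forall>i\<le>n. multiplicity_at b (p i) = rational_mult (Suc n) {0, t} 1 i)"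
    by (rule rational_curve[OF g]) (use B t in auto)
  then obtain b where b: "curve b" "total_degree b = 1"
    "\<And>i. i \<le> n \<Longrightarrow> multiplicity_at b (p i) = rational_mult (Suc n) {0, t} 1 i" by (elim exE conjE) simp
  let ?c = "curve_data p b"
  have l: "line_class n t ?c" using b t by (auto simp: line_class_def rational_mult_def)
  have "(\<Sum>i=1..n. snd ?c i * snd ?c i) = snd ?c t * snd ?c t + (int n - 1) * 0"
    by (rule sum_odd_one_out[OF t]) (use l in \<open>auto simp: line_class_def\<close>)
  moreover have "(\<Sum>i=1..n. snd ?c i) = snd ?c t + (int n - 1) * 0"
    by (rule sum_odd_one_out[OF t]) (use l in \<open>auto simp: line_class_def\<close>)
  ultimately have "minus_one_curve n p b"
    using l by (intro minus_one_curveI[OF b(1) _ _ refl]) (simp_all add: line_class_def)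
  with l show ?thesis by blast
qed

lemma constant_minus_one:
  assumes "curve b" "constant_class n x y a (curve_data p b)"
    "x * x - y * y - int n * (a * a) = - 1" "3 * x - y - int n * a = 1"
  shows "minus_one_curve n p b"
proof -
  let ?c = "curve_data p b"
  have "(\<Sum>i=1..n. snd ?c i * snd ?c i) = (\<Sum>i=1..n. a * a)" "(\<Sum>i=1..n. snd ?c i) = (\<Sum>i=1..n. a)"
    using assms(2) by (auto simp only: constant_class_def intro!: sum.cong)
  then show ?thesis
    using assms by (intro minus_one_curveI[OF assms(1) _ _ refl]) (simp_all only: constant_class_def sum_constant card_atLeastAtMost, simp_all)
qed

lemma rational_exists:
  assumes g: "good n B p" and e: "1 \<le> e" "e \<le> B" and n: "n = 2 * e"
  shows "\<exists>b. minus_one_curve n p b \<and> constant_class n (int e) (int e - 1) 1 (curve_data p b)"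
proof -
  have "\<exists>b. curve b \<and> total_degree b = e \<and> (\<forall>i\<le>n. multiplicity_at b (p i) = rational_mult 0 {1..n} e i)"
    by (rule rational_curve[OF g]) (use e n in auto)
  then obtain b where b: "curve b" "total_degree b = e"
    "\<And>i. i \<le> n \<Longrightarrow> multiplicity_at b (p i) = rational_mult 0 {1..n} e i" by (elim exE conjE) simp
  have c: "constant_class n (int e) (int e - 1) 1 (curve_data p b)"
    using b e by (auto simp: constant_class_def rational_mult_def of_nat_diff)
  have "minus_one_curve n p b"
    by (rule constant_minus_one[OF b(1) c]) (simp_all add: n algebra_simps)
  with c show ?thesis by blast
qed

lemma conic_exists:
  assumes g: "good 5 B p" and B: "2 \<le> B"
  shows "\<exists>b. minus_one_curve 5 p b \<and> constant_class 5 2 0 1 (curve_data p b)"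
proof -
  have "\<exists>b. curve b \<and> total_degree b = 2 \<and> (\<forall>i\<le>5. multiplicity_at b (p i) = rational_mult 1 {2..5} 2 i)"
    by (rule rational_curve[OF g]) (use B in auto)
  then obtain b where b: "curve b" "total_degree b = 2"
    "\<And>i. i \<le> 5 \<Longrightarrow> multiplicity_at b (p i) = rational_mult 1 {2..5} 2 i" by (elim exE conjE) simp
  have c: "constant_class 5 2 0 1 (curve_data p b)"
    using b by (auto simp: constant_class_def rational_mult_def)
  have "minus_one_curve 5 p b"
    by (rule constant_minus_one[OF b(1) c]) simp_all
  with c show ?thesis by blast
qed

lemma chord_exists:
  assumes g: "good 3 B p" and B: "1 \<le> B" and j: "j \<in> {1..3}"
  shows "\<exists>b. minus_one_curve 3 p b \<and> fst (curve_data p b) = 1 \<and>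
     (\<forall>i\<le>3. snd (curve_data p b) i = (if i = 0 \<or> i = j then 0 else 1))"
proof -
  have "\<exists>b. curve b \<and> total_degree b = 1 \<and> (\<forall>i\<le>3. multiplicity_at b (p i) = rational_mult 4 ({1..3} - {j}) 1 i)"
    by (rule rational_curve[OF g]) (use B j in \<open>auto simp: card_Diff_subset\<close>)
  then obtain b where b: "curve b" "total_degree b = 1"
    "\<And>i. i \<le> 3 \<Longrightarrow> multiplicity_at b (p i) = rational_mult 4 ({1..3} - {j}) 1 i" by (elim exE conjE) simp
  let ?c = "curve_data p b"
  have c: "snd ?c i = (if i = 0 \<or> i = j then 0 else 1)" if "i \<le> 3" for i
    using b(3)[OF that] that by (auto simp: rational_mult_def)
  have "(\<Sum>i=1..3. snd ?c i * snd ?c i) = snd ?c j * snd ?c j + (int 3 - 1) * 1"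
    by (rule sum_odd_one_out[OF j]) (simp only: c atLeastAtMost_iff Diff_iff singleton_iff, simp)
  moreover have "(\<Sum>i=1..3. snd ?c i) = snd ?c j + (int 3 - 1) * 1"
    by (rule sum_odd_one_out[OF j]) (simp only: c atLeastAtMost_iff Diff_iff singleton_iff, simp)
  moreover have "snd ?c 0 = 0" "snd ?c j = 0" using c[of 0] c[of j] j by simp_all
  ultimately have "minus_one_curve 3 p b"
    using b(2) by (intro minus_one_curveI[OF b(1) _ _ refl]) (simp_all del: snd_curve_data)
  then show ?thesis using b(2) c by (intro exI[of _ b]) simp
qed

text \<open>
  Let \<open>b\<close>, of degree \<open>y\<close> with multiplicities \<open>\<beta>\<close> of sum \<open>s\<close>, be a component that the class meets negatively, which reads
  \<open>6 * y < \<beta> 0 + 2 * s\<close>. In degree at most \<open>3\<close> this contradicts the bounds on points of rational curves. In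
  degree at least \<open>4\<close> the cubics through all eight points give \<open>s \<le> 3 * y\<close>, and the cubics that are double at one
  point and avoid another give \<open>\<beta> i + s - \<beta> j \<le> 3 * y\<close>; summing the latter over \<open>i\<close> or \<open>j\<close> excludes \<open>y = 4\<close> and
  \<open>y = 5\<close> and shows \<open>s \<le> 17\<close> for \<open>y = 6\<close>, which leaves the expected multiplicities.
\<close>

lemma sextic_exists:
  assumes g: "good 7 B p" and B: "6 \<le> B"
  shows "\<exists>b. minus_one_curve 7 p b \<and> constant_class 7 6 3 2 (curve_data p b)"
proof -
  define w :: system where "w = (6, \<lambda>i. if i = 0 then 3 else 2)"
  have w: "fst w = 6" "snd w 0 = 3" "\<And>i. i \<in> {1..7} \<Longrightarrow> snd w i = 2" by (auto simp: w_def)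
  have self: "intersection_number 7 w w = - 1"
    by (simp add: intersection_number_alt sum_atMost_split w)
  have "2 * virtual_dim 7 w = 0" unfolding virtual_dim_twice sum_atMost_split by (simp add: w)
  then have eff: "effective 7 p w" by (intro exists_section[OF g]) (simp_all add: w_def)
  have "\<exists>b. curve b \<and> intersection_number 7 w (curve_data p b) < 0 \<and> int (total_degree b) \<le> fst w \<and>
    (\<forall>i\<le>7. snd w i - int (multiplicity_at b (p i)) \<le> fst w - int (total_degree b))"
    by (rule negative_component[OF g eff]) (simp_all add: self, simp add: w_def)
  then obtain b where "curve b \<and> intersection_number 7 w (curve_data p b) < 0 \<and> int (total_degree b) \<le> fst w \<and>
    (\<forall>i\<le>7. snd w i - int (multiplicity_at b (p i)) \<le> fst w - int (total_degree b))" by (elim exE)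
  then have b: "curve b" "intersection_number 7 w (curve_data p b) < 0"
    "total_degree b \<le> 6" "\<And>i. i \<le> 7 \<Longrightarrow> snd w i - int (multiplicity_at b (p i)) \<le> 6 - int (total_degree b)"
    unfolding w(1) by simp_all
  define y where "y = int (total_degree b)"
  define \<beta> where "\<beta> i = int (multiplicity_at b (p i))" for i
  define s where "s = (\<Sum>i\<le>7. \<beta> i)"
  have s1: "(\<Sum>i=1..7. \<beta> i) = s - \<beta> 0" by (simp only: s_def sum_atMost_split)
  have y: "1 \<le> y" "y \<le> 6" using curve_degree_pos[OF b(1)] b(3) by (auto simp: y_def)
  have \<beta>: "0 \<le> \<beta> i" "\<beta> i \<le> y" for i using curve_mult_le_degree[OF b(1)] by (simp_all add: \<beta>_def y_def)
  have "(\<Sum>i=1..7. snd w i * \<beta> i) = (\<Sum>i=1..7. 2 * \<beta> i)" by (rule sum.cong) (auto simp: w)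
  also have "\<dots> = 2 * (s - \<beta> 0)" by (simp only: s1 sum_distrib_left[symmetric])
  finally have ws: "(\<Sum>i=1..7. snd w i * \<beta> i) = 2 * (s - \<beta> 0)" .
  have neg: "6 * y - \<beta> 0 - 2 * s < 0"
    using b(2) unfolding intersection_number_alt sum_atMost_split fst_curve_data snd_curve_data
      w(1,2) y_def[symmetric] \<beta>_def[symmetric] ws by simp
  have pair: "\<beta> i + \<beta> j \<le> y" if "2 \<le> y" "i \<le> 7" "j \<le> 7" "i \<noteq> j" for i j
    using two_multiplicities_le_degree[OF g b(1) _ _ that(2-4)] that(1) B unfolding y_def \<beta>_def by linarith
  have few: "s \<le> (if i0 \<le> 7 then \<beta> i0 else 0) + 2 * y"
    if "i0 \<le> 7 \<or> y = 1" "i0 \<le> 7 \<Longrightarrow> y - 1 \<le> \<beta> i0" "\<And>i. i \<le> 7 \<Longrightarrow> i \<noteq> i0 \<Longrightarrow> \<beta> i \<le> 1" for i0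
  proof -
    define T where "T = {i. i \<le> 7 \<and> i \<noteq> i0 \<and> 1 \<le> multiplicity_at b (p i)}"
    have "card T \<le> 2 * total_degree b" unfolding T_def
      by (rule few_simple_points[OF g curveD(2,3)[OF b(1)]]) (use that y B in \<open>auto simp: y_def \<beta>_def\<close>)
    then have T: "int (card T) \<le> 2 * y" by (simp add: y_def)
    have "s \<le> (\<Sum>i\<le>7. (if i = i0 then \<beta> i0 else 0) + (if i \<in> T then 1 else 0))"
      unfolding s_def
    proof (rule sum_mono)
      fix i :: nat assume "i \<in> {..7}"
      then show "\<beta> i \<le> (if i = i0 then \<beta> i0 else 0) + (if i \<in> T then 1 else 0)"
        using that(3)[of i] by (auto simp: \<beta>_def T_def)
    qed
    also have "\<dots> = (if i0 \<le> 7 then \<beta> i0 else 0) + (\<Sum>i\<in>{..7} \<inter> T. 1)"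
      by (simp only: sum.distrib sum.delta finite_atMost atMost_iff sum.inter_restrict[symmetric])
    also have "{..7} \<inter> T = T" by (auto simp: T_def)
    finally show ?thesis using T by simp
  qed
  have y4: "4 \<le> y"
  proof (rule ccontr)
    assume "\<not> 4 \<le> y"
    then consider "y = 1" | "y = 2 \<or> y = 3" using y by linarith
    then show False
    proof cases
      case 1
      have "s \<le> 2" using few[of 8] \<beta>(2) 1 by simp
      then show False using neg \<beta>(2)[of 0] 1 by linarith
    next
      case 2
      show False
      proof (cases "\<exists>i\<le>7. y - 1 \<le> \<beta> i")
        case True
        then obtain i0 where i0: "i0 \<le> 7" "y - 1 \<le> \<beta> i0" by blast
        have other: "\<beta> i \<le> y - \<beta> i0" if "i \<le> 7" "i \<noteq> i0" for i
          using pair[of i i0] that i0(1) 2 by auto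
        have "s \<le> \<beta> i0 + 2 * y" using few[of i0] i0 other by force
        moreover have "\<beta> 0 \<le> y - 1" if "\<beta> i0 = y - 1" using other[of 0] that i0 2 by (cases "i0 = 0") auto
        moreover have "s = y" if "\<beta> i0 = y"
        proof -
          have "\<beta> i = (if i = i0 then y else 0)" if "i \<le> 7" for i
            using other[OF that] \<beta>(1)[of i] \<open>\<beta> i0 = y\<close> by auto
          then have "s = (\<Sum>i\<le>7. if i = i0 then y else 0)" unfolding s_def by (intro sum.cong) auto
          then show ?thesis using i0(1) by simp
        qed
        moreover have "\<beta> i0 = y - 1 \<or> \<beta> i0 = y" using i0(2) \<beta>(2)[of i0] by linarith
        ultimately show False using neg \<beta>(2)[of 0] 2 by auto
      next
        case False
        then have small: "\<beta> i \<le> y - 2" if "i \<le> 7" for i using that by force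
        have "s \<le> (\<Sum>i\<le>7::nat. y - 2)" unfolding s_def using small by (intro sum_mono) simp
        then have "s \<le> 8 * (y - 2)" by simp
        then show False using neg 2 small[of 0] by auto
      qed
    qed
  qed
  have s3: "s \<le> 3 * y"
  proof -
    let ?E = "(3, \<lambda>_. 1) :: system"
    have "effective 7 p ?E" by (rule exists_section[OF g]) (simp_all add: virtual_dim_def)
    then have "0 \<le> intersection_number 7 ?E (curve_data p b)"
      by (rule nonnegative_intersection_degree[OF g b(1)]) (use B y4 in \<open>auto simp: y_def\<close>)
    then show ?thesis by (simp add: intersection_number_alt s_def \<beta>_def y_def)
  qed
  have cubic: "\<beta> i + s - \<beta> j \<le> 3 * y" if ij: "i \<le> 7" "j \<le> 7" "i \<noteq> j" for i j
  proof -
    let ?E = "(3, \<lambda>k. 1 + (if k = i then 1 else 0) - (if k = j then 1 else 0)) :: system"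
    have "(\<Sum>k\<le>7. snd ?E k * (snd ?E k + 1)) = (\<Sum>k\<le>7. 2 + (if k = i then 4 else 0) - (if k = j then 2 else 0))"
      using ij by (intro sum.cong) auto
    also have "\<dots> = 18" using ij by (simp add: sum.distrib sum_subtractf)
    finally have "2 * virtual_dim 7 ?E = 0" unfolding virtual_dim_twice by simp
    then have "effective 7 p ?E" by (intro exists_section[OF g]) auto
    then have "0 \<le> intersection_number 7 ?E (curve_data p b)"
      by (rule nonnegative_intersection_degree[OF g b(1)]) (use B y4 in \<open>auto simp: y_def\<close>)
    moreover have "(\<Sum>k\<le>7. snd ?E k * \<beta> k) = (\<Sum>k\<le>7. \<beta> k + (if k = i then \<beta> i else 0) - (if k = j then \<beta> j else 0))"
      by (intro sum.cong) auto
    then have "(\<Sum>k\<le>7. snd ?E k * \<beta> k) = s + \<beta> i - \<beta> j"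
      using ij by (simp add: sum.distrib sum_subtractf s_def)
    ultimately show ?thesis unfolding intersection_number_alt snd_curve_data fst_curve_data \<beta>_def[symmetric] y_def[symmetric]
      by simp
  qed
  have "(\<Sum>j=1..7. \<beta> 0 + s - \<beta> j) \<le> (\<Sum>j=1..7::nat. 3 * y)" using cubic[of 0] by (intro sum_mono) auto
  then have c1: "8 * \<beta> 0 + 6 * s \<le> 21 * y" by (simp add: sum_subtractf s1[simplified])
  have "(\<Sum>j=1..7. \<beta> j + s - \<beta> 0) \<le> (\<Sum>j=1..7::nat. 3 * y)" using cubic[of _ 0] by (intro sum_mono) auto
  then have c2: "8 * s - 8 * \<beta> 0 \<le> 21 * y" by (simp add: sum.distrib sum_subtractf s1[simplified])
  have "y = 4 \<or> y = 5 \<or> y = 6" using y4 y(2) by presburger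
  moreover have "y \<noteq> 4"
  proof
    assume y: "y = 4"
    have "5 * \<beta> 0 \<le> 9" using c1 neg unfolding y by linarith
    then have "\<beta> 0 \<le> 1" by linarith
    then have "12 \<le> s" using neg unfolding y by linarith
    then show False using c2 \<open>\<beta> 0 \<le> 1\<close> unfolding y by linarith
  qed
  moreover have "y \<noteq> 5"
  proof
    assume y: "y = 5"
    have "5 * \<beta> 0 \<le> 12" using c1 neg unfolding y by linarith
    then have "\<beta> 0 \<le> 2" by linarith
    then have "s = 15" using neg s3 unfolding y by linarith
    then have "\<beta> 0 \<le> 1" using c1 unfolding y by linarith
    then show False using c2 \<open>s = 15\<close> unfolding y by linarith
  qed
  ultimately have y6: "y = 6" by linarith
  have ge: "snd w i \<le> \<beta> i" if "i \<le> 7" for i using b(4)[OF that] y6 by (simp add: y_def \<beta>_def)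
  have "s \<le> 17" using c1 ge[of 0] y6 by (simp add: w)
  moreover have "(\<Sum>i\<le>7. snd w i) = 17" by (simp add: sum_atMost_split w)
  ultimately have "(\<Sum>i\<le>7. \<beta> i - snd w i) \<le> 0" by (simp add: sum_subtractf s_def)
  moreover have "0 \<le> (\<Sum>i\<le>7. \<beta> i - snd w i)" using ge by (intro sum_nonneg) auto
  ultimately have "(\<Sum>i\<le>7. \<beta> i - snd w i) = 0" by linarith
  then have "\<forall>i\<in>{..7}. \<beta> i - snd w i = 0" using ge by (subst (asm) sum_nonneg_eq_0_iff) auto
  then have c: "constant_class 7 6 3 2 (curve_data p b)"
    using y6 by (auto simp: constant_class_def w_def y_def \<beta>_def)
  then have "minus_one_curve 7 p b" by (rule constant_minus_one[OF b(1)]) simp_all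
  with c show ?thesis by blast
qed

section \<open>Listed systems are special\<close>

text \<open>
  The residual system meets each \<open>A j\<close> in \<open>- N j + N j = 0\<close>, and its virtual dimension is given by \<open>virtual_dim_residual\<close>.
\<close>

lemma specialI:
  fixes r :: nat
  assumes A: "\<And>j. j < r \<Longrightarrow> minus_one_curve n p (A j)"
    and disj: "\<And>i j. i < r \<Longrightarrow> j < r \<Longrightarrow> i \<noteq> j \<Longrightarrow> intersection_number n (curve_data p (A i)) (curve_data p (A j)) = 0"
    and N: "\<And>j. j < r \<Longrightarrow> intersection_number n L (curve_data p (A j)) = - N j" "\<And>j. j < r \<Longrightarrow> 1 \<le> N j" "k < r" "2 \<le> N k"
    and M: "(\<Sum>j<r. N j * fst (curve_data p (A j))) \<le> fst L"
      "\<And>i. i \<le> n \<Longrightarrow> (\<Sum>j<r. N j * snd (curve_data p (A j)) i) \<le> snd L i"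
    and v: "0 \<le> 2 * virtual_dim n L + (\<Sum>j<r. N j * (N j - 1))"
  shows "minus_one_special n p L"
proof -
  let ?M = "residual p L r N A"
  have d: "disjoint_curves n p (A i) (A j)" if "i < r" "j < r" "i \<noteq> j" for i j
    using disj[OF that] by (simp add: disjoint_curves_def)
  have "2 * virtual_dim n ?M = 2 * virtual_dim n L + (\<Sum>j<r. N j * (N j - 1))"
    by (rule virtual_dim_residual) (erule A, erule (2) d, erule N(1))
  then have vM: "0 \<le> virtual_dim n ?M" using v by linarith
  have "intersection_number n ?M (curve_data p (A j)) = 0" if "j < r" for j
  proof -
    have "(\<Sum>i<r. N i * intersection_number n (curve_data p (A i)) (curve_data p (A j)))
        = (\<Sum>i<r. if i = j then - N j else 0)"
      using disj that minus_one_curve_numerics(2)[OF A[OF that]] by (intro sum.cong) auto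
    then show ?thesis using N(1)[OF that] that by (simp add: intersection_residual)
  qed
  then have "\<forall>j<r. 0 \<le> intersection_number n ?M (curve_data p (A j))" by simp
  moreover have "0 \<le> fst ?M" "\<forall>i\<le>n. 0 \<le> snd ?M i" using M by (simp_all add: residual_def)
  moreover have "\<exists>j<r. 2 \<le> N j" using N(3,4) by (intro exI[of _ k] conjI)
  moreover have "\<forall>j<r. minus_one_curve n p (A j)" "\<forall>i<r. \<forall>j<r. i \<noteq> j \<longrightarrow> disjoint_curves n p (A i) (A j)"
    "\<forall>j<r. intersection_number n L (curve_data p (A j)) = - N j \<and> 1 \<le> N j"
    using A d N(1,2) by simp_all
  ultimately show ?thesis unfolding minus_one_special_def Let_def using vM
    by - (rule exI[of _ r], rule exI[of _ A], rule exI[of _ N], simp)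
qed

lemma special_single:
  assumes b: "minus_one_curve n p b" "constant_class n x y a (curve_data p b)" and N: "2 \<le> N"
    and eq: "int d * x - int m0 * y - 4 * (int n * a) = - N"
    and M: "N * x \<le> int d" "N * y \<le> int m0" "N * a \<le> 4"
    and v: "0 \<le> int d * (int d + 3) - int m0 * (int m0 + 1) - 20 * int n + N * (N - 1)"
  shows "minus_one_special n p (quasi_homogeneous d m0 4)"
proof (rule specialI[where r = "Suc 0" and A = "\<lambda>_. b" and N = "\<lambda>_. N" and k = 0])
  show "intersection_number n (quasi_homogeneous d m0 4) (curve_data p b) = - N"
    using eq by (simp add: intersection_constant[OF b(2)] algebra_simps)
  show "(\<Sum>j<Suc 0. N * snd (curve_data p b) i) \<le> snd (quasi_homogeneous d m0 4) i" if "i \<le> n" for i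
  proof (cases "i = 0")
    case True then show ?thesis using M(2) b(2) by (simp add: constant_class_def)
  next
    case False
    then have "snd (curve_data p b) i = a" using b(2) that by (simp add: constant_class_def)
    then show ?thesis using M(3) False by simp
  qed
  show "(\<Sum>j<Suc 0. N * fst (curve_data p b)) \<le> fst (quasi_homogeneous d m0 4)"
    using M(1) b(2) by (simp add: constant_class_def)
  show "0 \<le> 2 * virtual_dim n (quasi_homogeneous d m0 4) + (\<Sum>j<Suc 0. N * (N - 1))"
    using v unfolding virtual_dim_quasi_homogeneous by simp
qed (use b N in auto)

lemma sum_lines:
  assumes "\<And>j. j < n \<Longrightarrow> line_class n (Suc j) (curve_data p (A j))" "i \<le> n"
  shows "(\<Sum>j<n. N * snd (curve_data p (A j)) i) = (if i = 0 then int n * N else N)"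
proof (cases "i = 0")
  case True
  have "(\<Sum>j<n. N * snd (curve_data p (A j)) i) = (\<Sum>j<n. N)"
    by (rule sum.cong) (use assms True in \<open>auto simp: line_class_def\<close>)
  then show ?thesis using True by simp
next
  case False
  have "(\<Sum>j<n. N * snd (curve_data p (A j)) i) = (\<Sum>j<n. if j = i - 1 then N else 0)"
  proof (rule sum.cong[OF refl])
    fix j assume "j \<in> {..<n}"
    then have "line_class n (Suc j) (curve_data p (A j))" using assms(1) by simp
    then show "N * snd (curve_data p (A j)) i = (if j = i - 1 then N else 0)"
      using False assms(2) by (cases "i = Suc j") (auto simp: line_class_def)
  qed
  then show ?thesis using False assms(2) by simp
qed

lemma lines_exist:
  assumes "good n B p" "1 \<le> B"
  shows "\<exists>A. \<forall>j<n. minus_one_curve n p (A j) \<and> line_class n (Suc j) (curve_data p (A j))"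
proof -
  have "\<forall>j\<in>{..<n}. \<exists>b. minus_one_curve n p b \<and> line_class n (Suc j) (curve_data p b)"
    using line_exists[OF assms] by simp
  from bchoice[OF this] show ?thesis by (simp add: Ball_def)
qed

lemma special_lines:
  assumes g: "good n B p" "1 \<le> B" and k: "k \<in> {0, 1, 2}" and n: "1 \<le> n"
    and d: "int d = int m0 + k" and M: "int n * (4 - k) \<le> int m0"
    and v: "0 \<le> int d * (int d + 3) - int m0 * (int m0 + 1) - 20 * int n + int n * ((4 - k) * (3 - k))"
  shows "minus_one_special n p (quasi_homogeneous d m0 4)"
proof -
  obtain A where "\<forall>j<n. minus_one_curve n p (A j) \<and> line_class n (Suc j) (curve_data p (A j))"
    using lines_exist[OF g] by (elim exE)
  then have A: "\<And>j. j < n \<Longrightarrow> minus_one_curve n p (A j)" "\<And>j. j < n \<Longrightarrow> line_class n (Suc j) (curve_data p (A j))"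
    by simp_all
  show ?thesis
  proof (rule specialI[where r = n and A = A and N = "\<lambda>_. 4 - k" and k = 0])
    show "intersection_number n (curve_data p (A i)) (curve_data p (A j)) = 0" if "i < n" "j < n" "i \<noteq> j" for i j
      using intersection_line[OF A(2)[OF that(2)]] A(2)[OF that(1)] that
      by (simp add: line_class_def del: fst_curve_data snd_curve_data)
    show "intersection_number n (quasi_homogeneous d m0 4) (curve_data p (A j)) = - (4 - k)" if "j < n" for j
      using intersection_line[OF A(2)[OF that]] d by simp
    have "(\<Sum>j<n. (4 - k) * fst (curve_data p (A j))) = (\<Sum>j<n. 4 - k)"
      by (rule sum.cong) (use A(2) in \<open>auto simp: line_class_def\<close>)
    then show "(\<Sum>j<n. (4 - k) * fst (curve_data p (A j))) \<le> fst (quasi_homogeneous d m0 4)"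
      using M d k by auto
    show "(\<Sum>j<n. (4 - k) * snd (curve_data p (A j)) i) \<le> snd (quasi_homogeneous d m0 4) i" if "i \<le> n" for i
    proof -
      have "(\<Sum>j<n. (4 - k) * snd (curve_data p (A j)) i) = (if i = 0 then int n * (4 - k) else 4 - k)"
        by (rule sum_lines) (erule A(2), rule that)
      then show ?thesis using M k by (auto simp del: snd_curve_data)
    qed
    show "0 \<le> 2 * virtual_dim n (quasi_homogeneous d m0 4) + (\<Sum>j<n. (4 - k) * (4 - k - 1))"
      using v unfolding virtual_dim_quasi_homogeneous by simp
  qed (use A n k in auto)
qed

lemma special_lines_rational:
  assumes g: "good n B p" "e \<le> B" and k: "k \<in> {2, 3}" and e: "1 \<le> e" and n: "n = 2 * e"
    and d: "int d = int m0 + k" and N: "N \<in> {2, 3}" "N \<le> k" "int d * int e - int m0 * (int e - 1) - 8 * int e = - N"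
    and M: "int n * (4 - k) + N * int e \<le> int d" "int n * (4 - k) + N * (int e - 1) \<le> int m0"
    and v: "0 \<le> int d * (int d + 3) - int m0 * (int m0 + 1) - 20 * int n + int n * ((4 - k) * (3 - k)) + N * (N - 1)"
  shows "minus_one_special n p (quasi_homogeneous d m0 4)"
proof -
  have B: "1 \<le> B" using g(2) e by simp
  obtain A where "\<forall>j<n. minus_one_curve n p (A j) \<and> line_class n (Suc j) (curve_data p (A j))"
    using lines_exist[OF g(1) B] by (elim exE)
  then have A: "\<And>j. j < n \<Longrightarrow> minus_one_curve n p (A j)" "\<And>j. j < n \<Longrightarrow> line_class n (Suc j) (curve_data p (A j))"
    by simp_all
  obtain b where b: "minus_one_curve n p b" "constant_class n (int e) (int e - 1) 1 (curve_data p b)"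
    using rational_exists[OF g(1) e g(2) n] by (elim exE conjE)
  let ?A = "\<lambda>j. if j < n then A j else b" and ?N = "\<lambda>j. if j < n then 4 - k else N"
  have cross: "intersection_number n (curve_data p b) (curve_data p (A j)) = 0"
     "intersection_number n (curve_data p (A j)) (curve_data p b) = 0" if "j < n" for j
  proof -
    show "intersection_number n (curve_data p b) (curve_data p (A j)) = 0"
      using intersection_line[OF A(2)[OF that]] b(2) that
      by (simp add: constant_class_def del: fst_curve_data snd_curve_data)
    then show "intersection_number n (curve_data p (A j)) (curve_data p b) = 0"
      by (simp only: intersection_commute)
  qed
  have split: "(\<Sum>j<Suc n. f (if j < n then 4 - k else N) (if j < n then A j else b)) = (\<Sum>j<n. f (4 - k) (A j)) + f N b"
    for f :: "int \<Rightarrow> poly3 \<Rightarrow> int"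
    by simp
  show ?thesis
  proof (rule specialI[where r = "Suc n" and A = ?A and N = ?N and k = n])
    show "minus_one_curve n p (?A j)" for j using A(1) b(1) by simp
    show "intersection_number n (curve_data p (?A i)) (curve_data p (?A j)) = 0" if "i < Suc n" "j < Suc n" "i \<noteq> j" for i j
    proof (cases "i < n \<and> j < n")
      case True
      then show ?thesis using intersection_line[OF A(2)[of j]] A(2)[of i] that
        by (simp add: line_class_def del: fst_curve_data snd_curve_data)
    next
      case False
      then show ?thesis using cross that by (auto simp: less_Suc_eq)
    qed
    show "intersection_number n (quasi_homogeneous d m0 4) (curve_data p (?A j)) = - ?N j" if "j < Suc n" for j
    proof (cases "j < n")
      case True then show ?thesis using intersection_line[OF A(2)[OF True]] d by simp
    next
      case False
      have "intersection_number n (quasi_homogeneous d m0 4) (curve_data p b) = - N"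
        unfolding intersection_constant[OF b(2)] using N(3) n by (simp add: algebra_simps)
      then show ?thesis using False by simp
    qed
    have "(\<Sum>j<n. (4 - k) * fst (curve_data p (A j))) = (\<Sum>j<n. 4 - k)"
      by (rule sum.cong) (use A(2) in \<open>auto simp: line_class_def\<close>)
    then show "(\<Sum>j<Suc n. ?N j * fst (curve_data p (?A j))) \<le> fst (quasi_homogeneous d m0 4)"
      unfolding split[of "\<lambda>N A. N * fst (curve_data p A)"] using M(1) b(2) by (simp add: constant_class_def)
    show "(\<Sum>j<Suc n. ?N j * snd (curve_data p (?A j)) i) \<le> snd (quasi_homogeneous d m0 4) i" if i: "i \<le> n" for i
    proof -
      have "(\<Sum>j<n. (4 - k) * snd (curve_data p (A j)) i) = (if i = 0 then int n * (4 - k) else 4 - k)"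
        by (rule sum_lines) (erule A(2), rule i)
      then show ?thesis unfolding split[of "\<lambda>N A. N * snd (curve_data p A) i"]
        using M(2) b(2) i N(2) by (cases "i = 0") (simp_all add: constant_class_def del: snd_curve_data)
    qed
    show "0 \<le> 2 * virtual_dim n (quasi_homogeneous d m0 4) + (\<Sum>j<Suc n. ?N j * (?N j - 1))"
      using v unfolding virtual_dim_quasi_homogeneous split[of "\<lambda>N A. N * (N - 1)"] by simp
  qed (use N k in auto)
qed

text \<open>
  The three sides of the triangle \<open>p 1\<close>, \<open>p 2\<close>, \<open>p 3\<close>, each subtracted twice, leave the zero class.
\<close>

lemma special_triangle:
  assumes g: "good 3 B p" "1 \<le> B"
  shows "minus_one_special 3 p (quasi_homogeneous 6 0 4)"
proof -
  have "\<forall>j\<in>{..<3::nat}. \<exists>b. minus_one_curve 3 p b \<and> fst (curve_data p b) = 1 \<and>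
     (\<forall>i\<le>3. snd (curve_data p b) i = (if i = 0 \<or> i = Suc j then 0 else 1))"
    using chord_exists[OF g] by simp
  from bchoice[OF this] obtain A where A: "\<forall>j\<in>{..<3::nat}. minus_one_curve 3 p (A j) \<and> fst (curve_data p (A j)) = 1 \<and>
     (\<forall>i\<le>3. snd (curve_data p (A j)) i = (if i = 0 \<or> i = Suc j then 0 else 1))" ..
  have A1: "minus_one_curve 3 p (A j)" "fst (curve_data p (A j)) = 1" if "j < 3" for j using A that by simp_all
  have A2: "snd (curve_data p (A j)) i = (if i = 0 \<or> i = Suc j then 0 else 1)" if "j < 3" "i \<le> 3" for i j
    using A that by simp
  have three: "(\<Sum>i\<le>3. f i) = f 0 + f 1 + f 2 + f 3" for f :: "nat \<Rightarrow> int" by (simp add: numeral_3_eq_3 numeral_2_eq_2)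
  have three': "(\<Sum>i<3. f i) = f 0 + f 1 + f 2" for f :: "nat \<Rightarrow> int" by (simp add: numeral_3_eq_3 numeral_2_eq_2)
  have j3: "j = 0 \<or> j = 1 \<or> j = 2" if "j < 3" for j :: nat using that by linarith
  show ?thesis
  proof (rule specialI[where r = 3 and A = A and N = "\<lambda>_. 2" and k = 0])
    show "intersection_number 3 (curve_data p (A i)) (curve_data p (A j)) = 0" if "i < 3" "j < 3" "i \<noteq> j" for i j
      using that j3[of i] j3[of j] unfolding intersection_number_alt three
      by (auto simp only: A1(2) A2) (simp_all add: A1(2) A2 del: fst_curve_data snd_curve_data)
    show "intersection_number 3 (quasi_homogeneous 6 0 4) (curve_data p (A j)) = - 2" if "j < 3" for j
      using that j3[OF that] unfolding intersection_number_alt three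
      by (auto simp: A1(2) A2 simp del: fst_curve_data snd_curve_data)
    show "(\<Sum>j<3. 2 * fst (curve_data p (A j))) \<le> fst (quasi_homogeneous 6 0 4)"
      unfolding three' by (simp add: A1(2) del: fst_curve_data)
    show "(\<Sum>j<3. 2 * snd (curve_data p (A j)) i) \<le> snd (quasi_homogeneous 6 0 4) i" if "i \<le> 3" for i
      unfolding three' using that by (cases "i = 0") (auto simp: A2 simp del: snd_curve_data)
    show "0 \<le> 2 * virtual_dim 3 (quasi_homogeneous 6 0 4) + (\<Sum>j<3::nat. 2 * (2 - 1))"
      unfolding virtual_dim_quasi_homogeneous by simp
  qed (use A1 in auto)
qed

text \<open>
  The three families bounded below are resolved by the \<open>n\<close> lines through \<open>p 0\<close>. The six families with \<open>n = 2 * e\<close>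
  are resolved by the rational curve of degree \<open>e\<close>, together with the lines if \<open>d - m0 \<le> 3\<close>. The sporadic systems need the rational
  curve, the conic, the sextic, or the triangle. The margin in the degree bound
  makes room for the auxiliary classes of degree at most \<open>6\<close>.
\<close>

theorem listed_imp_special:
  assumes g: "good n B p" and B: "d + 6 \<le> B" and l: "listed (int d) (int m0) (int n)"
  shows "minus_one_special n p (quasi_homogeneous d m0 4)"
proof -
  have B1: "1 \<le> B" using B by simp
  have rat: "minus_one_special n p (quasi_homogeneous d m0 4)"
    if e: "1 \<le> e" "int n = 2 * e" and N: "2 \<le> N" "N \<le> 4"
      and eq: "int d * e - int m0 * (e - 1) - 8 * e = - N" and M: "N * e \<le> int d" "N * (e - 1) \<le> int m0"
      and v: "0 \<le> int d * (int d + 3) - int m0 * (int m0 + 1) - 40 * e + N * (N - 1)" for e N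
  proof -
    have "1 * e \<le> N * e" using N e by (intro mult_right_mono) auto
    then have e': "1 \<le> nat e" "nat e \<le> B" "n = 2 * nat e" using e M(1) B by linarith+
    have ee: "int (nat e) = e" using e by simp
    obtain b where b: "minus_one_curve n p b" "constant_class n e (e - 1) 1 (curve_data p b)"
      using rational_exists[OF g e'] unfolding ee by (elim exE conjE)
    show ?thesis by (rule special_single[OF b N(1)]) (use e N eq M v in auto)
  qed
  have lines_rat: "minus_one_special n p (quasi_homogeneous d m0 4)"
    if e: "1 \<le> e" "int n = 2 * e" and k: "k \<in> {2, 3}" "int d = int m0 + k"
      and N: "N \<in> {2, 3}" "N \<le> k" "int d * e - int m0 * (e - 1) - 8 * e = - N"
      and M: "2 * e * (4 - k) + N * e \<le> int d" "2 * e * (4 - k) + N * (e - 1) \<le> int m0"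
      and v: "0 \<le> int d * (int d + 3) - int m0 * (int m0 + 1) - 40 * e + 2 * e * ((4 - k) * (3 - k)) + N * (N - 1)" for e k N
  proof -
    have "0 \<le> 2 * e * (4 - k)" "1 * e \<le> N * e" using N k e by (auto intro!: mult_right_mono)
    then have e': "nat e \<le> B" "1 \<le> nat e" "n = 2 * nat e" using e M(1) B by linarith+
    have ee: "int (nat e) = e" using e by simp
    show ?thesis
      by (rule special_lines_rational[OF g e'(1) k(1) e'(2,3) k(2) N(1,2)]) (use N M v e in \<open>simp_all add: ee\<close>)
  qed
  from l consider
      (lines) "1 \<le> int n" "int m0 = int d \<and> 4 * int n \<le> int d \<or> int m0 = int d - 1 \<and> 7 * int n \<le> 2 * int d
        \<or> int m0 = int d - 2 \<and> 3 * int n + 1 \<le> int d"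
    | (family) e where "1 \<le> e" "int n = 2 * e" "(int d, int m0) \<in> {(6 * e, 6 * e - 2), (5 * e, 5 * e - 3), (5 * e + 1, 5 * e - 2),
         (4 * e, 4 * e - 4), (4 * e + 1, 4 * e - 3), (4 * e + 2, 4 * e - 2)}"
    | (sporadic) "(int d, int m0, int n) \<in> {(5, 0, 2), (6, 1, 2), (8, 3, 4), (9, 4, 4), (12, 7, 6), (15, 10, 8),
         (6, 0, 2), (6, 0, 3), (8, 2, 4), (12, 6, 7),
         (9, 2, 5), (8, 0, 5), (9, 1, 5), (9, 0, 5)}"
    unfolding listed_def by (elim disjE exE conjE) simp_all
  then show ?thesis
  proof cases
    case lines
    from lines(2) show ?thesis
    proof (elim disjE conjE)
      assume h: "int m0 = int d" "4 * int n \<le> int d"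
      show ?thesis by (rule special_lines[OF g B1, of 0]) (use h(2) lines(1) in \<open>simp_all add: h(1) algebra_simps\<close>)
    next
      assume h: "int m0 = int d - 1" "7 * int n \<le> 2 * int d"
      show ?thesis by (rule special_lines[OF g B1, of 1]) (use h(2) lines(1) in \<open>simp_all add: h(1) algebra_simps\<close>)
    next
      assume h: "int m0 = int d - 2" "3 * int n + 1 \<le> int d"
      show ?thesis by (rule special_lines[OF g B1, of 2]) (use h(2) lines(1) in \<open>simp_all add: h(1) algebra_simps\<close>)
    qed
  next
    case (family e)
    then consider "int d = 6 * e" "int m0 = 6 * e - 2" | "int d = 5 * e" "int m0 = 5 * e - 3"
      | "int d = 5 * e + 1" "int m0 = 5 * e - 2" | "int d = 4 * e" "int m0 = 4 * e - 4"
      | "int d = 4 * e + 1" "int m0 = 4 * e - 3" | "int d = 4 * e + 2" "int m0 = 4 * e - 2" by auto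
    then show ?thesis
    proof cases
      case 1 show ?thesis by (rule lines_rat[OF family(1,2), of 2 2]) (use family(1) in \<open>simp_all add: 1 algebra_simps\<close>)
    next
      case 2 show ?thesis by (rule lines_rat[OF family(1,2), of 3 3]) (use family(1) in \<open>simp_all add: 2 algebra_simps\<close>)
    next
      case 3 show ?thesis by (rule lines_rat[OF family(1,2), of 3 2]) (use family(1) in \<open>simp_all add: 3 algebra_simps\<close>)
    next
      case 4 show ?thesis by (rule rat[OF family(1,2), of 4]) (use family(1) in \<open>simp_all add: 4 algebra_simps\<close>)
    next
      case 5 show ?thesis by (rule rat[OF family(1,2), of 3]) (use family(1) in \<open>simp_all add: 5 algebra_simps\<close>)
    next
      case 6 show ?thesis by (rule rat[OF family(1,2), of 2]) (use family(1) in \<open>simp_all add: 6 algebra_simps\<close>)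
    qed
  next
    case sporadic
    have conic: ?thesis if "n = 5" "d = 9 \<and> m0 \<le> 2 \<or> d = 8 \<and> m0 = 0"
    proof -
      have "\<exists>b. minus_one_curve n p b \<and> constant_class n 2 0 1 (curve_data p b)"
        using conic_exists[of B p] g B that(1) by simp
      then obtain b where b: "minus_one_curve n p b" "constant_class n 2 0 1 (curve_data p b)" by (elim exE conjE)
      from that(2) show ?thesis
      proof (elim disjE conjE)
        assume h: "d = 9" "m0 \<le> 2"
        have "int m0 * (int m0 + 1) \<le> 2 * 3" using h by (intro mult_mono) auto
        then show ?thesis by - (rule special_single[OF b, of 2], use that(1) h(1) in simp_all)
      next
        assume h: "d = 8" "m0 = 0"
        show ?thesis by (rule special_single[OF b, of 4]) (use that(1) h in simp_all)
      qed
    qed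
    have sextic: ?thesis if "n = 7" "d = 12" "m0 = 6"
    proof -
      have "\<exists>b. minus_one_curve n p b \<and> constant_class n 6 3 2 (curve_data p b)"
        using sextic_exists[of B p] g B that(1,2) by simp
      then obtain b where b: "minus_one_curve n p b" "constant_class n 6 3 2 (curve_data p b)" by (elim exE conjE)
      show ?thesis by (rule special_single[OF b, of 2]) (use that in simp_all)
    qed
    have triangle: ?thesis if "n = 3" "d = 6" "m0 = 0"
      using special_triangle[of B p] g B1 that by simp
    have R: ?thesis if "int n = 2 * e" "1 \<le> e" "int d = D" "int m0 = m" "2 \<le> N" "N \<le> 4" "D * e - m * (e - 1) - 8 * e = - N"
       "N * e \<le> D" "N * (e - 1) \<le> m" "0 \<le> D * (D + 3) - m * (m + 1) - 40 * e + N * (N - 1)" for e N D m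
      by (rule rat[of e N]) (use that in simp_all)
    let ?T = "{(1, 5, 0, 3), (1, 6, 1, 2), (2, 8, 3, 3), (2, 9, 4, 2), (3, 12, 7, 2), (4, 15, 10, 2), (1, 6, 0, 2), (2, 8, 2, 2)}
       :: (int \<times> int \<times> int \<times> int) set"
    have "n = 5 \<and> (d = 9 \<and> m0 \<le> 2 \<or> d = 8 \<and> m0 = 0) \<or> n = 7 \<and> d = 12 \<and> m0 = 6 \<or> n = 3 \<and> d = 6 \<and> m0 = 0 \<or>
       (\<exists>t\<in>?T. int n = 2 * fst t \<and> int d = fst (snd t) \<and> int m0 = fst (snd (snd t)))"
      using sporadic by (simp only: insert_iff empty_iff prod.inject) (elim disjE conjE; simp)
    then show ?thesis
    proof (elim disjE)
      assume "n = 5 \<and> (d = 9 \<and> m0 \<le> 2 \<or> d = 8 \<and> m0 = 0)"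
      then show ?thesis by (intro conic) simp_all
    next
      assume "n = 7 \<and> d = 12 \<and> m0 = 6"
      then show ?thesis by (intro sextic) simp_all
    next
      assume "n = 3 \<and> d = 6 \<and> m0 = 0"
      then show ?thesis by (intro triangle) simp_all
    next
      assume "\<exists>t\<in>?T. int n = 2 * fst t \<and> int d = fst (snd t) \<and> int m0 = fst (snd (snd t))"
      then obtain t where t: "t \<in> ?T" "int n = 2 * fst t" "int d = fst (snd t)" "int m0 = fst (snd (snd t))"
        by (elim bexE conjE)
      have "\<forall>t\<in>?T. (case t of (e, D, m, N) \<Rightarrow> 1 \<le> e \<and> 2 \<le> N \<and> N \<le> 4 \<and> D * e - m * (e - 1) - 8 * e = - N \<and>
         N * e \<le> D \<and> N * (e - 1) \<le> m \<and> 0 \<le> D * (D + 3) - m * (m + 1) - 40 * e + N * (N - 1))" by simp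
      from this[rule_format, OF t(1)] show ?thesis
        using R[of "fst t" "fst (snd t)" "fst (snd (snd t))" "snd (snd (snd t))"] t(2-4)
        unfolding case_prod_unfold by simp
    qed
  qed
qed

lemma for_general_points_mono:
  assumes "for_general_points n P" "\<And>p. P p \<Longrightarrow> Q p"
  shows "for_general_points n Q"
proof -
  obtain Z where "zariski_closed n Z" "Z \<noteq> point_tuples n" "\<forall>p\<in>point_tuples n - Z. P p"
    using assms(1) unfolding for_general_points_def by (elim exE conjE)
  then show ?thesis unfolding for_general_points_def using assms(2) by (intro exI[of _ Z] conjI ballI) simp_all
qed

lemma listed_iff:
  "listed x y z \<longleftrightarrow>
     (x, y, z) \<in> {(d, d, e) | d e. 4 * e \<le> d \<and> 4 \<le> 4 * e} \<or>
     (x, y, z) \<in> {(d, d - 1, e) | d e. 7 * e \<le> 2 * d \<and> 1 \<le> e} \<or>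
     (x, y, z) \<in> {(d, d - 2, e) | d e. 3 * e + 1 \<le> d \<and> 1 \<le> e} \<or>
     (x, y, z) \<in> {(6 * e, 6 * e - 2, 2 * e) | e. 1 \<le> e} \<or>
     (x, y, z) \<in> {(5 * e, 5 * e - 3, 2 * e) | e. 1 \<le> e} \<or>
     (x, y, z) \<in> {(5 * e + 1, 5 * e - 2, 2 * e) | e. 1 \<le> e} \<or>
     (x, y, z) \<in> {(4 * e, 4 * e - 4, 2 * e) | e. 1 \<le> e} \<or>
     (x, y, z) \<in> {(4 * e + 1, 4 * e - 3, 2 * e) | e. 1 \<le> e} \<or>
     (x, y, z) \<in> {(4 * e + 2, 4 * e - 2, 2 * e) | e. 1 \<le> e} \<or>
     (x, y, z) \<in> {(5, 0, 2), (6, 1, 2), (8, 3, 4), (9, 4, 4), (12, 7, 6), (15, 10, 8),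
         (6, 0, 2), (6, 0, 3), (8, 2, 4), (12, 6, 7),
         (9, 2, 5), (8, 0, 5), (9, 1, 5), (9, 0, 5)}"
proof -
  have f: "(x, y, z) \<in> {(d, d, e) | d e. 4 * e \<le> d \<and> 4 \<le> 4 * e} \<longleftrightarrow> 1 \<le> z \<and> y = x \<and> 4 * z \<le> x"
    "(x, y, z) \<in> {(d, d - 1, e) | d e. 7 * e \<le> 2 * d \<and> 1 \<le> e} \<longleftrightarrow> 1 \<le> z \<and> y = x - 1 \<and> 7 * z \<le> 2 * x"
    "(x, y, z) \<in> {(d, d - 2, e) | d e. 3 * e + 1 \<le> d \<and> 1 \<le> e} \<longleftrightarrow> 1 \<le> z \<and> y = x - 2 \<and> 3 * z + 1 \<le> x"
    by auto
  have g: "(x, y, z) \<in> {(f e, g e, 2 * e) | e. 1 \<le> e} \<longleftrightarrow> (\<exists>e\<ge>1. z = 2 * e \<and> (x, y) = (f e, g e))" for f g :: "int \<Rightarrow> int"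
    by auto
  have h: "(\<exists>e\<ge>1. z = 2 * e \<and> (x, y) \<in> {f1 e, f2 e, f3 e, f4 e, f5 e, f6 e}) \<longleftrightarrow>
      (\<exists>e\<ge>1. z = 2 * e \<and> (x, y) = f1 e) \<or> (\<exists>e\<ge>1. z = 2 * e \<and> (x, y) = f2 e) \<or> (\<exists>e\<ge>1. z = 2 * e \<and> (x, y) = f3 e) \<or>
      (\<exists>e\<ge>1. z = 2 * e \<and> (x, y) = f4 e) \<or> (\<exists>e\<ge>1. z = 2 * e \<and> (x, y) = f5 e) \<or> (\<exists>e\<ge>1. z = 2 * e \<and> (x, y) = f6 e)"
    for f1 f2 f3 f4 f5 f6 :: "int \<Rightarrow> int \<times> int"
    unfolding insert_iff empty_iff by blast
  show ?thesis
    unfolding listed_def f h conj_disj_distribL disj_assoc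
    unfolding g[of "\<lambda>e. 6 * e" "\<lambda>e. 6 * e - 2"] g[of "\<lambda>e. 5 * e" "\<lambda>e. 5 * e - 3"]
      g[of "\<lambda>e. 5 * e + 1" "\<lambda>e. 5 * e - 2"] g[of "\<lambda>e. 4 * e" "\<lambda>e. 4 * e - 4"]
      g[of "\<lambda>e. 4 * e + 1" "\<lambda>e. 4 * e - 3"] g[of "\<lambda>e. 4 * e + 2" "\<lambda>e. 4 * e - 2"]
    by (rule refl)
qed

lemma rational_bound_iff:
  fixes d e :: int
  shows "7 / 2 * real_of_int e \<le> real_of_int d \<longleftrightarrow> 7 * e \<le> 2 * d" (is ?A)
    and "1 \<le> 7 / 2 * real_of_int e \<longleftrightarrow> 1 \<le> e" (is ?B)
    and "(9 * real_of_int e + 1) / 3 \<le> real_of_int d \<longleftrightarrow> 3 * e + 1 \<le> d" (is ?C)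
    and "10 / 3 \<le> (9 * real_of_int e + 1) / 3 \<longleftrightarrow> 1 \<le> e" (is ?D)
proof -
  have "7 / 2 * real_of_int e \<le> real_of_int d \<longleftrightarrow> real_of_int (7 * e) \<le> real_of_int (2 * d)" by (simp add: field_simps)
  also have "\<dots> \<longleftrightarrow> 7 * e \<le> 2 * d" by (rule of_int_le_iff)
  finally show ?A .
  have "1 \<le> 7 / 2 * real_of_int e \<longleftrightarrow> real_of_int 2 \<le> real_of_int (7 * e)" by (simp add: field_simps)
  also have "\<dots> \<longleftrightarrow> 2 \<le> 7 * e" by (rule of_int_le_iff)
  also have "\<dots> \<longleftrightarrow> 1 \<le> e" by presburger
  finally show ?B .
  have "(9 * real_of_int e + 1) / 3 \<le> real_of_int d \<longleftrightarrow> real_of_int (9 * e + 1) \<le> real_of_int (3 * d)" by (simp add: field_simps)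
  also have "\<dots> \<longleftrightarrow> 9 * e + 1 \<le> 3 * d" by (rule of_int_le_iff)
  also have "\<dots> \<longleftrightarrow> 3 * e + 1 \<le> d" by presburger
  finally show ?C .
  have "10 / 3 \<le> (9 * real_of_int e + 1) / 3 \<longleftrightarrow> real_of_int 10 \<le> real_of_int (9 * e + 1)" by (simp add: field_simps)
  also have "\<dots> \<longleftrightarrow> 10 \<le> 9 * e + 1" by (rule of_int_le_iff)
  also have "\<dots> \<longleftrightarrow> 1 \<le> e" by presburger
  finally show ?D .
qed

theorem theorem2p1:
  fixes d m0 n :: nat
  shows "for_general_points n (\<lambda>p.
    minus_one_special n p (quasi_homogeneous d m0 4) \<longleftrightarrow>
    (int d, int m0, int n) \<in>
        {(d, d, e) | d e :: int. d \<ge> 4 * e \<and> 4 * e \<ge> 4}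
      \<union> {(d, d - 1, e) | d e :: int.
           real_of_int d \<ge> 7 / 2 * real_of_int e \<and> 7 / 2 * real_of_int e \<ge> 1}
      \<union> {(d, d - 2, e) | d e :: int.
           real_of_int d \<ge> (9 * real_of_int e + 1) / 3 \<and> (9 * real_of_int e + 1) / 3 \<ge> 10 / 3}
      \<union> {(6 * e, 6 * e - 2, 2 * e) | e :: int. e \<ge> 1}
      \<union> {(5 * e, 5 * e - 3, 2 * e) | e :: int. e \<ge> 1}
      \<union> {(5 * e + 1, 5 * e - 2, 2 * e) | e :: int. e \<ge> 1}
      \<union> {(4 * e, 4 * e - 4, 2 * e) | e :: int. e \<ge> 1}
      \<union> {(4 * e + 1, 4 * e - 3, 2 * e) | e :: int. e \<ge> 1}
      \<union> {(4 * e + 2, 4 * e - 2, 2 * e) | e :: int. e \<ge> 1}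
      \<union> {(5, 0, 2), (6, 1, 2), (8, 3, 4), (9, 4, 4), (12, 7, 6), (15, 10, 8),
         (6, 0, 2), (6, 0, 3), (8, 2, 4), (12, 6, 7),
         (9, 2, 5), (8, 0, 5), (9, 1, 5), (9, 0, 5)})"
  (is "for_general_points n (\<lambda>p. _ \<longleftrightarrow> ?list)")
proof -
  have list: "?list \<longleftrightarrow> listed (int d) (int m0) (int n)"
    unfolding rational_bound_iff Un_iff listed_iff by (simp only: disj_assoc)
  show ?thesis
    unfolding list
  proof (rule for_general_points_mono[OF good_general[of n "d + 6"]])
    fix p assume g: "good n (d + 6) p"
    show "minus_one_special n p (quasi_homogeneous d m0 4) \<longleftrightarrow> listed (int d) (int m0) (int n)"
      using special_imp_listed[OF g, of d m0] listed_imp_special[OF g, of d m0] by (intro iffI) simp_all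
  qed
qed

end
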